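(* Let $G$ be a finitely generated group with residual chain $(N_i)_{i\in\mathbb{N}}$. Let $p_1,p_2,p_3,\dots$ be a sequence of prime numbers going to infinity. Then the first $\ell^2$-Betti number of $G$ satisfies $$b_1^{(2)}(G)\ \ge\ \limsup_{i\to\infty}\frac{b_1(N_i,\mathbb{F}_{p_i})}{[G:N_i]}.$$
   Context: A residual chain of a group $G$ is a descending chain $N_0\ge N_1\ge N_2\ge\cdots$ of finite index normal subgroups of $G$ with $\bigcap_{n\in\mathbb{N}}N_n=\{1\}$. $b_1^{(2)}(G)$ is the first $\ell^2$-Betti number of $G$, and $b_1(N,K)=\dim_K H_1(N,K)$ for a field $K$. *)

theory Defs
  imports
    "HOL-Algebra.AbelCoset"
    "HOL-Algebra.Generated_Groups"
    "HOL-Analysis.Analysis"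
    "HOL-Number_Theory.Residues"
    "Jordan_Normal_Form.Missing_VectorSpace"
begin

section \<open>Finitely generated groups and residual chains\<close>

definition finitely_generated_group :: "('g, 'm) monoid_scheme \<Rightarrow> bool" where
  "finitely_generated_group G \<longleftrightarrow>
     group G \<and> (\<exists>S. finite S \<and> S \<subseteq> carrier G \<and> generate G S = carrier G)"

definition residual_chain :: "('g, 'm) monoid_scheme \<Rightarrow> (nat \<Rightarrow> 'g set) \<Rightarrow> bool" where
  "residual_chain G N \<longleftrightarrow>
     (\<forall>i. N i \<lhd> G \<and> finite (rcosets\<^bsub>G\<^esub> (N i)) \<and> N (Suc i) \<subseteq> N i) \<and>
     (\<Inter>i. N i) = {\<one>\<^bsub>G\<^esub>}"


section \<open>Group homology via the bar resolution\<close>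

text \<open>
  The library has quotients of abelian groups but not of modules; as for the library's own module
  records, the ring multiplication and unit of the record are irrelevant.
\<close>

definition quotient_module ::
    "('r, 'm, 'x) module_scheme \<Rightarrow> 'm set \<Rightarrow> ('r, 'm set) module" where
  "quotient_module M B =
     \<lparr>carrier = a_rcosets\<^bsub>M\<^esub> B, mult = undefined, one = undefined,
      zero = B, add = set_add M,
      smult = (\<lambda>r C. \<Union>x\<in>C. B +>\<^bsub>M\<^esub> (r \<odot>\<^bsub>M\<^esub> x))\<rparr>"

text \<open>
  Let \<open>R\<close> be a (not necessarily commutative) ring and \<open>\<rho>\<close> a homomorphism from \<open>G\<close> to the units
  of \<open>R\<close>; it makes \<open>R\<close> a right module over the group ring by \<open>r \<cdot> g = r \<otimes> \<rho> g\<close>. If \<open>F\<close> is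
  the bar resolution of the trivial module (free on the symbols \<open>[g1|...|gn]\<close>), the tensor product
  of \<open>R\<close> with \<open>F\<close> over the group ring is, in degree \<open>n\<close>, the free left \<open>R\<close>-module on the
  symbols \<open>[g1|...|gn]\<close>, with boundary map
  \<open>d [g1|...|gn] = \<rho> g1 [g2|...|gn] + (\<Sum>0<i<n. (-1)^i [g1|...|gi gi+1|...|gn])
     + (-1)^n [g1|...|gn-1]\<close>.
  Symbols are lists of length \<open>n\<close>, and chains are finitely supported functions on them. The homology
  of this complex is a left \<open>R\<close>-module.
\<close>

definition bar_chains ::
    "('g, 'm) monoid_scheme \<Rightarrow> ('r, 'x) ring_scheme \<Rightarrow> nat \<Rightarrow> ('r, 'g list \<Rightarrow> 'r) module" where
  "bar_chains G R n =
     \<lparr>carrier = {c. range c \<subseteq> carrier R \<and> finite {x. c x \<noteq> \<zero>\<^bsub>R\<^esub>} \<and>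
                    {x. c x \<noteq> \<zero>\<^bsub>R\<^esub>} \<subseteq> {x. length x = n \<and> set x \<subseteq> carrier G}},
      mult = undefined, one = undefined,
      zero = (\<lambda>x. \<zero>\<^bsub>R\<^esub>), add = (\<lambda>c d x. c x \<oplus>\<^bsub>R\<^esub> d x),
      smult = (\<lambda>r c x. r \<otimes>\<^bsub>R\<^esub> c x)\<rparr>"

definition bar_face :: "('g, 'm) monoid_scheme \<Rightarrow> nat \<Rightarrow> 'g list \<Rightarrow> 'g list" where
  "bar_face G i x =
     (if i = 0 then tl x
      else if i = length x then butlast x
      else take (i - 1) x @ (x ! (i - 1) \<otimes>\<^bsub>G\<^esub> x ! i) # drop (i + 1) x)"

text \<open>The coefficient of the symbol \<open>y\<close> in \<open>d x\<close>; the boundary map is zero in degree 0.\<close>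

definition bar_coeff ::
    "('g, 'm) monoid_scheme \<Rightarrow> ('r, 'x) ring_scheme \<Rightarrow> ('g \<Rightarrow> 'r) \<Rightarrow> 'g list \<Rightarrow> 'g list \<Rightarrow> 'r" where
  "bar_coeff G R \<rho> x y =
     (if x = [] then \<zero>\<^bsub>R\<^esub>
      else \<Oplus>\<^bsub>R\<^esub>i\<in>{i. i \<le> length x \<and> bar_face G i x = y}.
             (if i = 0 then \<rho> (hd x) else (\<ominus>\<^bsub>R\<^esub> \<one>\<^bsub>R\<^esub>) [^]\<^bsub>R\<^esub> i))"

definition bar_boundary ::
    "('g, 'm) monoid_scheme \<Rightarrow> ('r, 'x) ring_scheme \<Rightarrow> ('g \<Rightarrow> 'r) \<Rightarrow>
     ('g list \<Rightarrow> 'r) \<Rightarrow> 'g list \<Rightarrow> 'r" where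
  "bar_boundary G R \<rho> c =
     (\<lambda>y. \<Oplus>\<^bsub>R\<^esub>x\<in>{x. c x \<noteq> \<zero>\<^bsub>R\<^esub>}. c x \<otimes>\<^bsub>R\<^esub> bar_coeff G R \<rho> x y)"

definition bar_cycles ::
    "('g, 'm) monoid_scheme \<Rightarrow> ('r, 'x) ring_scheme \<Rightarrow> ('g \<Rightarrow> 'r) \<Rightarrow> nat \<Rightarrow> ('g list \<Rightarrow> 'r) set" where
  "bar_cycles G R \<rho> n =
     {c \<in> carrier (bar_chains G R n). bar_boundary G R \<rho> c = (\<lambda>y. \<zero>\<^bsub>R\<^esub>)}"

definition bar_boundaries ::
    "('g, 'm) monoid_scheme \<Rightarrow> ('r, 'x) ring_scheme \<Rightarrow> ('g \<Rightarrow> 'r) \<Rightarrow> nat \<Rightarrow> ('g list \<Rightarrow> 'r) set" where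
  "bar_boundaries G R \<rho> n = bar_boundary G R \<rho> ` carrier (bar_chains G R (Suc n))"

definition group_homology ::
    "('g, 'm) monoid_scheme \<Rightarrow> ('r, 'x) ring_scheme \<Rightarrow> ('g \<Rightarrow> 'r) \<Rightarrow> nat \<Rightarrow>
     ('r, ('g list \<Rightarrow> 'r) set) module" where
  "group_homology G R \<rho> n =
     quotient_module ((bar_chains G R n)\<lparr>carrier := bar_cycles G R \<rho> n\<rparr>) (bar_boundaries G R \<rho> n)"

text \<open>
  Betti numbers over a field \<open>K\<close>: the action on \<open>K\<close> is trivial. Being based on
  \<^const>\<open>vectorspace.dim\<close>, the value is meaningful only when the homology is finite-dimensional; in
  degree 1 this is the case for every finitely generated group.
\<close>

definition betti_number :: "nat \<Rightarrow> ('g, 'm) monoid_scheme \<Rightarrow> ('r, 'x) ring_scheme \<Rightarrow> nat" where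
  "betti_number n G K = vectorspace.dim K (group_homology G K (\<lambda>_. \<one>\<^bsub>K\<^esub>) n)"


section \<open>The group von Neumann algebra\<close>

text \<open>The Hilbert space of square-summable functions on \<open>G\<close>, extended by 0 outside the carrier.\<close>

definition l2 :: "('g, 'm) monoid_scheme \<Rightarrow> ('g \<Rightarrow> complex) set" where
  "l2 G = {f. (\<forall>x. x \<notin> carrier G \<longrightarrow> f x = 0) \<and>
              (\<lambda>x. (cmod (f x))\<^sup>2) summable_on carrier G}"

definition l2_norm :: "('g, 'm) monoid_scheme \<Rightarrow> ('g \<Rightarrow> complex) \<Rightarrow> real" where
  "l2_norm G f = sqrt (\<Sum>\<^sub>\<infinity>x\<in>carrier G. (cmod (f x))\<^sup>2)"

definition left_translation ::
    "('g, 'm) monoid_scheme \<Rightarrow> 'g \<Rightarrow> ('g \<Rightarrow> complex) \<Rightarrow> 'g \<Rightarrow> complex" where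
  "left_translation G g f =
     (\<lambda>x. if x \<in> carrier G then f (inv\<^bsub>G\<^esub> g \<otimes>\<^bsub>G\<^esub> x) else 0)"

text \<open>The bounded linear operators on \<^term>\<open>l2 G\<close> that commute with all left translations.\<close>

definition vN_algebra ::
    "('g, 'm) monoid_scheme \<Rightarrow> (('g \<Rightarrow> complex) \<Rightarrow> 'g \<Rightarrow> complex) ring" where
  "vN_algebra G =
     \<lparr>carrier = {T \<in> l2 G \<rightarrow>\<^sub>E l2 G.
        (\<forall>f\<in>l2 G. \<forall>h\<in>l2 G. T (\<lambda>x. f x + h x) = (\<lambda>x. T f x + T h x)) \<and>
        (\<forall>a. \<forall>f\<in>l2 G. T (\<lambda>x. a * f x) = (\<lambda>x. a * T f x)) \<and>
        (\<exists>C. \<forall>f\<in>l2 G. l2_norm G (T f) \<le> C * l2_norm G f) \<and>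
        (\<forall>g\<in>carrier G. \<forall>f\<in>l2 G.
           T (left_translation G g f) = left_translation G g (T f))},
      mult = (\<lambda>S T. \<lambda>f\<in>l2 G. S (T f)),
      one = (\<lambda>f\<in>l2 G. f),
      zero = (\<lambda>f\<in>l2 G. \<lambda>x. 0),
      add = (\<lambda>S T. \<lambda>f\<in>l2 G. \<lambda>x. S f x + T f x)\<rparr>"

text \<open>The homomorphism from \<open>G\<close> to the units of the von Neumann algebra.\<close>

definition right_translation ::
    "('g, 'm) monoid_scheme \<Rightarrow> 'g \<Rightarrow> ('g \<Rightarrow> complex) \<Rightarrow> 'g \<Rightarrow> complex" where
  "right_translation G g =
     (\<lambda>f\<in>l2 G. \<lambda>x. if x \<in> carrier G then f (x \<otimes>\<^bsub>G\<^esub> g) else 0)"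

text \<open>The trace of \<open>T\<close> is the inner product of \<open>T \<delta>\<close> with \<open>\<delta>\<close>, where \<open>\<delta>\<close> is the unit
  vector at the neutral element.\<close>

definition vN_trace ::
    "('g, 'm) monoid_scheme \<Rightarrow> (('g \<Rightarrow> complex) \<Rightarrow> 'g \<Rightarrow> complex) \<Rightarrow> complex" where
  "vN_trace G T = T (\<lambda>x. if x = \<one>\<^bsub>G\<^esub> then 1 else 0) \<one>\<^bsub>G\<^esub>"


section \<open>Lueck's dimension function and \<open>\<ell>\<^sup>2\<close>-Betti numbers\<close>

definition idempotent_matrix ::
    "('r, 'x) ring_scheme \<Rightarrow> nat \<Rightarrow> (nat \<Rightarrow> nat \<Rightarrow> 'r) \<Rightarrow> bool" where
  "idempotent_matrix R n A \<longleftrightarrow>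
     (\<forall>i<n. \<forall>j<n. A i j \<in> carrier R) \<and>
     (\<forall>i<n. \<forall>k<n. (\<Oplus>\<^bsub>R\<^esub>j\<in>{..<n}. A i j \<otimes>\<^bsub>R\<^esub> A j k) = A i k)"

text \<open>
  The left \<open>R\<close>-module of all \<open>x A\<close> with \<open>x\<close> a row vector of length \<open>n\<close>. For \<open>A\<close> idempotent
  these are, up to isomorphism, the finitely generated projective left \<open>R\<close>-modules.
\<close>

definition row_module ::
    "('r, 'x) ring_scheme \<Rightarrow> nat \<Rightarrow> (nat \<Rightarrow> nat \<Rightarrow> 'r) \<Rightarrow> ('r, nat \<Rightarrow> 'r) module" where
  "row_module R n A =
     (ring.func_space R {..<n})\<lparr>carrier :=
        (\<lambda>x. \<lambda>j\<in>{..<n}. \<Oplus>\<^bsub>R\<^esub>i\<in>{..<n}. x i \<otimes>\<^bsub>R\<^esub> A i j) ` ({..<n} \<rightarrow>\<^sub>E carrier R)\<rparr>"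

text \<open>
  The dimension of an arbitrary left module over the von Neumann algebra is the supremum of the
  dimensions of its finitely generated projective submodules, and the dimension of the module given
  by an idempotent matrix is the trace of the matrix (a real number, since the trace of an idempotent
  is real). Submodules isomorphic to a given module are the images of its injective homomorphisms.
\<close>

definition vN_dim ::
    "('g, 'm) monoid_scheme \<Rightarrow> (('g \<Rightarrow> complex) \<Rightarrow> 'g \<Rightarrow> complex, 'a, 'x) module_scheme \<Rightarrow> ereal" where
  "vN_dim G M =
     Sup {ereal (\<Sum>i<n. Re (vN_trace G (A i i))) | n A.
            idempotent_matrix (vN_algebra G) n A \<and>
            (\<exists>\<phi> \<in> module_hom (vN_algebra G) (row_module (vN_algebra G) n A) M.
               inj_on \<phi> (carrier (row_module (vN_algebra G) n A)))}"

text \<open>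
  The \<open>n\<close>-th \<open>\<ell>\<^sup>2\<close>-Betti number of \<open>G\<close> is the dimension of the \<open>n\<close>-th homology of \<open>G\<close> with
  coefficients in its von Neumann algebra; \<open>G\<close> need not satisfy any finiteness property.
\<close>

definition l2_betti_number :: "nat \<Rightarrow> ('g, 'm) monoid_scheme \<Rightarrow> ereal" where
  "l2_betti_number n G =
     vN_dim G (group_homology G (vN_algebra G) (right_translation G) n)"

end

theory Submission imports Defs begin

text \<open>
  Both sides of the inequality are compared with the same finite computation. Let \<open>s 0, ..., s (d - 1)\<close>
  generate \<open>G\<close> as a monoid. For a transitive right action of \<open>G\<close> on a set \<open>X\<close>, a function \<open>f\<close> on
  \<open>X \<times> {..<d}\<close> is a 1-cochain of the Schreier graph, whose edge \<open>(x, i)\<close> leads from \<open>x\<close> to \<open>x (s i)\<close>.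
  Call \<open>f\<close> harmonic to level \<open>m\<close> if it has divergence zero at each vertex and sums to zero along
  every path that spells a word of length at most \<open>m\<close> with trivial product. These conditions are
  given by finitely many rows over the integral group ring, the \<open>harmonic_rows\<close>. If
  \<open>\<Delta> = \<Sum> L\<^sup>* L\<close> is their Laplacian and \<open>c\<close> a bound for it, then \<open>1 - \<Delta> / c\<close>, the \<open>heat_step\<close>, is
  a symmetric contraction of square-summable functions that fixes exactly the harmonic ones.

  For \<open>X = G\<close>, let \<open>T\<close> be the heat step of level \<open>m\<close>. The powers of \<open>T\<close> converge to the projection
  onto its fixed vectors, and for growing \<open>m\<close> these projections converge to the projection \<open>P\<close> onto
  the functions that are harmonic to all levels (\<open>nested_contractions_projection\<close>). As \<open>P\<close> commutes
  with translations, it is an idempotent matrix over the von Neumann algebra. Its rows are 1-cycles,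
  and since its columns sum to zero along loops, they extend from the generators to crossed
  homomorphisms on \<open>G\<close>. Pairing with a crossed homomorphism annihilates boundaries and recovers the
  entries of a cycle \<open>x P\<close>, so the row module of \<open>P\<close> embeds into the first homology
  (\<open>row_module_embeds\<close>). Therefore the trace of \<open>P\<close> is at most the \<open>\<ell>\<^sup>2\<close>-Betti number, and
  for each \<open>e > 0\<close> there are \<open>m\<close> and \<open>k\<close> such that
  \<open>\<tau> = \<Sum>i<d. \<parallel>T\<^sup>k \<delta>(1, i)\<parallel>\<^sup>2\<close> exceeds it by at most \<open>e\<close> (\<open>harmonic_projection\<close>).

  For \<open>X = G/N\<close> with \<open>N\<close> of finite index, let \<open>b\<close> be the Betti number of \<open>N\<close> over the field with \<open>p\<close>
  elements. Homomorphisms from \<open>N\<close> to this field yield at least \<open>p\<^sup>b\<close> harmonic cochains modulo \<open>p\<close>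
  (\<open>card_homs_le_card_cochains\<close>). If the coefficients of each row have sum of absolute values at most
  \<open>l\<close>, then two harmonic cochains modulo \<open>p\<close> with close representatives differ by an integral solution
  of the equations, not merely by one modulo \<open>p\<close>. Cutting the box of representatives into
  \<open>l\<^bsup>|E|\<^esup>\<close> small boxes, where \<open>E = X \<times> {..<d}\<close>, bounds the number of harmonic cochains modulo
  \<open>p\<close> by \<open>l\<^bsup>|E|\<^esup> p\<^sup>r\<close>, where \<open>r\<close> is the dimension of the space of real harmonic cochains
  (\<open>card_solutions_mod_le\<close>). The heat step fixes that space, so \<open>r\<close> is at most the sum of
  \<open>\<parallel>T\<^sup>k \<delta>(x, i)\<parallel>\<^sup>2\<close> over \<open>E\<close>. Finally these norms depend on the action only within bounded
  distance of \<open>x\<close>: once \<open>N\<close> contains no nontrivial element of a certain finite set, as is the case for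
  all sufficiently late members of a residual chain, the sum is \<open>[G : N] \<tau>\<close> (\<open>heat_power_diagonal\<close>). Taking logarithms,
  \<open>b / [G : N] \<le> \<tau> + d ln l / ln p\<close>, where \<open>d\<close> and \<open>l\<close> are independent of \<open>N\<close> and \<open>p\<close>; the last summand
  vanishes in the limit as \<open>p\<close> grows.
\<close>

section \<open>The Hilbert space of square-summable functions\<close>

text \<open>
  The convergence arguments need a complete inner product space. Real scalars suffice for them;
  complex linearity is regarded as one of the symmetries of an operator, see \<open>twist\<close> below.
\<close>

typedef 'i ell2 = "{f :: 'i \<Rightarrow> complex. (\<lambda>x. (cmod (f x))\<^sup>2) summable_on UNIV}"
  morphisms coord Ell2
  by (rule exI[of _ "\<lambda>_. 0"]) simp

lemma coord_summable: "(\<lambda>x. (cmod (coord f x))\<^sup>2) summable_on A"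
  using coord[of f] summable_on_subset_banach[of _ UNIV A] by auto

lemma coord_Ell2:
  assumes "(\<lambda>x. (cmod (f x))\<^sup>2) summable_on UNIV" shows "coord (Ell2 f) = f"
  using assms by (simp add: Ell2_inverse)

lemma ell2_eqI: "(\<And>x. coord f x = coord g x) \<Longrightarrow> f = g"
  by (simp add: coord_inject[symmetric] ext)

lemma norm_square_add_le: "(cmod (a + b))\<^sup>2 \<le> 2 * (cmod a)\<^sup>2 + 2 * (cmod b)\<^sup>2"
proof -
  have "(cmod (a + b))\<^sup>2 \<le> (cmod a + cmod b)\<^sup>2"
    by (intro power_mono norm_triangle_ineq) auto
  also have "\<dots> \<le> 2 * (cmod a)\<^sup>2 + 2 * (cmod b)\<^sup>2"
    using sum_squares_bound[of "cmod a" "cmod b"] by (simp add: power2_sum)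
  finally show ?thesis .
qed

lemma square_summable_add:
  assumes "(\<lambda>x. (cmod (f x))\<^sup>2) summable_on A" "(\<lambda>x. (cmod (g x))\<^sup>2) summable_on A"
  shows "(\<lambda>x. (cmod (f x + g x))\<^sup>2) summable_on A"
  by (rule summable_on_comparison_test[OF summable_on_add[OF
        summable_on_cmult_right[OF assms(1), of 2] summable_on_cmult_right[OF assms(2), of 2]]])
     (auto intro: norm_square_add_le)

lemma square_summable_cmult:
  assumes "(\<lambda>x. (cmod (f x))\<^sup>2) summable_on A"
  shows "(\<lambda>x. (cmod (a * f x))\<^sup>2) summable_on A"
  using summable_on_cmult_right[OF assms, of "(cmod a)\<^sup>2"] by (simp add: norm_mult power_mult_distrib)

lemma inner_summable:
  assumes "(\<lambda>x. (cmod (f x))\<^sup>2) summable_on A" "(\<lambda>x. (cmod (g x))\<^sup>2) summable_on A"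
  shows "(\<lambda>x. f x \<bullet> g x) summable_on A"
proof (rule abs_summable_summable, rule Infinite_Sum.abs_summable_on_comparison_test')
  show "(\<lambda>x. (cmod (f x))\<^sup>2 + (cmod (g x))\<^sup>2) summable_on A"
    by (intro summable_on_add assms)
  fix x
  have "\<bar>f x \<bullet> g x\<bar> \<le> cmod (f x) * cmod (g x)"
    by (rule Cauchy_Schwarz_ineq2)
  also have "\<dots> \<le> (cmod (f x))\<^sup>2 + (cmod (g x))\<^sup>2"
    using sum_squares_bound[of "cmod (f x)" "cmod (g x)"] zero_le_power2[of "cmod (f x)"]
      zero_le_power2[of "cmod (g x)"] by linarith
  finally show "norm (f x \<bullet> g x) \<le> (cmod (f x))\<^sup>2 + (cmod (g x))\<^sup>2" by simp
qed

instantiation ell2 :: (type) real_vector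
begin

definition "0 = Ell2 (\<lambda>_. 0)"
definition "f + g = Ell2 (\<lambda>x. coord f x + coord g x)"
definition "- f = Ell2 (\<lambda>x. - coord f x)" for f :: "'a ell2"
definition "f - g = Ell2 (\<lambda>x. coord f x - coord g x)"
definition "r *\<^sub>R f = Ell2 (\<lambda>x. r *\<^sub>R coord f x)"

lemma coord_zero [simp]: "coord 0 = (\<lambda>_. 0)"
  by (simp add: zero_ell2_def coord_Ell2)

lemma coord_add: "coord (f + g) = (\<lambda>x. coord f x + coord g x)"
  by (simp add: plus_ell2_def coord_Ell2 square_summable_add coord_summable)

lemma coord_uminus: "coord (- f) = (\<lambda>x. - coord f x)"
  by (simp add: uminus_ell2_def coord_Ell2 coord_summable)

lemma coord_diff: "coord (f - g) = (\<lambda>x. coord f x - coord g x)"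
proof -
  have "(\<lambda>x. (cmod (coord f x + (- coord g x)))\<^sup>2) summable_on UNIV"
    by (rule square_summable_add) (simp_all add: coord_summable)
  then show ?thesis by (simp add: minus_ell2_def coord_Ell2)
qed

lemma coord_scaleR: "coord (r *\<^sub>R f) = (\<lambda>x. r *\<^sub>R coord f x)"
  using square_summable_cmult[OF coord_summable[of f UNIV], of "of_real r"]
  by (simp add: scaleR_ell2_def coord_Ell2 scaleR_conv_of_real)

lemmas coord_simps = coord_add coord_uminus coord_diff coord_scaleR

instance
  by standard (rule ell2_eqI; simp add: coord_simps algebra_simps)+

end

instantiation ell2 :: (type) real_inner
begin

definition "f \<bullet> g = (\<Sum>\<^sub>\<infinity>x. coord f x \<bullet> coord g x)"
definition "norm f = sqrt (f \<bullet> f)" for f :: "'a ell2"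
definition "sgn f = f /\<^sub>R norm f" for f :: "'a ell2"
definition "dist f g = norm (f - g)" for f :: "'a ell2"
definition [code del]: "(uniformity :: ('a ell2 \<times> 'a ell2) filter)
    = (INF e\<in>{0 <..}. principal {(x, y). dist x y < e})"
definition [code del]: "open (U :: 'a ell2 set)
    \<longleftrightarrow> (\<forall>x\<in>U. eventually (\<lambda>(x', y). x' = x \<longrightarrow> y \<in> U) uniformity)"

lemma coord_inner_summable: "(\<lambda>x. coord f x \<bullet> coord g x) summable_on A"
  by (intro inner_summable coord_summable)

instance
proof
  fix f g h :: "'a ell2" and r :: real
  show "dist f g = norm (f - g)" by (simp add: dist_ell2_def)
  show "sgn f = f /\<^sub>R norm f" by (simp add: sgn_ell2_def)
  show "uniformity = (INF e\<in>{0<..}. principal {(x, y::'a ell2). dist x y < e})"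
    by (simp add: uniformity_ell2_def)
  show "open U \<longleftrightarrow> (\<forall>x\<in>U. \<forall>\<^sub>F (x', y) in uniformity. x' = x \<longrightarrow> y \<in> U)" for U :: "'a ell2 set"
    by (simp add: open_ell2_def)
  show "f \<bullet> g = g \<bullet> f" by (simp add: inner_ell2_def inner_commute)
  show "(f + g) \<bullet> h = f \<bullet> h + g \<bullet> h"
    by (simp add: inner_ell2_def coord_add inner_add_left infsum_add coord_inner_summable)
  show "(r *\<^sub>R f) \<bullet> g = r * (f \<bullet> g)"
    by (simp add: inner_ell2_def coord_scaleR infsum_cmult_right coord_inner_summable)
  show "0 \<le> f \<bullet> f" unfolding inner_ell2_def by (rule infsum_nonneg) simp
  show "f \<bullet> f = 0 \<longleftrightarrow> f = 0"
  proof
    assume "f \<bullet> f = 0"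
    then have "coord f x \<bullet> coord f x = 0" for x
      by (intro nonneg_infsum_le_0D[of "\<lambda>x. coord f x \<bullet> coord f x" UNIV x])
         (simp_all add: inner_ell2_def coord_inner_summable)
    then show "f = 0" by (intro ell2_eqI) simp
  qed (simp add: inner_ell2_def)
  show "norm f = sqrt (f \<bullet> f)" by (simp add: norm_ell2_def)
qed

end

lemma coord_sum: "coord (sum F A) x = (\<Sum>a\<in>A. coord (F a) x)"
  by (induction A rule: infinite_finite_induct) (simp_all add: coord_add)

lemma norm_ell2: "(norm f)\<^sup>2 = (\<Sum>\<^sub>\<infinity>x. (cmod (coord f x))\<^sup>2)"
  by (simp add: power2_norm_eq_inner inner_ell2_def)

lemma finite_sum_le_norm_ell2:
  assumes "finite F" shows "(\<Sum>x\<in>F. (cmod (coord f x))\<^sup>2) \<le> (norm f)\<^sup>2"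
  unfolding norm_ell2 by (rule finite_sum_le_infsum) (auto simp: coord_summable assms)

lemma cmod_coord_le_norm: "cmod (coord f x) \<le> norm f"
  by (rule power2_le_imp_le) (use finite_sum_le_norm_ell2[of "{x}" f] in simp_all)

lemma square_summable_bounded:
  assumes "\<And>F. finite F \<Longrightarrow> (\<Sum>x\<in>F. (cmod (f x))\<^sup>2) \<le> B"
  shows "(\<lambda>x. (cmod (f x))\<^sup>2) summable_on UNIV" "(norm (Ell2 f))\<^sup>2 \<le> B"
proof -
  show *: "(\<lambda>x. (cmod (f x))\<^sup>2) summable_on UNIV"
    by (rule nonneg_bdd_above_summable_on) (auto intro: bdd_aboveI2 assms)
  show "(norm (Ell2 f))\<^sup>2 \<le> B"
    unfolding norm_ell2 coord_Ell2[OF *] by (rule infsum_le_finite_sums[OF *]) (rule assms)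
qed

instance ell2 :: (type) complete_space
proof
  fix X :: "nat \<Rightarrow> 'a ell2"
  assume X: "Cauchy X"
  have "Cauchy (\<lambda>n. coord (X n) x)" for x
  proof (rule metric_CauchyI)
    fix e :: real assume "e > 0"
    then obtain M where "\<forall>m\<ge>M. \<forall>n\<ge>M. dist (X m) (X n) < e" using metric_CauchyD[OF X] by blast
    then have "dist (coord (X m) x) (coord (X n) x) < e" if "m \<ge> M" "n \<ge> M" for m n
      using le_less_trans[OF cmod_coord_le_norm[of "X m - X n" x], of e] that
      by (simp add: dist_norm coord_diff)
    then show "\<exists>M. \<forall>m\<ge>M. \<forall>n\<ge>M. dist (coord (X m) x) (coord (X n) x) < e" by blast
  qed
  then have "\<forall>x. \<exists>l. (\<lambda>n. coord (X n) x) \<longlonglongrightarrow> l"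
    by (simp add: Cauchy_convergent_iff convergent_def)
  then obtain g where g: "\<And>x. (\<lambda>n. coord (X n) x) \<longlonglongrightarrow> g x" by metis
  have near: "(\<lambda>x. (cmod (coord (X m) x - g x))\<^sup>2) summable_on UNIV \<and>
      (norm (Ell2 (\<lambda>x. coord (X m) x - g x)))\<^sup>2 \<le> e\<^sup>2"
    if "e > 0" "\<forall>m\<ge>M. \<forall>n\<ge>M. dist (X m) (X n) < e" "m \<ge> M" for e M m
  proof -
    have "(\<Sum>x\<in>F. (cmod (coord (X m) x - g x))\<^sup>2) \<le> e\<^sup>2" if "finite F" for F
    proof (rule LIMSEQ_le_const2)
      show "(\<lambda>n. \<Sum>x\<in>F. (cmod (coord (X m) x - coord (X n) x))\<^sup>2)
          \<longlonglongrightarrow> (\<Sum>x\<in>F. (cmod (coord (X m) x - g x))\<^sup>2)"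
        by (intro tendsto_intros g)
      have "(\<Sum>x\<in>F. (cmod (coord (X m) x - coord (X n) x))\<^sup>2) \<le> e\<^sup>2" if "n \<ge> M" for n
      proof -
        have "(\<Sum>x\<in>F. (cmod (coord (X m) x - coord (X n) x))\<^sup>2) \<le> (norm (X m - X n))\<^sup>2"
          using finite_sum_le_norm_ell2[OF \<open>finite F\<close>, of "X m - X n"] by (simp add: coord_diff)
        also have "\<dots> \<le> e\<^sup>2"
          using \<open>\<forall>m\<ge>M. \<forall>n\<ge>M. dist (X m) (X n) < e\<close> \<open>m \<ge> M\<close> that by (intro power_mono) (auto simp: dist_norm less_imp_le)
        finally show ?thesis .
      qed
      then show "\<exists>N. \<forall>n\<ge>N. (\<Sum>x\<in>F. (cmod (coord (X m) x - coord (X n) x))\<^sup>2) \<le> e\<^sup>2" by blast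
    qed
    from square_summable_bounded[OF this] show ?thesis by blast
  qed
  obtain M where M: "\<forall>m\<ge>M. \<forall>n\<ge>M. dist (X m) (X n) < 1" using metric_CauchyD[OF X, of 1] by auto
  have "(\<lambda>x. (cmod (coord (X M) x - (coord (X M) x - g x)))\<^sup>2) summable_on UNIV"
    using square_summable_add[OF coord_summable[of "X M"], of "\<lambda>x. - (coord (X M) x - g x)"]
      near[OF _ M, of M] by (simp add: norm_minus_commute)
  then have gs: "(\<lambda>x. (cmod (g x))\<^sup>2) summable_on UNIV" by simp
  have "X \<longlonglongrightarrow> Ell2 g"
  proof (rule metric_LIMSEQ_I)
    fix r :: real assume "r > 0"
    then obtain M where M: "\<forall>m\<ge>M. \<forall>n\<ge>M. dist (X m) (X n) < r / 2"
      using metric_CauchyD[OF X, of "r/2"] by auto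
    have "dist (X m) (Ell2 g) < r" if "m \<ge> M" for m
    proof -
      have eq: "Ell2 (\<lambda>x. coord (X m) x - g x) = X m - Ell2 g"
        by (simp add: minus_ell2_def coord_Ell2[OF gs])
      have "(norm (X m - Ell2 g))\<^sup>2 \<le> (r/2)\<^sup>2"
        unfolding eq[symmetric] using near[OF _ M that] \<open>r > 0\<close> by simp
      then have "norm (X m - Ell2 g) \<le> r/2" 
        by (rule power2_le_imp_le) (use \<open>r > 0\<close> in simp)
      then show ?thesis using \<open>r > 0\<close> by (simp add: dist_norm)
    qed
    then show "\<exists>no. \<forall>n\<ge>no. dist (X n) (Ell2 g) < r" by blast
  qed
  then show "convergent X" by (rule convergentI)
qed

definition unit_vec :: "'i \<Rightarrow> 'i ell2" where
  "unit_vec i = Ell2 (\<lambda>x. if x = i then 1 else 0)"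

lemma coord_unit_vec: "coord (unit_vec i) = (\<lambda>x. if x = i then 1 else 0)"
proof -
  have "(\<lambda>x. (cmod (if x = i then 1 else 0))\<^sup>2) summable_on UNIV"
    by (rule finite_nonzero_values_imp_summable_on) (auto intro: finite_subset[of _ "{i}"])
  then show ?thesis by (simp add: unit_vec_def coord_Ell2)
qed

lemma inner_unit_vec: "unit_vec i \<bullet> f = Re (coord f i)"
proof -
  have eq: "coord (unit_vec i) x \<bullet> coord f x = (if x = i then Re (coord f i) else 0)" for x
    by (simp add: coord_unit_vec inner_complex_def)
  have "unit_vec i \<bullet> f = (\<Sum>\<^sub>\<infinity>x\<in>{i}. if x = i then Re (coord f i) else 0)"
    unfolding inner_ell2_def eq by (rule infsum_cong_neutral) simp_all
  then show ?thesis by simp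
qed

section \<open>Projections as limits of powers of contractions\<close>

text \<open>
  The squared norms of \<open>A m x\<close> decrease, hence form a Cauchy sequence, and the last hypothesis
  transfers this to the vectors \<open>A m x\<close> themselves.
\<close>

lemma decreasing_operators_limit:
  fixes A :: "nat \<Rightarrow> 'h::{real_inner,complete_space} \<Rightarrow> 'h"
  assumes lin: "\<And>m. linear (A m)"
    and sym: "\<And>m x y. A m x \<bullet> y = x \<bullet> A m y"
    and contr: "\<And>m x. norm (A m x) \<le> norm x"
    and diff: "\<And>m n x. m \<le> n \<Longrightarrow> (norm (A m x - A n x))\<^sup>2 \<le> (norm (A m x))\<^sup>2 - (norm (A n x))\<^sup>2"
  shows "\<exists>P. linear P \<and> (\<forall>x y. P x \<bullet> y = x \<bullet> P y) \<and> (\<forall>x. norm (P x) \<le> norm x) \<and>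
    (\<forall>x. (\<lambda>m. A m x) \<longlonglongrightarrow> P x)"
proof -
  have "convergent (\<lambda>m. A m x)" for x
  proof -
    have "decseq (\<lambda>m. (norm (A m x))\<^sup>2)"
      unfolding decseq_def using diff[of _ _ x] zero_le_power2 by (metis diff_ge_0_iff_ge order_trans)
    then obtain L where "(\<lambda>m. (norm (A m x))\<^sup>2) \<longlonglongrightarrow> L"
      by (rule decseq_convergent[of _ 0]) auto
    then have C: "Cauchy (\<lambda>m. (norm (A m x))\<^sup>2)" by (auto intro: LIMSEQ_imp_Cauchy)
    have "Cauchy (\<lambda>m. A m x)"
    proof (rule CauchyI')
      fix e :: real assume "e > 0"
      then obtain M where M: "\<And>m n. m \<ge> M \<Longrightarrow> n \<ge> M \<Longrightarrow>
          \<bar>(norm (A m x))\<^sup>2 - (norm (A n x))\<^sup>2\<bar> < e\<^sup>2"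
        using CauchyD[OF C, of "e\<^sup>2"] by auto
      have "norm (A m x - A n x) < e" if "M \<le> m" "m < n" for m n
      proof (rule power2_less_imp_less)
        show "(norm (A m x - A n x))\<^sup>2 < e\<^sup>2"
          using diff[of m n x] M[of m n] that by auto
        show "0 \<le> e" using \<open>e > 0\<close> by simp
      qed
      then show "\<exists>M. \<forall>m\<ge>M. \<forall>n>m. dist (A m x) (A n x) < e" unfolding dist_norm by blast
    qed
    then show ?thesis by (rule Cauchy_convergent)
  qed
  then obtain P where P: "\<And>x. (\<lambda>m. A m x) \<longlonglongrightarrow> P x"
    unfolding convergent_def by metis
  show ?thesis
  proof (intro exI[of _ P] conjI allI)
    show "linear P"
    proof (rule linearI)
      fix x y
      have "(\<lambda>m. A m (x + y)) \<longlonglongrightarrow> P x + P y"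
        unfolding linear_add[OF lin] by (intro tendsto_intros P)
      then show "P (x + y) = P x + P y" by (rule LIMSEQ_unique[OF P])
    next
      fix r x
      have "(\<lambda>m. A m (r *\<^sub>R x)) \<longlonglongrightarrow> r *\<^sub>R P x"
        unfolding linear_scale[OF lin] by (intro tendsto_intros P)
      then show "P (r *\<^sub>R x) = r *\<^sub>R P x" by (rule LIMSEQ_unique[OF P])
    qed
    show "P x \<bullet> y = x \<bullet> P y" for x y
    proof (rule LIMSEQ_unique)
      show "(\<lambda>m. A m x \<bullet> y) \<longlonglongrightarrow> P x \<bullet> y" by (intro tendsto_intros P)
      show "(\<lambda>m. A m x \<bullet> y) \<longlonglongrightarrow> x \<bullet> P y" unfolding sym by (intro tendsto_intros P)
    qed
    show "norm (P x) \<le> norm x" for x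
      by (rule LIMSEQ_le_const2[OF tendsto_norm[OF P]]) (use contr in blast)
  qed (rule P)
qed

lemma LIMSEQ_exists_less:
  fixes f :: "nat \<Rightarrow> real"
  assumes "f \<longlonglongrightarrow> y" "e > 0"
  shows "\<exists>n. f n < y + e"
proof -
  have "eventually (\<lambda>n. f n < y + e) sequentially"
    by (rule order_tendstoD(2)[OF assms(1)]) (use assms(2) in simp)
  then show ?thesis using eventually_happens' sequentially_bot by blast
qed

lemma funpow_symmetric:
  fixes T :: "'h::real_inner \<Rightarrow> 'h"
  assumes "\<And>x y. T x \<bullet> y = x \<bullet> T y"
  shows "(T ^^ k) x \<bullet> y = x \<bullet> (T ^^ k) y"
  by (induction k arbitrary: x y) (simp_all add: assms funpow_swap1)

lemma linear_funpow:
  fixes T :: "'h::real_vector \<Rightarrow> 'h"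
  assumes "linear T" shows "linear (T ^^ k)"
  by (induction k) (auto simp: linear_iff linear_add[OF assms] linear_scale[OF assms])

text \<open>
  By symmetry the inner product of two powers with exponents of the same parity is the squared norm
  of a power in the middle; this is why only even powers are considered. On the limit \<open>T\<close> acts as an
  involution, hence isometrically, so that \<open>fixed\<close> applies.
\<close>

lemma contraction_powers_limit:
  fixes T :: "'h::{real_inner,complete_space} \<Rightarrow> 'h"
  assumes lin: "linear T"
    and sym: "\<And>x y. T x \<bullet> y = x \<bullet> T y"
    and contr: "\<And>x. norm (T x) \<le> norm x"
    and fixed: "\<And>x. norm (T x) = norm x \<Longrightarrow> T x = x"
  shows "\<exists>P. linear P \<and> (\<forall>x y. P x \<bullet> y = x \<bullet> P y) \<and> (\<forall>x. norm (P x) \<le> norm x) \<and>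
    (\<forall>x. (\<lambda>k. (T ^^ (2 * k)) x) \<longlonglongrightarrow> P x) \<and> (\<forall>x. T (P x) = P x) \<and>
    (\<forall>x. T x = x \<longrightarrow> P x = x)"
proof -
  have powc: "norm ((T ^^ k) x) \<le> norm x" for k x
    by (induction k) (auto intro: order_trans[OF contr])
  have dec: "(norm ((T ^^ n) x))\<^sup>2 \<le> (norm ((T ^^ m) x))\<^sup>2" if "m \<le> n" for m n x
  proof -
    have "(T ^^ n) x = (T ^^ (n - m)) ((T ^^ m) x)"
      using that by (metis comp_apply funpow_add le_add_diff_inverse2)
    then show ?thesis using powc by (simp add: power_mono)
  qed
  have inn: "(T ^^ m) x \<bullet> (T ^^ n) x = (norm ((T ^^ k) x))\<^sup>2" if "m + n = 2 * k" for m n k x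
  proof -
    have "(T ^^ m) x \<bullet> (T ^^ n) x = x \<bullet> (T ^^ (m + n)) x"
      by (simp add: funpow_symmetric[OF sym] funpow_add)
    also have "\<dots> = x \<bullet> (T ^^ k) ((T ^^ k) x)" using that by (simp add: mult_2 funpow_add)
    finally show ?thesis by (simp add: funpow_symmetric[OF sym, symmetric] power2_norm_eq_inner)
  qed
  have diff: "(norm ((T ^^ (2 * m)) x - (T ^^ (2 * n)) x))\<^sup>2
        \<le> (norm ((T ^^ (2 * m)) x))\<^sup>2 - (norm ((T ^^ (2 * n)) x))\<^sup>2" if "m \<le> n" for m n x
  proof -
    have "(norm ((T ^^ (2 * m)) x - (T ^^ (2 * n)) x))\<^sup>2 =
        (norm ((T ^^ (2 * m)) x))\<^sup>2 - 2 * ((T ^^ (2 * m)) x \<bullet> (T ^^ (2 * n)) x)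
        + (norm ((T ^^ (2 * n)) x))\<^sup>2"
      by (simp add: power2_norm_eq_inner inner_diff inner_commute)
    moreover have "(T ^^ (2 * m)) x \<bullet> (T ^^ (2 * n)) x = (norm ((T ^^ (m + n)) x))\<^sup>2"
      by (rule inn) simp
    moreover have "\<dots> \<ge> (norm ((T ^^ (2 * n)) x))\<^sup>2" using \<open>m \<le> n\<close> by (intro dec) simp
    ultimately show ?thesis by linarith
  qed
  obtain P where P: "linear P" "\<And>x y. P x \<bullet> y = x \<bullet> P y" "\<And>x. norm (P x) \<le> norm x"
    "\<And>x. (\<lambda>k. (T ^^ (2 * k)) x) \<longlonglongrightarrow> P x"
    using decreasing_operators_limit[of "\<lambda>k. T ^^ (2 * k)",
          OF linear_funpow[OF lin] funpow_symmetric[OF sym] powc diff] by metis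
  show ?thesis
  proof (intro exI[of _ P] conjI allI impI P)
    fix x
    have bl: "bounded_linear T"
      by (rule bounded_linear_intro[of _ 1]) (auto simp: linear_add[OF lin] linear_scale[OF lin] contr)
    have "(\<lambda>k. T (T ((T ^^ (2 * k)) x))) \<longlonglongrightarrow> T (T (P x))"
      by (rule bounded_linear.tendsto[OF bl bounded_linear.tendsto[OF bl P(4)]])
    then have "(\<lambda>k. (T ^^ (2 * Suc k)) x) \<longlonglongrightarrow> T (T (P x))" by simp
    moreover have "(\<lambda>k. (T ^^ (2 * Suc k)) x) \<longlonglongrightarrow> P x"
      using LIMSEQ_Suc[OF P(4)] .
    ultimately have "T (T (P x)) = P x" by (rule LIMSEQ_unique)
    then show "T (P x) = P x" using contr[of "P x"] contr[of "T (P x)"] by (intro fixed) simp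
  next
    fix x assume "T x = x"
    then have "(T ^^ k) x = x" for k by (induction k) auto
    then show "P x = x" using P(4)[of x] by (simp add: LIMSEQ_const_iff)
  qed
qed

text \<open>
  The projections onto the fixed spaces of the \<open>T m\<close> decrease, so they converge to the projection
  onto the intersection of these spaces. Finitely many of its norms are approximated by those of a
  single power of a single \<open>T m\<close>; this reduces the dimension of an infinite-dimensional space to a
  computation of finite range.
\<close>

lemma nested_contractions_projection:
  fixes T :: "nat \<Rightarrow> 'h::{real_inner,complete_space} \<Rightarrow> 'h"
  assumes lin: "\<And>m. linear (T m)"
    and sym: "\<And>m x y. T m x \<bullet> y = x \<bullet> T m y"
    and contr: "\<And>m x. norm (T m x) \<le> norm x"
    and fixed: "\<And>m x. norm (T m x) = norm x \<Longrightarrow> T m x = x"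
    and nested: "\<And>m x. T (Suc m) x = x \<Longrightarrow> T m x = x"
  obtains P where "linear P" "\<And>x y. P x \<bullet> y = x \<bullet> P y" "\<And>x. norm (P x) \<le> norm x"
    "\<And>m x. T m (P x) = P x" "\<And>x. P (P x) = P x"
    "\<And>R x. bounded_linear R \<Longrightarrow> (\<And>m x. R (T m x) = T m (R x)) \<Longrightarrow> R (P x) = P (R x)"
    "\<And>A e. finite A \<Longrightarrow> e > 0 \<Longrightarrow>
        \<exists>m k. (\<Sum>a\<in>A. (norm ((T m ^^ k) a))\<^sup>2) \<le> (\<Sum>a\<in>A. (norm (P a))\<^sup>2) + e"
proof -
  have "\<forall>m. \<exists>P. linear P \<and> (\<forall>x y. P x \<bullet> y = x \<bullet> P y) \<and> (\<forall>x. norm (P x) \<le> norm x) \<and>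
      (\<forall>x. (\<lambda>k. (T m ^^ (2 * k)) x) \<longlonglongrightarrow> P x) \<and> (\<forall>x. T m (P x) = P x) \<and> (\<forall>x. T m x = x \<longrightarrow> P x = x)"
    by (rule allI) (rule contraction_powers_limit[OF lin sym contr fixed])
  from choice[OF this] obtain Q where Q0: "\<forall>m. linear (Q m) \<and> (\<forall>x y. Q m x \<bullet> y = x \<bullet> Q m y) \<and>
      (\<forall>x. norm (Q m x) \<le> norm x) \<and> (\<forall>x. (\<lambda>k. (T m ^^ (2 * k)) x) \<longlonglongrightarrow> Q m x) \<and>
      (\<forall>x. T m (Q m x) = Q m x) \<and> (\<forall>x. T m x = x \<longrightarrow> Q m x = x)"
    by (rule exE)
  then have Q: "\<And>m. linear (Q m)" "\<And>m x y. Q m x \<bullet> y = x \<bullet> Q m y"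
    "\<And>m x. norm (Q m x) \<le> norm x" "\<And>m x. (\<lambda>k. (T m ^^ (2 * k)) x) \<longlonglongrightarrow> Q m x"
    "\<And>m x. T m (Q m x) = Q m x" "\<And>m x. T m x = x \<Longrightarrow> Q m x = x"
    by blast+
  have nest: "T m x = x" if "m \<le> n" "T n x = x" for m n x
    using that by (induction rule: dec_induct) (auto dest: nested)
  have QQ: "Q m (Q n x) = Q n x" if "m \<le> n" for m n x
    using nest[OF that Q(5)] by (rule Q(6))
  have diff: "(norm (Q m x - Q n x))\<^sup>2 \<le> (norm (Q m x))\<^sup>2 - (norm (Q n x))\<^sup>2"
    if "m \<le> n" for m n x
  proof -
    have "(norm (Q m x - Q n x))\<^sup>2 = (norm (Q m x))\<^sup>2 - 2 * (Q m x \<bullet> Q n x) + (norm (Q n x))\<^sup>2"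
      by (simp add: power2_norm_eq_inner inner_diff inner_commute)
    moreover have "Q m x \<bullet> Q n x = x \<bullet> Q n (Q n x)" using QQ[OF \<open>m \<le> n\<close>] QQ[of n n] by (simp add: Q(2))
    moreover have "\<dots> = (norm (Q n x))\<^sup>2" by (simp add: Q(2)[symmetric] power2_norm_eq_inner)
    ultimately show ?thesis by linarith
  qed
  obtain P where P: "linear P" "\<And>x y. P x \<bullet> y = x \<bullet> P y" "\<And>x. norm (P x) \<le> norm x"
    "\<And>x. (\<lambda>m. Q m x) \<longlonglongrightarrow> P x"
    using decreasing_operators_limit[of Q, OF Q(1-3) diff] by metis
  have bl: "bounded_linear (Q m)" for m
    by (rule bounded_linear_intro[of _ 1]) (auto simp: linear_add[OF Q(1)] linear_scale[OF Q(1)] Q(3))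
  have QP: "Q m (P x) = P x" for m x
  proof (rule LIMSEQ_unique)
    show "(\<lambda>n. Q m (Q (n + m) x)) \<longlonglongrightarrow> Q m (P x)"
      by (rule bounded_linear.tendsto[OF bl LIMSEQ_ignore_initial_segment[OF P(4)]])
    show "(\<lambda>n. Q m (Q (n + m) x)) \<longlonglongrightarrow> P x"
      using LIMSEQ_ignore_initial_segment[OF P(4)[of x], of m] by (simp add: QQ)
  qed
  show thesis
  proof (rule that[OF P(1-3)])
    show "T m (P x) = P x" for m x using Q(5)[of m "P x"] by (simp add: QP)
    show "P (P x) = P x" for x using P(4)[of "P x"] by (simp add: QP LIMSEQ_const_iff)
    fix R :: "'h \<Rightarrow> 'h" and x assume R: "bounded_linear R" "\<And>m x. R (T m x) = T m (R x)"
    have "R ((T m ^^ k) y) = (T m ^^ k) (R y)" for m k y by (induction k) (simp_all add: R(2))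
    then have "(\<lambda>k. (T m ^^ (2 * k)) (R y)) \<longlonglongrightarrow> R (Q m y)" for m y
      using bounded_linear.tendsto[OF R(1) Q(4)[of m y]] by simp
    then have RQ: "R (Q m y) = Q m (R y)" for m y by (rule LIMSEQ_unique[OF _ Q(4)])
    have "(\<lambda>m. Q m (R x)) \<longlonglongrightarrow> R (P x)"
      unfolding RQ[symmetric] by (rule bounded_linear.tendsto[OF R(1) P(4)])
    then show "R (P x) = P (R x)" by (rule LIMSEQ_unique[OF _ P(4)])
  next
    fix A :: "'h set" and e :: real assume "finite A" "e > 0"
    have "(\<lambda>m. \<Sum>a\<in>A. (norm (Q m a))\<^sup>2) \<longlonglongrightarrow> (\<Sum>a\<in>A. (norm (P a))\<^sup>2)"
      by (intro tendsto_intros P(4))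
    then obtain m where m: "(\<Sum>a\<in>A. (norm (Q m a))\<^sup>2) < (\<Sum>a\<in>A. (norm (P a))\<^sup>2) + e / 2"
      using LIMSEQ_exists_less[of _ _ "e / 2"] \<open>e > 0\<close> by fastforce
    have "(\<lambda>k. \<Sum>a\<in>A. (norm ((T m ^^ (2 * k)) a))\<^sup>2) \<longlonglongrightarrow> (\<Sum>a\<in>A. (norm (Q m a))\<^sup>2)"
      by (intro tendsto_intros Q(4))
    then obtain k where k: "(\<Sum>a\<in>A. (norm ((T m ^^ (2 * k)) a))\<^sup>2) < (\<Sum>a\<in>A. (norm (Q m a))\<^sup>2) + e / 2"
      using LIMSEQ_exists_less[of _ _ "e / 2"] \<open>e > 0\<close> by fastforce
    from m k have "(\<Sum>a\<in>A. (norm ((T m ^^ (2 * k)) a))\<^sup>2) \<le> (\<Sum>a\<in>A. (norm (P a))\<^sup>2) + e" by linarith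
    then show "\<exists>m k. (\<Sum>a\<in>A. (norm ((T m ^^ k) a))\<^sup>2) \<le> (\<Sum>a\<in>A. (norm (P a))\<^sup>2) + e" by blast
  qed
qed

section \<open>Rows of group ring elements acting on square-summable functions\<close>

text \<open>
  A list of entries \<open>(i, c, g)\<close> stands for the row vector over the integral group ring that is the
  sum of the terms \<open>c g\<close> in position \<open>i\<close>. A list rather than a function is used because paths in the
  Schreier graph translate into lists step by step.
\<close>

type_synonym 'g row = "(nat \<times> int \<times> 'g) list"

definition row_apply :: "('x \<Rightarrow> 'g \<Rightarrow> 'x) \<Rightarrow> 'g row \<Rightarrow> ('x \<times> nat \<Rightarrow> 'b::comm_ring_1) \<Rightarrow> 'x \<Rightarrow> 'b" where
  "row_apply act L f x = (\<Sum>(i, c, g)\<leftarrow>L. of_int c * f (act x g, i))"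

definition row_weight :: "'g row \<Rightarrow> real" where
  "row_weight L = (\<Sum>(i, c, g)\<leftarrow>L. \<bar>of_int c\<bar>)"

definition valid_row :: "('g, 'm) monoid_scheme \<Rightarrow> nat \<Rightarrow> 'g row \<Rightarrow> bool" where
  "valid_row G d L \<longleftrightarrow> (\<forall>(i, c, g)\<in>set L. i < d \<and> g \<in> carrier G)"

definition shift :: "'x set \<Rightarrow> ('x \<Rightarrow> 'g \<Rightarrow> 'x) \<Rightarrow> nat \<Rightarrow> 'g \<Rightarrow> ('x \<times> nat) ell2 \<Rightarrow> 'x ell2" where
  "shift X act i g f = Ell2 (\<lambda>x. if x \<in> X then coord f (act x g, i) else 0)"

definition shift_adj :: "('g, 'm) monoid_scheme \<Rightarrow> 'x set \<Rightarrow> ('x \<Rightarrow> 'g \<Rightarrow> 'x) \<Rightarrow>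
    nat \<Rightarrow> 'g \<Rightarrow> 'x ell2 \<Rightarrow> ('x \<times> nat) ell2" where
  "shift_adj G X act i g h =
     Ell2 (\<lambda>(x, j). if x \<in> X \<and> j = i then coord h (act x (inv\<^bsub>G\<^esub> g)) else 0)"

definition row_op :: "'x set \<Rightarrow> ('x \<Rightarrow> 'g \<Rightarrow> 'x) \<Rightarrow> 'g row \<Rightarrow> ('x \<times> nat) ell2 \<Rightarrow> 'x ell2" where
  "row_op X act L f = (\<Sum>(i, c, g)\<leftarrow>L. of_int c *\<^sub>R shift X act i g f)"

definition row_adj :: "('g, 'm) monoid_scheme \<Rightarrow> 'x set \<Rightarrow> ('x \<Rightarrow> 'g \<Rightarrow> 'x) \<Rightarrow> 'g row \<Rightarrow>
    'x ell2 \<Rightarrow> ('x \<times> nat) ell2" where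
  "row_adj G X act L h = (\<Sum>(i, c, g)\<leftarrow>L. of_int c *\<^sub>R shift_adj G X act i g h)"

text \<open>
  A bound for the Laplacian of the rows, by Cauchy-Schwarz; the summand 1 makes it positive even if
  there are no rows.
\<close>

definition row_bound :: "'g row set \<Rightarrow> real" where
  "row_bound rs = 1 + (\<Sum>L\<in>rs. (row_weight L)\<^sup>2)"

definition laplacian :: "('g, 'm) monoid_scheme \<Rightarrow> 'x set \<Rightarrow> ('x \<Rightarrow> 'g \<Rightarrow> 'x) \<Rightarrow> 'g row set \<Rightarrow>
    ('x \<times> nat) ell2 \<Rightarrow> ('x \<times> nat) ell2" where
  "laplacian G X act rs f = (\<Sum>L\<in>rs. row_adj G X act L (row_op X act L f))"

definition heat_step :: "('g, 'm) monoid_scheme \<Rightarrow> 'x set \<Rightarrow> ('x \<Rightarrow> 'g \<Rightarrow> 'x) \<Rightarrow> 'g row set \<Rightarrow>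
    ('x \<times> nat) ell2 \<Rightarrow> ('x \<times> nat) ell2" where
  "heat_step G X act rs f = f - (1 / row_bound rs) *\<^sub>R laplacian G X act rs f"

text \<open>
  The Laplacian as a pointwise formula, which shows that a value depends on only finitely many values
  of the argument.
\<close>

definition local_laplacian :: "('g, 'm) monoid_scheme \<Rightarrow> ('x \<Rightarrow> 'g \<Rightarrow> 'x) \<Rightarrow> 'g row set \<Rightarrow>
    ('x \<times> nat \<Rightarrow> complex) \<Rightarrow> 'x \<Rightarrow> nat \<Rightarrow> complex" where
  "local_laplacian G act rs f x j =
     (\<Sum>L\<in>rs. \<Sum>(i, c, g)\<leftarrow>L. if i = j then of_int c * row_apply act L f (act x (inv\<^bsub>G\<^esub> g)) else 0)"

lemma valid_row_Nil [simp]: "valid_row G d []"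
  and valid_row_Cons [simp]: "valid_row G d ((i, c, g) # L) \<longleftrightarrow> i < d \<and> g \<in> carrier G \<and> valid_row G d L"
  by (auto simp: valid_row_def)

lemma row_bound_pos: "row_bound rs > 0"
  unfolding row_bound_def by (intro add_pos_nonneg sum_nonneg) auto

locale right_action = group G for G :: "('g, 'm) monoid_scheme" (structure) +
  fixes X :: "'x set" and act :: "'x \<Rightarrow> 'g \<Rightarrow> 'x"
  assumes act_closed: "x \<in> X \<Longrightarrow> g \<in> carrier G \<Longrightarrow> act x g \<in> X"
    and act_one: "x \<in> X \<Longrightarrow> act x \<one> = x"
    and act_mult: "x \<in> X \<Longrightarrow> g \<in> carrier G \<Longrightarrow> h \<in> carrier G \<Longrightarrow> act (act x g) h = act x (g \<otimes> h)"
begin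

lemma act_inv1: "x \<in> X \<Longrightarrow> g \<in> carrier G \<Longrightarrow> act (act x g) (inv g) = x"
  and act_inv2: "x \<in> X \<Longrightarrow> g \<in> carrier G \<Longrightarrow> act (act x (inv g)) g = x"
  by (simp_all add: act_mult act_one)

lemma bij_betw_act: "g \<in> carrier G \<Longrightarrow> bij_betw (\<lambda>x. act x g) X X"
  by (rule bij_betwI[of _ _ _ "\<lambda>x. act x (inv g)"]) (auto simp: act_closed act_inv1 act_inv2)

lemma square_summable_shift:
  assumes "inj_on s Y"
  shows "(\<lambda>x. (cmod (if x \<in> Y then coord f (s x) else 0))\<^sup>2) summable_on UNIV \<and>
    (norm (Ell2 (\<lambda>x. if x \<in> Y then coord f (s x) else 0)))\<^sup>2 \<le> (norm f)\<^sup>2"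
proof -
  have "(\<Sum>x\<in>F. (cmod (if x \<in> Y then coord f (s x) else 0))\<^sup>2) \<le> (norm f)\<^sup>2" if "finite F" for F
  proof -
    have "(\<Sum>x\<in>F. (cmod (if x \<in> Y then coord f (s x) else 0))\<^sup>2)
        = (\<Sum>x\<in>F \<inter> Y. (cmod (coord f (s x)))\<^sup>2)"
      using that by (intro sum.mono_neutral_cong_right) auto
    also have "\<dots> = (\<Sum>y\<in>s ` (F \<inter> Y). (cmod (coord f y))\<^sup>2)"
      using inj_on_subset[OF assms, of "F \<inter> Y"] by (subst sum.reindex) auto
    also have "\<dots> \<le> (norm f)\<^sup>2" by (rule finite_sum_le_norm_ell2) (use that in auto)
    finally show ?thesis .
  qed
  from square_summable_bounded[OF this] show ?thesis by blast
qed

lemma inj_on_act_pair: "g \<in> carrier G \<Longrightarrow> inj_on (\<lambda>x. (act x g, i)) X"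
  using bij_betw_act[of g] by (auto simp: bij_betw_def inj_on_def)

lemma coord_shift:
  assumes "g \<in> carrier G"
  shows "coord (shift X act i g f) x = (if x \<in> X then coord f (act x g, i) else 0)"
  unfolding shift_def using square_summable_shift[OF inj_on_act_pair[OF assms, of i], of f]
  by (subst coord_Ell2) auto

lemma norm_shift:
  assumes "g \<in> carrier G" shows "norm (shift X act i g f) \<le> norm f"
  unfolding shift_def
  by (rule power2_le_imp_le[OF conjunct2[OF square_summable_shift[OF inj_on_act_pair[OF assms]]] norm_ge_zero])

lemma inj_on_act_slice: "g \<in> carrier G \<Longrightarrow> inj_on (\<lambda>(x, j). act x g) (X \<times> {i})"
  using bij_betw_act[of g] by (auto simp: bij_betw_def inj_on_def)

lemma shift_adj_alt: "shift_adj G X act i g h =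
    Ell2 (\<lambda>p. if p \<in> X \<times> {i} then coord h ((\<lambda>(x, j). act x (inv g)) p) else 0)"
  unfolding shift_adj_def by (rule arg_cong[of _ _ Ell2]) (auto simp: fun_eq_iff)

lemma coord_shift_adj:
  assumes "g \<in> carrier G"
  shows "coord (shift_adj G X act i g h) (x, j) = (if x \<in> X \<and> j = i then coord h (act x (inv g)) else 0)"
  unfolding shift_adj_alt
  using square_summable_shift[OF inj_on_act_slice[OF inv_closed[OF assms], of i], of h]
  by (subst coord_Ell2) auto

lemma norm_shift_adj:
  assumes "g \<in> carrier G" shows "norm (shift_adj G X act i g h) \<le> norm h"
  unfolding shift_adj_alt
  by (rule power2_le_imp_le[OF conjunct2[OF square_summable_shift[OF inj_on_act_slice[OF inv_closed[OF assms]]]] norm_ge_zero])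

text \<open>
  The action by \<open>g\<close> is a bijection of \<open>X\<close>, so reindexing moves \<open>g\<close> to the other argument.
\<close>

lemma inner_shift:
  assumes g: "g \<in> carrier G"
  shows "shift X act i g f \<bullet> h = f \<bullet> shift_adj G X act i g h"
proof -
  have "shift X act i g f \<bullet> h = (\<Sum>\<^sub>\<infinity>x\<in>X. coord f (act x g, i) \<bullet> coord h x)"
    unfolding inner_ell2_def by (rule infsum_cong_neutral) (auto simp: coord_shift[OF g])
  also have "\<dots> = (\<Sum>\<^sub>\<infinity>x\<in>X. coord f (act x g, i) \<bullet> coord h (act (act x g) (inv g)))"
    by (rule infsum_cong) (simp add: act_inv1 g)
  also have "\<dots> = (\<Sum>\<^sub>\<infinity>x\<in>X. coord f (x, i) \<bullet> coord h (act x (inv g)))"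
    by (rule infsum_reindex_bij_betw[OF bij_betw_act[OF g],
          of "\<lambda>x. coord f (x, i) \<bullet> coord h (act x (inv g))"])
  also have "\<dots> = (\<Sum>\<^sub>\<infinity>p\<in>(\<lambda>x. (x, i)) ` X. coord f p \<bullet> coord h (act (fst p) (inv g)))"
    by (subst infsum_reindex) (auto simp: inj_on_def o_def)
  also have "\<dots> = f \<bullet> shift_adj G X act i g h"
    unfolding inner_ell2_def
  proof (rule infsum_cong_neutral)
    fix p assume "p \<in> UNIV - (\<lambda>x. (x, i)) ` X"
    then show "coord f p \<bullet> coord (shift_adj G X act i g h) p = 0"
      by (cases p) (auto simp: coord_shift_adj[OF g])
  qed (auto simp: coord_shift_adj[OF g])
  finally show ?thesis .
qed

lemma shift_add: "g \<in> carrier G \<Longrightarrow> shift X act i g (f + f') = shift X act i g f + shift X act i g f'"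
  and shift_scaleR: "g \<in> carrier G \<Longrightarrow> shift X act i g (r *\<^sub>R f) = r *\<^sub>R shift X act i g f"
  by (rule ell2_eqI; simp add: coord_shift coord_simps)+

lemma shift_adj_add: "g \<in> carrier G \<Longrightarrow>
    shift_adj G X act i g (h + h') = shift_adj G X act i g h + shift_adj G X act i g h'"
  and shift_adj_scaleR: "g \<in> carrier G \<Longrightarrow> shift_adj G X act i g (r *\<^sub>R h) = r *\<^sub>R shift_adj G X act i g h"
proof -
  assume g: "g \<in> carrier G"
  show "shift_adj G X act i g (h + h') = shift_adj G X act i g h + shift_adj G X act i g h'"
  proof (rule ell2_eqI)
    fix p :: "'x \<times> nat"
    show "coord (shift_adj G X act i g (h + h')) p
        = coord (shift_adj G X act i g h + shift_adj G X act i g h') p"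
      by (cases p) (simp add: coord_shift_adj[OF g] coord_simps)
  qed
next
  assume g: "g \<in> carrier G"
  show "shift_adj G X act i g (r *\<^sub>R h) = r *\<^sub>R shift_adj G X act i g h"
  proof (rule ell2_eqI)
    fix p :: "'x \<times> nat"
    show "coord (shift_adj G X act i g (r *\<^sub>R h)) p = coord (r *\<^sub>R shift_adj G X act i g h) p"
      by (cases p) (simp add: coord_shift_adj[OF g] coord_simps)
  qed
qed

lemma row_op_Nil: "row_op X act [] f = 0"
  and row_op_Cons: "row_op X act ((i, c, g) # L) f = of_int c *\<^sub>R shift X act i g f + row_op X act L f"
  and row_adj_Nil: "row_adj G X act [] h = 0"
  and row_adj_Cons: "row_adj G X act ((i, c, g) # L) h = of_int c *\<^sub>R shift_adj G X act i g h + row_adj G X act L h"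
  by (simp_all add: row_op_def row_adj_def)

lemma linear_row_op:
  assumes "valid_row G d L" shows "linear (row_op X act L)"
  using assms
proof (induction L)
  case Nil then show ?case by (simp add: row_op_Nil linear_iff)
next
  case (Cons a L)
  obtain i c g where a: "a = (i, c, g)" by (cases a)
  have "linear (row_op X act L)" "g \<in> carrier G" using Cons a by auto
  then show ?case
    by (simp add: linear_iff a row_op_Cons shift_add shift_scaleR algebra_simps)
qed

lemma linear_row_adj:
  assumes "valid_row G d L" shows "linear (row_adj G X act L)"
  using assms
proof (induction L)
  case Nil then show ?case by (simp add: row_adj_Nil linear_iff)
next
  case (Cons a L)
  obtain i c g where a: "a = (i, c, g)" by (cases a)
  have "linear (row_adj G X act L)" "g \<in> carrier G" using Cons a by auto
  then show ?case
    by (simp add: linear_iff a row_adj_Cons shift_adj_add shift_adj_scaleR algebra_simps)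
qed

lemma inner_row_op:
  assumes "valid_row G d L" shows "row_op X act L f \<bullet> h = f \<bullet> row_adj G X act L h"
  using assms
proof (induction L)
  case Nil then show ?case by (simp add: row_op_Nil row_adj_Nil)
next
  case (Cons a L)
  obtain i c g where a: "a = (i, c, g)" by (cases a)
  with Cons show ?case
    by (simp add: row_op_Cons row_adj_Cons inner_add_left inner_add_right inner_shift)
qed

lemma norm_row_adj:
  assumes "valid_row G d L" shows "norm (row_adj G X act L h) \<le> row_weight L * norm h"
  using assms
proof (induction L)
  case Nil then show ?case by (simp add: row_adj_Nil row_weight_def)
next
  case (Cons a L)
  obtain i c g where a: "a = (i, c, g)" by (cases a)
  have "norm (row_adj G X act (a # L) h) \<le> \<bar>of_int c\<bar> * norm (shift_adj G X act i g h) + norm (row_adj G X act L h)"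
    unfolding a row_adj_Cons by (rule norm_triangle_le) simp
  also have "\<dots> \<le> \<bar>of_int c\<bar> * norm h + row_weight L * norm h"
    using Cons a by (intro add_mono mult_left_mono norm_shift_adj) auto
  finally show ?case by (simp add: a row_weight_def algebra_simps)
qed

lemma coord_row_op:
  assumes "valid_row G d L"
  shows "coord (row_op X act L f) x = (if x \<in> X then row_apply act L (coord f) x else 0)"
  using assms
proof (induction L)
  case Nil then show ?case by (simp add: row_op_Nil row_apply_def)
next
  case (Cons a L)
  obtain i c g where a: "a = (i, c, g)" by (cases a)
  with Cons show ?case
    by (simp add: row_op_Cons row_apply_def coord_simps coord_shift scaleR_conv_of_real)
qed

lemma coord_row_adj:
  assumes "valid_row G d L"
  shows "coord (row_adj G X act L h) (x, j) =
    (if x \<in> X then \<Sum>(i, c, g)\<leftarrow>L. if i = j then of_int c * coord h (act x (inv g)) else 0 else 0)"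
  using assms
proof (induction L)
  case Nil then show ?case by (simp add: row_adj_Nil)
next
  case (Cons a L)
  obtain i c g where a: "a = (i, c, g)" by (cases a)
  with Cons show ?case
    by (auto simp add: row_adj_Cons coord_simps coord_shift_adj scaleR_conv_of_real)
qed

context
  fixes d :: nat and rs :: "'g row set"
  assumes rs: "finite rs" "\<And>L. L \<in> rs \<Longrightarrow> valid_row G d L"
begin

lemma linear_laplacian: "linear (laplacian G X act rs)"
proof -
  have "linear (\<lambda>f. row_adj G X act L (row_op X act L f))" if "L \<in> rs" for L
    using linear_compose[OF linear_row_op[OF rs(2)[OF that]] linear_row_adj[OF rs(2)[OF that]]]
    by (simp add: o_def)
  then have "linear (\<lambda>f. \<Sum>L\<in>rs. row_adj G X act L (row_op X act L f))"
    by (intro linear_compose_sum) blast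
  then show ?thesis unfolding laplacian_def[abs_def] .
qed

lemma linear_heat_step: "linear (heat_step G X act rs)"
  unfolding heat_step_def[abs_def] linear_iff
  by (simp add: linear_add[OF linear_laplacian] linear_scale[OF linear_laplacian] algebra_simps)

lemma inner_laplacian: "laplacian G X act rs f \<bullet> h = (\<Sum>L\<in>rs. row_op X act L f \<bullet> row_op X act L h)"
  unfolding laplacian_def inner_sum_left
  by (rule sum.cong) (simp_all add: inner_row_op[OF rs(2)] inner_commute[of "row_adj _ _ _ _ _" h] inner_commute[of _ "row_op _ _ _ h"])

lemma heat_step_symmetric: "heat_step G X act rs f \<bullet> h = f \<bullet> heat_step G X act rs h"
proof -
  have "laplacian G X act rs f \<bullet> h = f \<bullet> laplacian G X act rs h"
    unfolding inner_commute[of f] inner_laplacian by (simp add: inner_commute)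
  then show ?thesis by (simp add: heat_step_def inner_diff_left inner_diff_right)
qed

lemma norm_laplacian:
  "(norm (laplacian G X act rs f))\<^sup>2 \<le> row_bound rs * (\<Sum>L\<in>rs. (norm (row_op X act L f))\<^sup>2)"
proof -
  have "norm (laplacian G X act rs f) \<le> (\<Sum>L\<in>rs. row_weight L * norm (row_op X act L f))"
    unfolding laplacian_def by (rule sum_norm_le) (rule norm_row_adj[OF rs(2)])
  then have "(norm (laplacian G X act rs f))\<^sup>2 \<le> (\<Sum>L\<in>rs. row_weight L * norm (row_op X act L f))\<^sup>2"
    by (intro power_mono) auto
  also have "\<dots> \<le> (\<Sum>L\<in>rs. (row_weight L)\<^sup>2) * (\<Sum>L\<in>rs. (norm (row_op X act L f))\<^sup>2)"
    by (rule Cauchy_Schwarz_ineq_sum)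
  also have "\<dots> \<le> row_bound rs * (\<Sum>L\<in>rs. (norm (row_op X act L f))\<^sup>2)"
    by (intro mult_right_mono sum_nonneg) (auto simp: row_bound_def)
  finally show ?thesis .
qed

text \<open>
  If \<open>q\<close> is the sum of the squared norms of the \<open>L f\<close> and \<open>c\<close> the bound of the rows, then
  \<open>\<langle>\<Delta> f, f\<rangle> = q\<close> and \<open>\<parallel>\<Delta> f\<parallel>\<^sup>2 \<le> c q\<close>, so that expanding the square of
  \<open>f - \<Delta> f / c\<close> leaves at most \<open>\<parallel>f\<parallel>\<^sup>2 - q / c\<close>. This quantitative form gives the contraction
  property together with its case of equality.
\<close>

lemma norm_heat_step:
  "(norm (heat_step G X act rs f))\<^sup>2 \<le>
     (norm f)\<^sup>2 - (\<Sum>L\<in>rs. (norm (row_op X act L f))\<^sup>2) / row_bound rs"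
proof -
  define C q where "C = row_bound rs" and "q = (\<Sum>L\<in>rs. (norm (row_op X act L f))\<^sup>2)"
  have C: "C > 0" by (simp add: C_def row_bound_pos)
  have expand: "(norm (f - r *\<^sub>R a))\<^sup>2 = (norm f)\<^sup>2 - 2 * r * (a \<bullet> f) + r\<^sup>2 * (norm a)\<^sup>2" for r a
    unfolding power2_norm_eq_inner
    by (simp add: inner_diff_left inner_diff_right inner_commute algebra_simps power2_eq_square)
  have "laplacian G X act rs f \<bullet> f = q"
    by (simp add: inner_laplacian q_def power2_norm_eq_inner)
  then have "(norm (heat_step G X act rs f))\<^sup>2
      = (norm f)\<^sup>2 - 2 / C * q + (1 / C)\<^sup>2 * (norm (laplacian G X act rs f))\<^sup>2"
    unfolding heat_step_def expand by (simp add: C_def)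
  also have "\<dots> \<le> (norm f)\<^sup>2 - 2 / C * q + (1 / C)\<^sup>2 * (C * q)"
    using norm_laplacian[of f] by (intro add_left_mono mult_left_mono) (auto simp: C_def q_def)
  also have "\<dots> = (norm f)\<^sup>2 - q / C" using C by (simp add: field_simps power2_eq_square)
  finally show ?thesis by (simp add: C_def q_def)
qed

lemma heat_step_contraction: "norm (heat_step G X act rs f) \<le> norm f"
proof (rule power2_le_imp_le)
  have "0 \<le> (\<Sum>L\<in>rs. (norm (row_op X act L f))\<^sup>2) / row_bound rs"
    using row_bound_pos[of rs] by (intro divide_nonneg_pos sum_nonneg) auto
  then show "(norm (heat_step G X act rs f))\<^sup>2 \<le> (norm f)\<^sup>2" using norm_heat_step[of f] by linarith
qed simp

lemma norm_heat_step_eq_imp: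
  assumes "norm (heat_step G X act rs f) = norm f" "L \<in> rs"
  shows "row_op X act L f = 0"
proof -
  have "(\<Sum>L\<in>rs. (norm (row_op X act L f))\<^sup>2) / row_bound rs \<le> 0"
    using norm_heat_step[of f] assms(1) by simp
  then have "(\<Sum>L\<in>rs. (norm (row_op X act L f))\<^sup>2) \<le> 0"
    using row_bound_pos[of rs] by (simp add: divide_le_0_iff)
  then have "(\<Sum>L\<in>rs. (norm (row_op X act L f))\<^sup>2) = 0" by (intro antisym sum_nonneg) auto
  then show ?thesis using rs(1) assms(2) by (simp add: sum_nonneg_eq_0_iff)
qed

lemma heat_step_fixed_iff: "heat_step G X act rs f = f \<longleftrightarrow> (\<forall>L\<in>rs. row_op X act L f = 0)"
proof
  show "heat_step G X act rs f = f \<Longrightarrow> \<forall>L\<in>rs. row_op X act L f = 0"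
    using norm_heat_step_eq_imp[of f] by auto
  assume "\<forall>L\<in>rs. row_op X act L f = 0"
  then have "laplacian G X act rs f = 0"
    unfolding laplacian_def by (intro sum.neutral) (simp add: linear_0[OF linear_row_adj[OF rs(2)]])
  then show "heat_step G X act rs f = f" by (simp add: heat_step_def)
qed

lemma coord_heat_step:
  "coord (heat_step G X act rs f) (x, j) = coord f (x, j) -
     (if x \<in> X then of_real (1 / row_bound rs) * local_laplacian G act rs (coord f) x j else 0)"
proof -
  have "coord (row_adj G X act L (row_op X act L f)) (x, j) = (if x \<in> X then
     (\<Sum>(i, c, g)\<leftarrow>L. if i = j then of_int c * row_apply act L (coord f) (act x (inv g)) else 0) else 0)"
    if "L \<in> rs" for L
  proof -
    have "(\<Sum>(i, c, g)\<leftarrow>L. if i = j then of_int c * coord (row_op X act L f) (act x (inv g)) else 0)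
       = (\<Sum>(i, c, g)\<leftarrow>L. if i = j then of_int c * row_apply act L (coord f) (act x (inv g)) else 0)"
      if "x \<in> X"
      using rs(2)[OF \<open>L \<in> rs\<close>] that
      by (intro arg_cong[of _ _ sum_list] map_cong)
         (auto simp: coord_row_op[OF rs(2)[OF \<open>L \<in> rs\<close>]] valid_row_def act_closed)
    then show ?thesis by (simp add: coord_row_adj[OF rs(2)[OF that]])
  qed
  then have "coord (laplacian G X act rs f) (x, j) = (if x \<in> X then local_laplacian G act rs (coord f) x j else 0)"
    unfolding laplacian_def local_laplacian_def coord_sum by simp
  then show ?thesis by (simp add: heat_step_def coord_simps scaleR_conv_of_real)
qed

end

end

section \<open>Equivariance and locality of the heat step\<close>

text \<open>
  Scalar multiplication by \<open>a\<close> and substitution of an equivariant map \<open>s\<close> in one operator. It also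
  discards the components from \<open>d\<close> onwards, on which valid rows do not act.
\<close>

definition twist :: "'x set \<Rightarrow> nat \<Rightarrow> complex \<Rightarrow> ('x \<Rightarrow> 'x) \<Rightarrow> ('x \<times> nat) ell2 \<Rightarrow> ('x \<times> nat) ell2" where
  "twist X d a s f = Ell2 (\<lambda>(x, j). if x \<in> X \<and> j < d then a * coord f (s x, j) else 0)"

text \<open>
  The value of a Laplacian at \<open>x\<close> involves the values at the points \<open>x g\<^sup>-\<^sup>1 g'\<close> with \<open>g\<close> and \<open>g'\<close>
  occurring in one row; the neutral element is included for the identity in the heat step.
\<close>

definition row_quotients :: "('g, 'm) monoid_scheme \<Rightarrow> 'g row set \<Rightarrow> 'g set" where
  "row_quotients G rs = insert \<one>\<^bsub>G\<^esub> (\<Union>L\<in>rs. \<Union>(i, c, g)\<in>set L. \<Union>(i', c', g')\<in>set L.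
     {inv\<^bsub>G\<^esub> g \<otimes>\<^bsub>G\<^esub> g'})"

fun propagation :: "('g, 'm) monoid_scheme \<Rightarrow> 'g row set \<Rightarrow> nat \<Rightarrow> 'g set" where
  "propagation G rs 0 = {\<one>\<^bsub>G\<^esub>}"
| "propagation G rs (Suc n) = (\<lambda>(h, q). h \<otimes>\<^bsub>G\<^esub> q) ` (propagation G rs n \<times> row_quotients G rs)"

lemma finite_row_quotients: "finite rs \<Longrightarrow> finite (row_quotients G rs)"
  unfolding row_quotients_def by auto

lemma finite_propagation: "finite rs \<Longrightarrow> finite (propagation G rs n)"
  by (induction n) (simp_all add: finite_row_quotients)

lemma sum_list_cong: "(\<And>p. p \<in> set L \<Longrightarrow> u p = v p) \<Longrightarrow> sum_list (map u L) = sum_list (map v L)"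
  by (metis map_eq_conv)

context right_action
begin

lemma square_summable_twist:
  assumes "inj_on s X"
  shows "(\<lambda>p. (cmod (if p \<in> X \<times> {..<d} then a * coord f (map_prod s id p) else 0))\<^sup>2) summable_on UNIV"
    and "norm (twist X d a s f) \<le> cmod a * norm f"
proof -
  have inj: "inj_on (map_prod s id) (X \<times> {..<d})" using assms by (auto simp: inj_on_def)
  let ?g = "\<lambda>p. if p \<in> X \<times> {..<d} then coord f (map_prod s id p) else 0"
  note * = square_summable_shift[OF inj, of f]
  have eq: "(if p \<in> X \<times> {..<d} then a * coord f (map_prod s id p) else 0) = a * ?g p" for p by simp
  show sm: "(\<lambda>p. (cmod (if p \<in> X \<times> {..<d} then a * coord f (map_prod s id p) else 0))\<^sup>2) summable_on UNIV"
    unfolding eq by (rule square_summable_cmult[OF conjunct1[OF *]])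
  have tw: "twist X d a s f = Ell2 (\<lambda>p. a * ?g p)"
    unfolding twist_def by (rule arg_cong[of _ _ Ell2]) auto
  have "(norm (twist X d a s f))\<^sup>2 = (cmod a)\<^sup>2 * (norm (Ell2 ?g))\<^sup>2"
    unfolding tw norm_ell2 coord_Ell2[OF sm[unfolded eq]] coord_Ell2[OF conjunct1[OF *]]
      norm_mult power_mult_distrib by (rule infsum_cmult_right')
  also have "\<dots> \<le> (cmod a)\<^sup>2 * (norm f)\<^sup>2" using conjunct2[OF *] by (rule mult_left_mono) simp
  finally have "(norm (twist X d a s f))\<^sup>2 \<le> (cmod a * norm f)\<^sup>2" by (simp add: power_mult_distrib)
  then show "norm (twist X d a s f) \<le> cmod a * norm f" by (rule power2_le_imp_le) simp
qed

lemma coord_twist: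
  assumes "inj_on s X"
  shows "coord (twist X d a s f) (x, j) = (if x \<in> X \<and> j < d then a * coord f (s x, j) else 0)"
proof -
  have "twist X d a s f = Ell2 (\<lambda>p. if p \<in> X \<times> {..<d} then a * coord f (map_prod s id p) else 0)"
    unfolding twist_def by (rule arg_cong[of _ _ Ell2]) auto
  then show ?thesis using coord_Ell2[OF square_summable_twist(1)[OF assms, of d a f]] by simp
qed

lemma bounded_linear_twist:
  assumes "inj_on s X" shows "bounded_linear (twist X d a s)"
proof (rule bounded_linear_intro[of _ "cmod a"])
  fix f g :: "('x \<times> nat) ell2" and r :: real
  show "twist X d a s (f + g) = twist X d a s f + twist X d a s g"
  proof (rule ell2_eqI)
    fix p :: "'x \<times> nat"
    show "coord (twist X d a s (f + g)) p = coord (twist X d a s f + twist X d a s g) p"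
      by (cases p) (simp add: coord_twist[OF assms] coord_simps algebra_simps)
  qed
  show "twist X d a s (r *\<^sub>R f) = r *\<^sub>R twist X d a s f"
  proof (rule ell2_eqI)
    fix p :: "'x \<times> nat"
    show "coord (twist X d a s (r *\<^sub>R f)) p = coord (r *\<^sub>R twist X d a s f) p"
      by (cases p) (simp add: coord_twist[OF assms] coord_simps)
  qed
  show "norm (twist X d a s f) \<le> norm f * cmod a"
    using square_summable_twist(2)[OF assms, of d a f] by (simp add: mult.commute)
qed

lemma twist_heat_step:
  assumes rs: "finite rs" "\<And>L. L \<in> rs \<Longrightarrow> valid_row G d L"
    and s: "inj_on s X" "\<And>x. x \<in> X \<Longrightarrow> s x \<in> X" "\<And>x g. x \<in> X \<Longrightarrow> g \<in> carrier G \<Longrightarrow> s (act x g) = act (s x) g"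
  shows "twist X d a s (heat_step G X act rs f) = heat_step G X act rs (twist X d a s f)"
proof (rule ell2_eqI)
  fix p :: "'x \<times> nat"
  obtain x j where p: "p = (x, j)" by (cases p)
  let ?r = "of_real (1 / row_bound rs) :: complex"
  have ra: "row_apply act L (coord (twist X d a s f)) y = a * row_apply act L (coord f) (s y)"
    if "L \<in> rs" "y \<in> X" for L y
  proof -
    have "row_apply act L (coord (twist X d a s f)) y
        = (\<Sum>(i, c, g)\<leftarrow>L. a * (of_int c * coord f (act (s y) g, i)))"
      unfolding row_apply_def
      using rs(2)[OF that(1)] that(2)
      by (intro sum_list_cong) (auto simp: valid_row_def coord_twist[OF s(1)] act_closed s(3))
    then show ?thesis by (simp add: row_apply_def sum_list_const_mult case_prod_unfold)
  qed
  have ll: "local_laplacian G act rs (coord (twist X d a s f)) x j =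
      (if j < d then a * local_laplacian G act rs (coord f) (s x) j else 0)" if "x \<in> X"
  proof (cases "j < d")
    case True
    have "(\<Sum>(i, c, g)\<leftarrow>L. if i = j then of_int c * row_apply act L (coord (twist X d a s f)) (act x (inv g)) else 0)
       = a * (\<Sum>(i, c, g)\<leftarrow>L. if i = j then of_int c * row_apply act L (coord f) (act (s x) (inv g)) else 0)"
      if L: "L \<in> rs" for L
    proof -
      have "(\<Sum>(i, c, g)\<leftarrow>L. if i = j then of_int c * row_apply act L (coord (twist X d a s f)) (act x (inv g)) else 0)
         = (\<Sum>(i, c, g)\<leftarrow>L. a * (if i = j then of_int c * row_apply act L (coord f) (act (s x) (inv g)) else 0))"
        using rs(2)[OF L] \<open>x \<in> X\<close>
        by (intro sum_list_cong) (auto simp: valid_row_def ra[OF L] act_closed s(3))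
      then show ?thesis by (simp add: sum_list_const_mult case_prod_unfold)
    qed
    then show ?thesis using True by (simp add: local_laplacian_def sum_distrib_left)
  next
    case False
    have "(\<Sum>(i, c, g)\<leftarrow>L. if i = j then of_int c * row_apply act L (coord (twist X d a s f)) (act x (inv g)) else 0)
       = (\<Sum>(i, c, g)\<leftarrow>L. 0)" if L: "L \<in> rs" for L
      using rs(2)[OF L] False by (intro sum_list_cong) (auto simp: valid_row_def)
    then show ?thesis using False by (simp add: local_laplacian_def case_prod_unfold)
  qed
  show "coord (twist X d a s (heat_step G X act rs f)) p = coord (heat_step G X act rs (twist X d a s f)) p"
  proof (cases "x \<in> X")
    case True
    then show ?thesis
      using s(2)[OF True]
      by (simp add: p coord_twist[OF s(1)] coord_heat_step[OF rs] ll[OF True] algebra_simps)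
  next
    case False
    then show ?thesis by (simp add: p coord_twist[OF s(1)] coord_heat_step[OF rs])
  qed
qed

end

lemma (in group) right_action_self: "right_action G (carrier G) (\<lambda>x g. x \<otimes> g)"
  by unfold_locales (auto simp: m_assoc)

context right_action
begin

lemma row_quotients_closed: "(\<And>L. L \<in> rs \<Longrightarrow> valid_row G d L) \<Longrightarrow> row_quotients G rs \<subseteq> carrier G"
  unfolding row_quotients_def valid_row_def by fastforce

lemma propagation_closed:
  assumes "\<And>L. L \<in> rs \<Longrightarrow> valid_row G d L" shows "propagation G rs n \<subseteq> carrier G"
  using row_quotients_closed[OF assms] by (induction n) auto

text \<open>
  Near a point \<open>y\<close>, the \<open>G\<close>-set \<open>X\<close> is compared with \<open>G\<close> itself along the orbit map \<open>h \<mapsto> y h\<close>.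
\<close>

lemma heat_step_local:
  assumes rs: "finite rs" "\<And>L. L \<in> rs \<Longrightarrow> valid_row G d L"
    and y: "y \<in> X" and h: "h \<in> carrier G"
    and agree: "\<And>q j. q \<in> row_quotients G rs \<Longrightarrow> coord f (h \<otimes> q, j) = coord f' (act y (h \<otimes> q), j)"
  shows "coord (heat_step G (carrier G) (\<lambda>x g. x \<otimes> g) rs f) (h, j) = coord (heat_step G X act rs f') (act y h, j)"
proof -
  interpret self: right_action G "carrier G" "\<lambda>x g. x \<otimes> g" by (rule right_action_self)
  have ra: "row_apply (\<lambda>x g. x \<otimes> g) L (coord f) (h \<otimes> inv g) = row_apply act L (coord f') (act (act y h) (inv g))"
    if L: "L \<in> rs" "(i, c, g) \<in> set L" for L i c g
    unfolding row_apply_def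
  proof (rule sum_list_cong)
    fix p assume p: "p \<in> set L"
    obtain i' c' g' where pp: "p = (i', c', g')" by (cases p)
    have gc: "g \<in> carrier G" "g' \<in> carrier G" using rs(2)[OF L(1)] L(2) p pp by (auto simp: valid_row_def)
    have "inv g \<otimes> g' \<in> row_quotients G rs"
      unfolding row_quotients_def using L p pp by force
    from agree[OF this, of i'] show "(\<lambda>(i, c, ga). of_int c * coord f (h \<otimes> inv g \<otimes> ga, i)) p =
         (\<lambda>(i, c, ga). of_int c * coord f' (act (act (act y h) (inv g)) ga, i)) p"
      using gc h y by (simp add: pp m_assoc act_mult act_closed)
  qed
  have "local_laplacian G (\<lambda>x g. x \<otimes> g) rs (coord f) h j = local_laplacian G act rs (coord f') (act y h) j"
    unfolding local_laplacian_def
    by (intro sum.cong sum_list_cong refl) (auto simp: ra)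
  moreover have "coord f (h, j) = coord f' (act y h, j)"
    using agree[of \<one>] h by (simp add: row_quotients_def)
  ultimately show ?thesis
    using h y by (simp add: coord_heat_step[OF rs] self.coord_heat_step[OF rs] act_closed)
qed

lemma heat_power_local:
  assumes rs: "finite rs" "\<And>L. L \<in> rs \<Longrightarrow> valid_row G d L" and y: "y \<in> X"
    and agree: "\<And>h j. h \<in> propagation G rs n \<Longrightarrow> coord f (h, j) = coord f' (act y h, j)"
  shows "coord ((heat_step G (carrier G) (\<lambda>x g. x \<otimes> g) rs ^^ n) f) (\<one>, j) = coord ((heat_step G X act rs ^^ n) f') (y, j)"
  using agree
proof (induction n arbitrary: f f')
  case 0
  then show ?case using y by (simp add: act_one)
next
  case (Suc n)
  have "coord (heat_step G (carrier G) (\<lambda>x g. x \<otimes> g) rs f) (h, j) = coord (heat_step G X act rs f') (act y h, j)"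
    if "h \<in> propagation G rs n" for h j
  proof (rule heat_step_local[OF rs y])
    show "h \<in> carrier G" using propagation_closed[OF rs(2)] that by blast
    fix q j assume "q \<in> row_quotients G rs"
    with that have "h \<otimes> q \<in> propagation G rs (Suc n)" by force
    then show "coord f (h \<otimes> q, j) = coord f' (act y (h \<otimes> q), j)" by (rule Suc.prems)
  qed
  from Suc.IH[OF this] show ?case by (simp add: funpow_swap1)
qed

text \<open>
  By symmetry the squared norm is the diagonal matrix entry of the power \<open>2 k\<close>, which depends only
  on the part of the orbit of \<open>y\<close> within the reach of \<open>2 k\<close> steps. There the orbit map identifies the
  unit vector at \<open>y\<close> with the one at the neutral element.
\<close>

lemma heat_power_diagonal:
  assumes rs: "finite rs" "\<And>L. L \<in> rs \<Longrightarrow> valid_row G d L" and y: "y \<in> X"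
    and free: "\<And>h. h \<in> propagation G rs (2 * k) \<Longrightarrow> act y h = y \<Longrightarrow> h = \<one>"
  shows "(norm ((heat_step G X act rs ^^ k) (unit_vec (y, j))))\<^sup>2 =
    (norm ((heat_step G (carrier G) (\<lambda>x g. x \<otimes> g) rs ^^ k) (unit_vec (\<one>, j))))\<^sup>2"
proof -
  interpret self: right_action G "carrier G" "\<lambda>x g. x \<otimes> g" by (rule right_action_self)
  have sq: "(norm ((T ^^ k) u))\<^sup>2 = u \<bullet> (T ^^ (2 * k)) u"
    if "\<And>x y. T x \<bullet> y = x \<bullet> T y" for T :: "('z \<times> nat) ell2 \<Rightarrow> ('z \<times> nat) ell2" and u
    by (simp add: power2_norm_eq_inner funpow_symmetric[OF that] mult_2 funpow_add)
  have "coord ((heat_step G (carrier G) (\<lambda>x g. x \<otimes> g) rs ^^ (2 * k)) (unit_vec (\<one>, j))) (\<one>, j) =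
      coord ((heat_step G X act rs ^^ (2 * k)) (unit_vec (y, j))) (y, j)"
  proof (rule heat_power_local[OF rs y])
    fix h i assume "h \<in> propagation G rs (2 * k)"
    then have "act y h = y \<longleftrightarrow> h = \<one>" using free y act_one by blast
    then show "coord (unit_vec (\<one>, j)) (h, i) = coord (unit_vec (y, j)) (act y h, i)"
      by (simp add: coord_unit_vec)
  qed
  then show ?thesis
    by (simp add: sq[OF heat_step_symmetric[OF rs]] sq[OF self.heat_step_symmetric[OF rs]] inner_unit_vec)
qed

end

section \<open>The first homology of the bar complex\<close>

text \<open>
  The coefficients occurring here are the group von Neumann algebra with the right translations, and
  a prime field with the trivial action.
\<close>

locale group_in_ring = group G + ring R for G :: "('g, 'm) monoid_scheme" and R :: "('r, 'x) ring_scheme" +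
  fixes \<rho> :: "'g \<Rightarrow> 'r"
  assumes rho_closed [simp]: "g \<in> carrier G \<Longrightarrow> \<rho> g \<in> carrier R"
    and rho_mult: "g \<in> carrier G \<Longrightarrow> h \<in> carrier G \<Longrightarrow> \<rho> (g \<otimes>\<^bsub>G\<^esub> h) = \<rho> g \<otimes>\<^bsub>R\<^esub> \<rho> h"
    and rho_one: "\<rho> \<one>\<^bsub>G\<^esub> = \<one>\<^bsub>R\<^esub>"
begin

definition pairing :: "('g list \<Rightarrow> 'r) \<Rightarrow> ('g list \<Rightarrow> 'r) \<Rightarrow> 'r" where
  "pairing c \<zeta> = (\<Oplus>\<^bsub>R\<^esub>x\<in>{x. c x \<noteq> \<zero>\<^bsub>R\<^esub>}. c x \<otimes>\<^bsub>R\<^esub> \<zeta> x)"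

abbreviation "bchains n \<equiv> bar_chains G R n"

lemma chain_closed: "c \<in> carrier (bchains n) \<Longrightarrow> c x \<in> carrier R"
  and chain_finite: "c \<in> carrier (bchains n) \<Longrightarrow> finite {x. c x \<noteq> \<zero>\<^bsub>R\<^esub>}"
  and chain_support: "c \<in> carrier (bchains n) \<Longrightarrow> c x \<noteq> \<zero>\<^bsub>R\<^esub> \<Longrightarrow> length x = n \<and> set x \<subseteq> carrier G"
  by (auto simp: bar_chains_def)

lemma chainI:
  assumes "\<And>x. c x \<in> carrier R" "finite A" "\<And>x. c x \<noteq> \<zero>\<^bsub>R\<^esub> \<Longrightarrow> x \<in> A"
    "\<And>x. x \<in> A \<Longrightarrow> length x = n \<and> set x \<subseteq> carrier G"
  shows "c \<in> carrier (bchains n)"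
proof -
  have "{x. c x \<noteq> \<zero>\<^bsub>R\<^esub>} \<subseteq> A" using assms(3) by blast
  then have "finite {x. c x \<noteq> \<zero>\<^bsub>R\<^esub>}" using assms(2) by (rule finite_subset)
  moreover have "{x. c x \<noteq> \<zero>\<^bsub>R\<^esub>} \<subseteq> {x. length x = n \<and> set x \<subseteq> carrier G}"
    using assms(3,4) by blast
  ultimately show ?thesis using assms(1) by (simp add: bar_chains_def image_subset_iff)
qed

lemma chains_add: "c \<oplus>\<^bsub>bchains n\<^esub> d = (\<lambda>x. c x \<oplus>\<^bsub>R\<^esub> d x)"
  and chains_smult: "r \<odot>\<^bsub>bchains n\<^esub> c = (\<lambda>x. r \<otimes>\<^bsub>R\<^esub> c x)"
  by (simp_all add: bar_chains_def)

lemma chain_add_closed: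
  assumes "c \<in> carrier (bchains n)" "d \<in> carrier (bchains n)"
  shows "(\<lambda>x. c x \<oplus>\<^bsub>R\<^esub> d x) \<in> carrier (bchains n)"
proof (rule chainI[of _ "{x. c x \<noteq> \<zero>\<^bsub>R\<^esub>} \<union> {x. d x \<noteq> \<zero>\<^bsub>R\<^esub>}"])
  show "x \<in> {x. c x \<noteq> \<zero>\<^bsub>R\<^esub>} \<union> {x. d x \<noteq> \<zero>\<^bsub>R\<^esub>}" if "c x \<oplus>\<^bsub>R\<^esub> d x \<noteq> \<zero>\<^bsub>R\<^esub>" for x
    using that by auto
  show "length x = n \<and> set x \<subseteq> carrier G" if "x \<in> {x. c x \<noteq> \<zero>\<^bsub>R\<^esub>} \<union> {x. d x \<noteq> \<zero>\<^bsub>R\<^esub>}" for x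
    using that chain_support[OF assms(1)] chain_support[OF assms(2)] by blast
qed (use assms chain_closed chain_finite in auto)

lemma chain_smult_closed:
  assumes "r \<in> carrier R" "c \<in> carrier (bchains n)"
  shows "(\<lambda>x. r \<otimes>\<^bsub>R\<^esub> c x) \<in> carrier (bchains n)"
proof (rule chainI[of _ "{x. c x \<noteq> \<zero>\<^bsub>R\<^esub>}"])
  show "x \<in> {x. c x \<noteq> \<zero>\<^bsub>R\<^esub>}" if "r \<otimes>\<^bsub>R\<^esub> c x \<noteq> \<zero>\<^bsub>R\<^esub>" for x
    using that assms(1) by auto
  show "length x = n \<and> set x \<subseteq> carrier G" if "x \<in> {x. c x \<noteq> \<zero>\<^bsub>R\<^esub>}" for x
    using that chain_support[OF assms(2)] by blast
qed (use assms chain_closed chain_finite in auto)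

lemma chain_zero_closed: "(\<lambda>x. \<zero>\<^bsub>R\<^esub>) \<in> carrier (bchains n)"
  by (rule chainI[of _ "{}"]) auto

lemma pairing_superset:
  assumes "c \<in> carrier (bchains n)" "finite A" "\<And>x. c x \<noteq> \<zero>\<^bsub>R\<^esub> \<Longrightarrow> x \<in> A" "\<And>x. \<zeta> x \<in> carrier R"
  shows "pairing c \<zeta> = (\<Oplus>\<^bsub>R\<^esub>x\<in>A. c x \<otimes>\<^bsub>R\<^esub> \<zeta> x)"
  unfolding pairing_def
  by (rule add.finprod_mono_neutral_cong) (use assms chain_finite chain_closed in auto)

lemma pairing_add:
  assumes "c \<in> carrier (bchains n)" "d \<in> carrier (bchains n)" "\<And>x. \<zeta> x \<in> carrier R"
  shows "pairing (\<lambda>x. c x \<oplus>\<^bsub>R\<^esub> d x) \<zeta> = pairing c \<zeta> \<oplus>\<^bsub>R\<^esub> pairing d \<zeta>"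
proof -
  define A where "A = {x. c x \<noteq> \<zero>\<^bsub>R\<^esub>} \<union> {x. d x \<noteq> \<zero>\<^bsub>R\<^esub>}"
  have fin: "finite A" using assms chain_finite by (auto simp: A_def)
  have cl: "c x \<in> carrier R" "d x \<in> carrier R" for x using assms chain_closed by auto
  have "pairing (\<lambda>x. c x \<oplus>\<^bsub>R\<^esub> d x) \<zeta> = (\<Oplus>\<^bsub>R\<^esub>x\<in>A. (c x \<oplus>\<^bsub>R\<^esub> d x) \<otimes>\<^bsub>R\<^esub> \<zeta> x)"
    by (rule pairing_superset[OF chain_add_closed[OF assms(1,2)] fin]) (auto simp: A_def assms(3))
  also have "\<dots> = (\<Oplus>\<^bsub>R\<^esub>x\<in>A. c x \<otimes>\<^bsub>R\<^esub> \<zeta> x \<oplus>\<^bsub>R\<^esub> d x \<otimes>\<^bsub>R\<^esub> \<zeta> x)"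
    by (rule finsum_cong') (use cl assms(3) in \<open>auto simp: l_distr\<close>)
  also have "\<dots> = (\<Oplus>\<^bsub>R\<^esub>x\<in>A. c x \<otimes>\<^bsub>R\<^esub> \<zeta> x) \<oplus>\<^bsub>R\<^esub> (\<Oplus>\<^bsub>R\<^esub>x\<in>A. d x \<otimes>\<^bsub>R\<^esub> \<zeta> x)"
    by (rule finsum_addf) (use cl assms(3) in auto)
  also have "(\<Oplus>\<^bsub>R\<^esub>x\<in>A. c x \<otimes>\<^bsub>R\<^esub> \<zeta> x) = pairing c \<zeta>"
    by (rule pairing_superset[OF assms(1) fin, symmetric]) (auto simp: A_def assms(3))
  also have "(\<Oplus>\<^bsub>R\<^esub>x\<in>A. d x \<otimes>\<^bsub>R\<^esub> \<zeta> x) = pairing d \<zeta>"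
    by (rule pairing_superset[OF assms(2) fin, symmetric]) (auto simp: A_def assms(3))
  finally show ?thesis .
qed

lemma pairing_smult:
  assumes "r \<in> carrier R" "c \<in> carrier (bchains n)" "\<And>x. \<zeta> x \<in> carrier R"
  shows "pairing (\<lambda>x. r \<otimes>\<^bsub>R\<^esub> c x) \<zeta> = r \<otimes>\<^bsub>R\<^esub> pairing c \<zeta>"
proof -
  let ?A = "{x. c x \<noteq> \<zero>\<^bsub>R\<^esub>}"
  have cl: "c x \<in> carrier R" for x using assms chain_closed by auto
  have "pairing (\<lambda>x. r \<otimes>\<^bsub>R\<^esub> c x) \<zeta> = (\<Oplus>\<^bsub>R\<^esub>x\<in>?A. (r \<otimes>\<^bsub>R\<^esub> c x) \<otimes>\<^bsub>R\<^esub> \<zeta> x)"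
    by (rule pairing_superset[OF chain_smult_closed[OF assms(1,2)] chain_finite[OF assms(2)]])
       (use assms in auto)
  also have "\<dots> = (\<Oplus>\<^bsub>R\<^esub>x\<in>?A. r \<otimes>\<^bsub>R\<^esub> (c x \<otimes>\<^bsub>R\<^esub> \<zeta> x))"
    by (rule finsum_cong') (use cl assms in \<open>auto simp: m_assoc\<close>)
  also have "\<dots> = r \<otimes>\<^bsub>R\<^esub> pairing c \<zeta>"
    unfolding pairing_def
    by (rule finsum_rdistr[symmetric]) (use cl assms chain_finite[OF assms(2)] in auto)
  finally show ?thesis .
qed

lemma finsum_filter:
  assumes "finite A" "\<And>i. i \<in> A \<Longrightarrow> f i \<in> carrier R"
  shows "(\<Oplus>\<^bsub>R\<^esub>i\<in>{i\<in>A. P i}. f i) = (\<Oplus>\<^bsub>R\<^esub>i\<in>A. if P i then f i else \<zero>\<^bsub>R\<^esub>)"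
  by (rule add.finprod_mono_neutral_cong) (use assms in auto)

lemma finsum_delta:
  assumes "finite A" "\<And>i. i \<in> A \<Longrightarrow> f i \<in> carrier R" "a \<in> A"
  shows "(\<Oplus>\<^bsub>R\<^esub>i\<in>A. if i = a then f i else \<zero>\<^bsub>R\<^esub>) = f a"
  using add.finprod_singleton_swap[of a A f] assms by (auto simp: Pi_def)

lemma bar_coeff_1:
  assumes g: "g \<in> carrier G"
  shows "bar_coeff G R \<rho> [g] y = (if y = [] then \<rho> g \<ominus>\<^bsub>R\<^esub> \<one>\<^bsub>R\<^esub> else \<zero>\<^bsub>R\<^esub>)"
proof -
  let ?f = "\<lambda>i. if i = 0 then \<rho> g else (\<ominus>\<^bsub>R\<^esub> \<one>\<^bsub>R\<^esub>) [^]\<^bsub>R\<^esub> (i::nat)"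
  have S: "{i. i \<le> length [g] \<and> bar_face G i [g] = y} = {i \<in> {0, 1}. bar_face G i [g] = y}"
    by auto
  have "bar_coeff G R \<rho> [g] y = (\<Oplus>\<^bsub>R\<^esub>i\<in>{i \<in> {0, 1}. bar_face G i [g] = y}. ?f i)"
    by (simp only: bar_coeff_def S list.distinct list.sel if_False)
  also have "\<dots> = (\<Oplus>\<^bsub>R\<^esub>i\<in>{0, 1}. if bar_face G i [g] = y then ?f i else \<zero>\<^bsub>R\<^esub>)"
    by (rule finsum_filter) (use g in auto)
  also have "\<dots> = (if y = [] then \<rho> g \<ominus>\<^bsub>R\<^esub> \<one>\<^bsub>R\<^esub> else \<zero>\<^bsub>R\<^esub>)"
    using g by (auto simp: bar_face_def minus_eq)
  finally show ?thesis .
qed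

lemma bar_coeff_2:
  assumes gh: "g \<in> carrier G" "h \<in> carrier G"
  shows "bar_coeff G R \<rho> [g, h] y = (if y = [h] then \<rho> g else \<zero>\<^bsub>R\<^esub>) \<oplus>\<^bsub>R\<^esub>
     ((if y = [g \<otimes>\<^bsub>G\<^esub> h] then \<ominus>\<^bsub>R\<^esub> \<one>\<^bsub>R\<^esub> else \<zero>\<^bsub>R\<^esub>) \<oplus>\<^bsub>R\<^esub> (if y = [g] then \<one>\<^bsub>R\<^esub> else \<zero>\<^bsub>R\<^esub>))"
proof -
  let ?f = "\<lambda>i. if i = 0 then \<rho> g else (\<ominus>\<^bsub>R\<^esub> \<one>\<^bsub>R\<^esub>) [^]\<^bsub>R\<^esub> (i::nat)"
  have S: "{i. i \<le> length [g, h] \<and> bar_face G i [g, h] = y} = {i \<in> {0, 1, 2}. bar_face G i [g, h] = y}"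
    by auto
  have sq: "(\<ominus>\<^bsub>R\<^esub> \<one>\<^bsub>R\<^esub>) [^]\<^bsub>R\<^esub> (2::nat) = \<one>\<^bsub>R\<^esub>"
    by (simp add: numeral_2_eq_2 l_minus)
  have "bar_coeff G R \<rho> [g, h] y = (\<Oplus>\<^bsub>R\<^esub>i\<in>{i \<in> {0, 1, 2}. bar_face G i [g, h] = y}. ?f i)"
    by (simp only: bar_coeff_def S list.distinct list.sel if_False)
  also have "\<dots> = (\<Oplus>\<^bsub>R\<^esub>i\<in>{0, 1, 2}. if bar_face G i [g, h] = y then ?f i else \<zero>\<^bsub>R\<^esub>)"
    by (rule finsum_filter) (use gh in auto)
  also have "\<dots> = (if bar_face G 0 [g, h] = y then ?f 0 else \<zero>\<^bsub>R\<^esub>) \<oplus>\<^bsub>R\<^esub>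
     ((if bar_face G 1 [g, h] = y then ?f 1 else \<zero>\<^bsub>R\<^esub>) \<oplus>\<^bsub>R\<^esub>
      (if bar_face G 2 [g, h] = y then ?f 2 else \<zero>\<^bsub>R\<^esub>))"
    using gh by (simp add: Pi_def)
  also have "bar_face G 0 [g, h] = [h]" by (simp add: bar_face_def)
  also have "bar_face G 1 [g, h] = [g \<otimes>\<^bsub>G\<^esub> h]" by (simp add: bar_face_def)
  also have "bar_face G 2 [g, h] = [g]" by (simp add: bar_face_def)
  finally show ?thesis using gh by (simp add: sq eq_commute[of _ y])
qed

lemma bar_coeff_closed:
  assumes "length x \<in> {1, 2}" "set x \<subseteq> carrier G"
  shows "bar_coeff G R \<rho> x y \<in> carrier R"
proof -
  consider g where "x = [g]" | g h where "x = [g, h]"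
    using assms(1) by (auto simp: length_Suc_conv numeral_2_eq_2)
  then show ?thesis using assms(2) by cases (auto simp: bar_coeff_1 bar_coeff_2)
qed

lemma chain2_cases:
  assumes "c \<in> carrier (bchains 2)" "c x \<noteq> \<zero>\<^bsub>R\<^esub>"
  obtains g h where "x = [g, h]" "g \<in> carrier G" "h \<in> carrier G"
  using chain_support[OF assms] by (auto simp: length_Suc_conv numeral_2_eq_2)

lemma chain1_cases:
  assumes "c \<in> carrier (bchains 1)" "c x \<noteq> \<zero>\<^bsub>R\<^esub>"
  obtains g where "x = [g]" "g \<in> carrier G"
  using chain_support[OF assms] by (auto simp: length_Suc_conv)

text \<open>
  A finite set that contains the support of the boundary of a 2-chain.
\<close>

definition faces :: "('g list \<Rightarrow> 'r) \<Rightarrow> 'g list set" where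
  "faces c = (\<Union>x\<in>{x. c x \<noteq> \<zero>\<^bsub>R\<^esub>}. {[hd (tl x)], [hd x \<otimes>\<^bsub>G\<^esub> hd (tl x)], [hd x]})"

lemma boundary_eq_pairing: "bar_boundary G R \<rho> c y = pairing c (\<lambda>x. bar_coeff G R \<rho> x y)"
  by (simp add: bar_boundary_def pairing_def)

lemma boundary_2_closed: "c \<in> carrier (bchains 2) \<Longrightarrow> bar_boundary G R \<rho> c y \<in> carrier R"
  unfolding bar_boundary_def
  by (intro finsum_closed) (auto intro!: m_closed bar_coeff_closed dest: chain_support simp: chain_closed)

lemma boundary_2_support:
  assumes "c \<in> carrier (bchains 2)" "bar_boundary G R \<rho> c y \<noteq> \<zero>\<^bsub>R\<^esub>"
  shows "y \<in> faces c"
proof (rule ccontr)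
  assume y: "y \<notin> faces c"
  have "c x \<otimes>\<^bsub>R\<^esub> bar_coeff G R \<rho> x y = \<zero>\<^bsub>R\<^esub>" if x: "c x \<noteq> \<zero>\<^bsub>R\<^esub>" for x
  proof -
    obtain g h where gh: "x = [g, h]" "g \<in> carrier G" "h \<in> carrier G" using chain2_cases[OF assms(1) x] .
    then have "y \<noteq> [h]" "y \<noteq> [g \<otimes>\<^bsub>G\<^esub> h]" "y \<noteq> [g]" using y x by (force simp: faces_def)+
    then show ?thesis using gh chain_closed[OF assms(1)] by (simp add: bar_coeff_2)
  qed
  then have "bar_boundary G R \<rho> c y = (\<Oplus>\<^bsub>R\<^esub>x\<in>{x. c x \<noteq> \<zero>\<^bsub>R\<^esub>}. \<zero>\<^bsub>R\<^esub>)"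
    unfolding bar_boundary_def by (intro finsum_cong') auto
  then show False using assms(2) by simp
qed

lemma boundary_2_chain:
  assumes "c \<in> carrier (bchains 2)" shows "bar_boundary G R \<rho> c \<in> carrier (bchains 1)"
proof (rule chainI[of _ "faces c"])
  show "finite (faces c)" unfolding faces_def using chain_finite[OF assms] by auto
  show "length y = 1 \<and> set y \<subseteq> carrier G" if "y \<in> faces c" for y
    using that unfolding faces_def by (auto elim!: chain2_cases[OF assms])
qed (use assms boundary_2_closed boundary_2_support in auto)

text \<open>
  The boundary of \<open>[g, h]\<close> pairs to \<open>\<rho> g z(h) - z(g h) + z(g)\<close>, which is zero exactly because \<open>z\<close> is a
  crossed homomorphism.
\<close>

lemma pairing_boundary:
  assumes c: "c \<in> carrier (bchains 2)"
    and z: "\<And>g. g \<in> carrier G \<Longrightarrow> z g \<in> carrier R"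
      "\<And>g h. g \<in> carrier G \<Longrightarrow> h \<in> carrier G \<Longrightarrow> z (g \<otimes>\<^bsub>G\<^esub> h) = z g \<oplus>\<^bsub>R\<^esub> \<rho> g \<otimes>\<^bsub>R\<^esub> z h"
  shows "(\<Oplus>\<^bsub>R\<^esub>y\<in>{y. bar_boundary G R \<rho> c y \<noteq> \<zero>\<^bsub>R\<^esub>}. bar_boundary G R \<rho> c y \<otimes>\<^bsub>R\<^esub> z (hd y)) = \<zero>\<^bsub>R\<^esub>"
proof -
  define A where "A = {x. c x \<noteq> \<zero>\<^bsub>R\<^esub>}"
  have finA: "finite A" and finF: "finite (faces c)"
    using chain_finite[OF c] by (auto simp: A_def faces_def)
  have A: "\<exists>g h. x = [g, h] \<and> g \<in> carrier G \<and> h \<in> carrier G" if "x \<in> A" for x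
    using that unfolding A_def by (auto elim: chain2_cases[OF c])
  have F: "\<exists>g. y = [g] \<and> g \<in> carrier G" if "y \<in> faces c" for y
    using that unfolding faces_def by (auto elim!: chain2_cases[OF c])
  have zF: "z (hd y) \<in> carrier R" if "y \<in> faces c" for y using F[OF that] z(1) by auto
  have kA: "bar_coeff G R \<rho> x y \<in> carrier R" if "x \<in> A" for x y
    using A[OF that] by (auto intro!: bar_coeff_closed)
  have cl: "c x \<in> carrier R" for x by (rule chain_closed[OF c])
  have "(\<Oplus>\<^bsub>R\<^esub>y\<in>{y. bar_boundary G R \<rho> c y \<noteq> \<zero>\<^bsub>R\<^esub>}. bar_boundary G R \<rho> c y \<otimes>\<^bsub>R\<^esub> z (hd y))
      = (\<Oplus>\<^bsub>R\<^esub>y\<in>faces c. bar_boundary G R \<rho> c y \<otimes>\<^bsub>R\<^esub> z (hd y))"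
  proof (rule add.finprod_mono_neutral_cong)
    show "finite {y. bar_boundary G R \<rho> c y \<noteq> \<zero>\<^bsub>R\<^esub>}"
      using boundary_2_support[OF c] by (auto intro: finite_subset[OF _ finF])
  qed (use finF zF boundary_2_support[OF c] boundary_2_closed[OF c] in \<open>auto\<close>)
  also have "\<dots> = (\<Oplus>\<^bsub>R\<^esub>y\<in>faces c. \<Oplus>\<^bsub>R\<^esub>x\<in>A. c x \<otimes>\<^bsub>R\<^esub> (bar_coeff G R \<rho> x y \<otimes>\<^bsub>R\<^esub> z (hd y)))"
  proof (rule finsum_cong')
    fix y assume y: "y \<in> faces c"
    have "bar_boundary G R \<rho> c y \<otimes>\<^bsub>R\<^esub> z (hd y) = (\<Oplus>\<^bsub>R\<^esub>x\<in>A. c x \<otimes>\<^bsub>R\<^esub> bar_coeff G R \<rho> x y \<otimes>\<^bsub>R\<^esub> z (hd y))"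
      unfolding bar_boundary_def A_def[symmetric]
      by (rule finsum_ldistr[OF finA zF[OF y]]) (use kA cl in auto)
    also have "\<dots> = (\<Oplus>\<^bsub>R\<^esub>x\<in>A. c x \<otimes>\<^bsub>R\<^esub> (bar_coeff G R \<rho> x y \<otimes>\<^bsub>R\<^esub> z (hd y)))"
      by (rule finsum_cong') (use kA cl zF[OF y] in \<open>auto simp: m_assoc\<close>)
    finally show "bar_boundary G R \<rho> c y \<otimes>\<^bsub>R\<^esub> z (hd y) = \<dots>" .
  qed (use kA cl zF in \<open>auto intro!: finsum_closed\<close>)
  also have "\<dots> = (\<Oplus>\<^bsub>R\<^esub>x\<in>A. \<Oplus>\<^bsub>R\<^esub>y\<in>faces c. c x \<otimes>\<^bsub>R\<^esub> (bar_coeff G R \<rho> x y \<otimes>\<^bsub>R\<^esub> z (hd y)))"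
    by (rule finsum_finsum_swap[OF finF finA]) (use kA cl zF in auto)
  also have "\<dots> = (\<Oplus>\<^bsub>R\<^esub>x\<in>A. \<zero>\<^bsub>R\<^esub>)"
  proof (rule finsum_cong')
    fix x assume x: "x \<in> A"
    obtain g h where gh: "x = [g, h]" "g \<in> carrier G" "h \<in> carrier G" using A[OF x] by blast
    have mem: "[h] \<in> faces c" "[g \<otimes>\<^bsub>G\<^esub> h] \<in> faces c" "[g] \<in> faces c"
      using x gh(1) unfolding faces_def A_def by force+
    have gh': "g \<otimes>\<^bsub>G\<^esub> h \<in> carrier G" using gh by simp
    have zc: "z g \<in> carrier R" "z h \<in> carrier R" "z (g \<otimes>\<^bsub>G\<^esub> h) \<in> carrier R"
      using z(1) gh gh' by blast+
    have "(\<Oplus>\<^bsub>R\<^esub>y\<in>faces c. bar_coeff G R \<rho> x y \<otimes>\<^bsub>R\<^esub> z (hd y)) =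
        (\<Oplus>\<^bsub>R\<^esub>y\<in>faces c. (if y = [h] then \<rho> g \<otimes>\<^bsub>R\<^esub> z (hd y) else \<zero>\<^bsub>R\<^esub>) \<oplus>\<^bsub>R\<^esub>
          ((if y = [g \<otimes>\<^bsub>G\<^esub> h] then \<ominus>\<^bsub>R\<^esub> z (hd y) else \<zero>\<^bsub>R\<^esub>) \<oplus>\<^bsub>R\<^esub> (if y = [g] then z (hd y) else \<zero>\<^bsub>R\<^esub>)))"
    proof (rule finsum_cong')
      fix y assume "y \<in> faces c"
      note zy = zF[OF this]
      show "bar_coeff G R \<rho> x y \<otimes>\<^bsub>R\<^esub> z (hd y) =
          (if y = [h] then \<rho> g \<otimes>\<^bsub>R\<^esub> z (hd y) else \<zero>\<^bsub>R\<^esub>) \<oplus>\<^bsub>R\<^esub>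
          ((if y = [g \<otimes>\<^bsub>G\<^esub> h] then \<ominus>\<^bsub>R\<^esub> z (hd y) else \<zero>\<^bsub>R\<^esub>) \<oplus>\<^bsub>R\<^esub> (if y = [g] then z (hd y) else \<zero>\<^bsub>R\<^esub>))"
      proof -
        have e: "(if y = [h] then \<rho> g else \<zero>\<^bsub>R\<^esub>) \<otimes>\<^bsub>R\<^esub> z (hd y) = (if y = [h] then \<rho> g \<otimes>\<^bsub>R\<^esub> z (hd y) else \<zero>\<^bsub>R\<^esub>)"
          "(if y = [g \<otimes>\<^bsub>G\<^esub> h] then \<ominus>\<^bsub>R\<^esub> \<one>\<^bsub>R\<^esub> else \<zero>\<^bsub>R\<^esub>) \<otimes>\<^bsub>R\<^esub> z (hd y) =
            (if y = [g \<otimes>\<^bsub>G\<^esub> h] then \<ominus>\<^bsub>R\<^esub> z (hd y) else \<zero>\<^bsub>R\<^esub>)"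
          "(if y = [g] then \<one>\<^bsub>R\<^esub> else \<zero>\<^bsub>R\<^esub>) \<otimes>\<^bsub>R\<^esub> z (hd y) = (if y = [g] then z (hd y) else \<zero>\<^bsub>R\<^esub>)"
          by (simp_all only: if_distrib[of "\<lambda>t. t \<otimes>\<^bsub>R\<^esub> z (hd y)"])
             (use zy in \<open>simp_all only: l_null l_minus l_one one_closed\<close>)
        have cl3: "(if y = [h] then \<rho> g else \<zero>\<^bsub>R\<^esub>) \<in> carrier R"
          "(if y = [g \<otimes>\<^bsub>G\<^esub> h] then \<ominus>\<^bsub>R\<^esub> \<one>\<^bsub>R\<^esub> else \<zero>\<^bsub>R\<^esub>) \<in> carrier R"
          "(if y = [g] then \<one>\<^bsub>R\<^esub> else \<zero>\<^bsub>R\<^esub>) \<in> carrier R"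
          using gh by simp_all
        show ?thesis
          unfolding gh(1) bar_coeff_2[OF gh(2,3)] l_distr[OF cl3(1) a_closed[OF cl3(2,3)] zy]
            l_distr[OF cl3(2,3) zy] e ..
      qed
    qed (use zc gh in auto)
    also have "\<dots> = (\<Oplus>\<^bsub>R\<^esub>y\<in>faces c. if y = [h] then \<rho> g \<otimes>\<^bsub>R\<^esub> z (hd y) else \<zero>\<^bsub>R\<^esub>) \<oplus>\<^bsub>R\<^esub>
        ((\<Oplus>\<^bsub>R\<^esub>y\<in>faces c. if y = [g \<otimes>\<^bsub>G\<^esub> h] then \<ominus>\<^bsub>R\<^esub> z (hd y) else \<zero>\<^bsub>R\<^esub>) \<oplus>\<^bsub>R\<^esub>
         (\<Oplus>\<^bsub>R\<^esub>y\<in>faces c. if y = [g] then z (hd y) else \<zero>\<^bsub>R\<^esub>))"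
      using zc gh by (subst finsum_addf, force, force, subst finsum_addf, force, force) simp
    also have "\<dots> = \<rho> g \<otimes>\<^bsub>R\<^esub> z h \<oplus>\<^bsub>R\<^esub> (\<ominus>\<^bsub>R\<^esub> z (g \<otimes>\<^bsub>G\<^esub> h) \<oplus>\<^bsub>R\<^esub> z g)"
      using zc zF gh mem by (simp add: finsum_delta[OF finF])
    also have "\<dots> = \<zero>\<^bsub>R\<^esub>"
    proof -
      have "\<rho> g \<otimes>\<^bsub>R\<^esub> z h \<oplus>\<^bsub>R\<^esub> (\<ominus>\<^bsub>R\<^esub> z (g \<otimes>\<^bsub>G\<^esub> h) \<oplus>\<^bsub>R\<^esub> z g)
          = z (g \<otimes>\<^bsub>G\<^esub> h) \<oplus>\<^bsub>R\<^esub> \<ominus>\<^bsub>R\<^esub> z (g \<otimes>\<^bsub>G\<^esub> h)"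
        using gh z(1) gh' by (simp add: z(2) a_ac del: r_neg l_neg)
      then show ?thesis using z(1)[OF gh'] by (simp add: r_neg)
    qed
    finally have inner: "(\<Oplus>\<^bsub>R\<^esub>y\<in>faces c. bar_coeff G R \<rho> x y \<otimes>\<^bsub>R\<^esub> z (hd y)) = \<zero>\<^bsub>R\<^esub>" .
    have "(\<Oplus>\<^bsub>R\<^esub>y\<in>faces c. c x \<otimes>\<^bsub>R\<^esub> (bar_coeff G R \<rho> x y \<otimes>\<^bsub>R\<^esub> z (hd y)))
        = c x \<otimes>\<^bsub>R\<^esub> (\<Oplus>\<^bsub>R\<^esub>y\<in>faces c. bar_coeff G R \<rho> x y \<otimes>\<^bsub>R\<^esub> z (hd y))"
      by (rule finsum_rdistr[OF finF cl, symmetric]) (use kA[OF x] zF in auto)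
    then show "(\<Oplus>\<^bsub>R\<^esub>y\<in>faces c. c x \<otimes>\<^bsub>R\<^esub> (bar_coeff G R \<rho> x y \<otimes>\<^bsub>R\<^esub> z (hd y))) = \<zero>\<^bsub>R\<^esub>"
      using inner cl by simp
  qed auto
  finally show ?thesis by simp
qed

(* Homology is taken in degree 1, which should not be rewritten to Suc 0. *)
declare One_nat_def [simp del]

abbreviation "cycle_module \<equiv> (bchains 1)\<lparr>carrier := bar_cycles G R \<rho> 1\<rparr>"

abbreviation "boundaries \<equiv> bar_boundaries G R \<rho> 1"

definition homology_class :: "('g list \<Rightarrow> 'r) \<Rightarrow> ('g list \<Rightarrow> 'r) set" where
  "homology_class c = boundaries +>\<^bsub>cycle_module\<^esub> c"

lemma cycle_module_simps:
  "carrier cycle_module = bar_cycles G R \<rho> 1" "\<zero>\<^bsub>cycle_module\<^esub> = (\<lambda>x. \<zero>\<^bsub>R\<^esub>)"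
  "c \<oplus>\<^bsub>cycle_module\<^esub> d = (\<lambda>x. c x \<oplus>\<^bsub>R\<^esub> d x)" "r \<odot>\<^bsub>cycle_module\<^esub> c = (\<lambda>x. r \<otimes>\<^bsub>R\<^esub> c x)"
  by (simp_all add: bar_chains_def)

lemma cycle_chain: "c \<in> bar_cycles G R \<rho> 1 \<Longrightarrow> c \<in> carrier (bchains 1)"
  by (simp add: bar_cycles_def)

lemma boundary_1:
  assumes "c \<in> carrier (bchains 1)"
  shows "bar_boundary G R \<rho> c y =
    (if y = [] then (\<Oplus>\<^bsub>R\<^esub>x\<in>{x. c x \<noteq> \<zero>\<^bsub>R\<^esub>}. c x \<otimes>\<^bsub>R\<^esub> (\<rho> (hd x) \<ominus>\<^bsub>R\<^esub> \<one>\<^bsub>R\<^esub>)) else \<zero>\<^bsub>R\<^esub>)"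
proof (cases "y = []")
  case True
  have "(\<Oplus>\<^bsub>R\<^esub>x\<in>{x. c x \<noteq> \<zero>\<^bsub>R\<^esub>}. c x \<otimes>\<^bsub>R\<^esub> bar_coeff G R \<rho> x y)
      = (\<Oplus>\<^bsub>R\<^esub>x\<in>{x. c x \<noteq> \<zero>\<^bsub>R\<^esub>}. c x \<otimes>\<^bsub>R\<^esub> (\<rho> (hd x) \<ominus>\<^bsub>R\<^esub> \<one>\<^bsub>R\<^esub>))"
    by (rule finsum_cong')
       (use True chain_closed[OF assms] in \<open>auto elim!: chain1_cases[OF assms] simp: bar_coeff_1\<close>)
  then show ?thesis using True by (simp add: bar_boundary_def)
next
  case False
  have "(\<Oplus>\<^bsub>R\<^esub>x\<in>{x. c x \<noteq> \<zero>\<^bsub>R\<^esub>}. c x \<otimes>\<^bsub>R\<^esub> bar_coeff G R \<rho> x y) = (\<Oplus>\<^bsub>R\<^esub>x\<in>{x. c x \<noteq> \<zero>\<^bsub>R\<^esub>}. \<zero>\<^bsub>R\<^esub>)"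
    by (rule finsum_cong')
       (use False chain_closed[OF assms] in \<open>auto elim!: chain1_cases[OF assms] simp: bar_coeff_1\<close>)
  then show ?thesis using False by (simp add: bar_boundary_def)
qed

text \<open>
  The boundary of a 1-chain is its pairing with the crossed homomorphism \<open>g \<mapsto> \<rho> g - 1\<close>.
\<close>

lemma boundary_boundary:
  assumes "c \<in> carrier (bchains 2)"
  shows "bar_boundary G R \<rho> (bar_boundary G R \<rho> c) = (\<lambda>y. \<zero>\<^bsub>R\<^esub>)"
proof
  fix y
  have "(\<Oplus>\<^bsub>R\<^esub>x\<in>{x. bar_boundary G R \<rho> c x \<noteq> \<zero>\<^bsub>R\<^esub>}. bar_boundary G R \<rho> c x \<otimes>\<^bsub>R\<^esub> (\<rho> (hd x) \<ominus>\<^bsub>R\<^esub> \<one>\<^bsub>R\<^esub>)) = \<zero>\<^bsub>R\<^esub>"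
  proof (rule pairing_boundary[OF assms])
    fix g h assume gh: "g \<in> carrier G" "h \<in> carrier G"
    have "\<rho> g \<ominus>\<^bsub>R\<^esub> \<one>\<^bsub>R\<^esub> \<oplus>\<^bsub>R\<^esub> \<rho> g \<otimes>\<^bsub>R\<^esub> (\<rho> h \<ominus>\<^bsub>R\<^esub> \<one>\<^bsub>R\<^esub>)
        = (\<rho> g \<oplus>\<^bsub>R\<^esub> \<ominus>\<^bsub>R\<^esub> \<rho> g) \<oplus>\<^bsub>R\<^esub> (\<rho> g \<otimes>\<^bsub>R\<^esub> \<rho> h \<oplus>\<^bsub>R\<^esub> \<ominus>\<^bsub>R\<^esub> \<one>\<^bsub>R\<^esub>)"
      using gh by (simp add: minus_eq r_distr r_minus a_ac del: r_neg l_neg)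
    then show "\<rho> (g \<otimes>\<^bsub>G\<^esub> h) \<ominus>\<^bsub>R\<^esub> \<one>\<^bsub>R\<^esub> = \<rho> g \<ominus>\<^bsub>R\<^esub> \<one>\<^bsub>R\<^esub> \<oplus>\<^bsub>R\<^esub> \<rho> g \<otimes>\<^bsub>R\<^esub> (\<rho> h \<ominus>\<^bsub>R\<^esub> \<one>\<^bsub>R\<^esub>)"
      using gh by (simp add: rho_mult minus_eq r_neg)
  qed simp
  then show "bar_boundary G R \<rho> (bar_boundary G R \<rho> c) y = \<zero>\<^bsub>R\<^esub>"
    by (simp add: boundary_1[OF boundary_2_chain[OF assms]])
qed

lemma boundary_add:
  assumes "c \<in> carrier (bchains n)" "d \<in> carrier (bchains n)" "n \<in> {1, 2}"
  shows "bar_boundary G R \<rho> (\<lambda>x. c x \<oplus>\<^bsub>R\<^esub> d x) = (\<lambda>y. bar_boundary G R \<rho> c y \<oplus>\<^bsub>R\<^esub> bar_boundary G R \<rho> d y)"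
proof
  fix y
  let ?k = "\<lambda>x. if length x = n \<and> set x \<subseteq> carrier G then bar_coeff G R \<rho> x y else \<zero>\<^bsub>R\<^esub>"
  have k: "?k x \<in> carrier R" for x using assms(3) by (auto intro!: bar_coeff_closed)
  have b: "bar_boundary G R \<rho> e y = pairing e ?k" if "e \<in> carrier (bchains n)" for e
    unfolding boundary_eq_pairing pairing_def
    by (rule finsum_cong')
       (use chain_support[OF that] chain_closed[OF that] k in auto)
  show "bar_boundary G R \<rho> (\<lambda>x. c x \<oplus>\<^bsub>R\<^esub> d x) y = bar_boundary G R \<rho> c y \<oplus>\<^bsub>R\<^esub> bar_boundary G R \<rho> d y"
    unfolding b[OF assms(1)] b[OF assms(2)] b[OF chain_add_closed[OF assms(1,2)]]
    by (rule pairing_add[OF assms(1,2) k])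
qed

lemma boundary_smult:
  assumes "r \<in> carrier R" "c \<in> carrier (bchains n)" "n \<in> {1, 2}"
  shows "bar_boundary G R \<rho> (\<lambda>x. r \<otimes>\<^bsub>R\<^esub> c x) = (\<lambda>y. r \<otimes>\<^bsub>R\<^esub> bar_boundary G R \<rho> c y)"
proof
  fix y
  let ?k = "\<lambda>x. if length x = n \<and> set x \<subseteq> carrier G then bar_coeff G R \<rho> x y else \<zero>\<^bsub>R\<^esub>"
  have k: "?k x \<in> carrier R" for x using assms(3) by (auto intro!: bar_coeff_closed)
  have b: "bar_boundary G R \<rho> e y = pairing e ?k" if "e \<in> carrier (bchains n)" for e
    unfolding boundary_eq_pairing pairing_def
    by (rule finsum_cong')
       (use chain_support[OF that] chain_closed[OF that] k in auto)
  show "bar_boundary G R \<rho> (\<lambda>x. r \<otimes>\<^bsub>R\<^esub> c x) y = r \<otimes>\<^bsub>R\<^esub> bar_boundary G R \<rho> c y"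
    unfolding b[OF assms(2)] b[OF chain_smult_closed[OF assms(1,2)]]
    by (rule pairing_smult[OF assms(1,2) k])
qed

lemma neg_eq_smult: "c \<in> carrier (bchains n) \<Longrightarrow> (\<lambda>x. \<ominus>\<^bsub>R\<^esub> c x) = (\<lambda>x. (\<ominus>\<^bsub>R\<^esub> \<one>\<^bsub>R\<^esub>) \<otimes>\<^bsub>R\<^esub> c x)"
  using chain_closed by (auto simp: l_minus)

lemma cycle_add: "c \<in> bar_cycles G R \<rho> 1 \<Longrightarrow> d \<in> bar_cycles G R \<rho> 1 \<Longrightarrow> (\<lambda>x. c x \<oplus>\<^bsub>R\<^esub> d x) \<in> bar_cycles G R \<rho> 1"
  and cycle_smult: "r \<in> carrier R \<Longrightarrow> c \<in> bar_cycles G R \<rho> 1 \<Longrightarrow> (\<lambda>x. r \<otimes>\<^bsub>R\<^esub> c x) \<in> bar_cycles G R \<rho> 1"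
  and cycle_zero: "(\<lambda>x. \<zero>\<^bsub>R\<^esub>) \<in> bar_cycles G R \<rho> 1"
  by (simp_all add: bar_cycles_def chain_add_closed chain_smult_closed boundary_add[where n=1]
      boundary_smult[where n=1] chain_zero_closed) (simp add: bar_boundary_def)

lemma abelian_group_cycles: "abelian_group cycle_module"
proof (rule abelian_groupI; (unfold cycle_module_simps)?)
  fix c d e assume "c \<in> bar_cycles G R \<rho> 1" "d \<in> bar_cycles G R \<rho> 1" "e \<in> bar_cycles G R \<rho> 1"
  then have cl: "c x \<in> carrier R" "d x \<in> carrier R" "e x \<in> carrier R" for x
    using chain_closed cycle_chain by blast+
  show "(\<lambda>x. c x \<oplus>\<^bsub>R\<^esub> d x \<oplus>\<^bsub>R\<^esub> e x) = (\<lambda>x. c x \<oplus>\<^bsub>R\<^esub> (d x \<oplus>\<^bsub>R\<^esub> e x))"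
    using cl by (simp add: a_assoc)
next
  fix c d assume "c \<in> bar_cycles G R \<rho> 1" "d \<in> bar_cycles G R \<rho> 1"
  then have cl: "c x \<in> carrier R" "d x \<in> carrier R" for x
    using chain_closed cycle_chain by blast+
  show "(\<lambda>x. c x \<oplus>\<^bsub>R\<^esub> d x) = (\<lambda>x. d x \<oplus>\<^bsub>R\<^esub> c x)" using cl by (simp add: a_comm)
next
  fix c assume c: "c \<in> bar_cycles G R \<rho> 1"
  then have cl: "c x \<in> carrier R" for x using chain_closed cycle_chain by blast
  show "(\<lambda>x. \<zero>\<^bsub>R\<^esub> \<oplus>\<^bsub>R\<^esub> c x) = c" using cl by simp
  have "(\<lambda>x. \<ominus>\<^bsub>R\<^esub> c x) \<in> bar_cycles G R \<rho> 1"
    using cycle_smult[OF _ c, of "\<ominus>\<^bsub>R\<^esub> \<one>\<^bsub>R\<^esub>"] neg_eq_smult[OF cycle_chain[OF c]] by simp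
  then show "\<exists>y\<in>bar_cycles G R \<rho> 1. (\<lambda>x. y x \<oplus>\<^bsub>R\<^esub> c x) = (\<lambda>x. \<zero>\<^bsub>R\<^esub>)"
    using cl by (intro bexI[of _ "\<lambda>x. \<ominus>\<^bsub>R\<^esub> c x"]) (auto simp: l_neg)
qed (auto simp: cycle_add cycle_zero)

lemma boundariesE:
  assumes "b \<in> boundaries"
  obtains c where "c \<in> carrier (bchains 2)" "b = bar_boundary G R \<rho> c"
  using assms by (auto simp: bar_boundaries_def numeral_2_eq_2)

lemma boundariesI: "c \<in> carrier (bchains 2) \<Longrightarrow> bar_boundary G R \<rho> c \<in> boundaries"
  by (auto simp: bar_boundaries_def numeral_2_eq_2)

lemma boundaries_subset: "boundaries \<subseteq> bar_cycles G R \<rho> 1"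
  by (auto elim!: boundariesE simp: bar_cycles_def boundary_2_chain boundary_boundary)

lemma boundaries_add: "b \<in> boundaries \<Longrightarrow> b' \<in> boundaries \<Longrightarrow> (\<lambda>x. b x \<oplus>\<^bsub>R\<^esub> b' x) \<in> boundaries"
  by (elim boundariesE) (auto simp: boundary_add[symmetric] intro!: boundariesI chain_add_closed)

lemma boundaries_smult: "r \<in> carrier R \<Longrightarrow> b \<in> boundaries \<Longrightarrow> (\<lambda>x. r \<otimes>\<^bsub>R\<^esub> b x) \<in> boundaries"
  by (elim boundariesE) (auto simp: boundary_smult[symmetric] intro!: boundariesI chain_smult_closed)

lemma boundaries_zero: "(\<lambda>x. \<zero>\<^bsub>R\<^esub>) \<in> boundaries"
  using boundariesI[OF chain_zero_closed] by (simp add: bar_boundary_def)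

lemma abelian_subgroup_boundaries: "abelian_subgroup boundaries cycle_module"
proof (rule abelian_subgroupI3[OF additive_subgroupI abelian_group_cycles])
  interpret Z: abelian_group cycle_module by (rule abelian_group_cycles)
  show "subgroup boundaries (add_monoid cycle_module)"
  proof (rule group.subgroupI[OF Z.a_group])
    fix b assume b: "b \<in> boundaries"
    let ?n = "\<lambda>x. \<ominus>\<^bsub>R\<^esub> b x"
    have bz: "b \<in> bar_cycles G R \<rho> 1" using b boundaries_subset by blast
    have nb: "?n \<in> boundaries"
      using boundaries_smult[OF _ b, of "\<ominus>\<^bsub>R\<^esub> \<one>\<^bsub>R\<^esub>"] neg_eq_smult[OF cycle_chain[OF bz]] by simp
    have cl: "b x \<in> carrier R" for x using chain_closed cycle_chain[OF bz] by blast
    have "\<ominus>\<^bsub>cycle_module\<^esub> b = ?n"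
      by (rule Z.minus_equality) (use nb bz boundaries_subset cl in \<open>auto simp: cycle_module_simps chains_add l_neg\<close>)
    then show "inv\<^bsub>add_monoid cycle_module\<^esub> b \<in> boundaries" using nb by (simp add: a_inv_def)
  qed (use boundaries_subset boundaries_zero boundaries_add in \<open>auto simp: bar_chains_def\<close>)
qed

lemma homology_simps:
  "carrier (group_homology G R \<rho> 1) = homology_class ` bar_cycles G R \<rho> 1"
  "\<zero>\<^bsub>group_homology G R \<rho> 1\<^esub> = boundaries"
  by (auto simp: group_homology_def quotient_module_def A_RCOSETS_def' homology_class_def)

lemma homology_class_add:
  assumes "c \<in> bar_cycles G R \<rho> 1" "d \<in> bar_cycles G R \<rho> 1"
  shows "homology_class c \<oplus>\<^bsub>group_homology G R \<rho> 1\<^esub> homology_class d = homology_class (\<lambda>x. c x \<oplus>\<^bsub>R\<^esub> d x)"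
proof -
  interpret B: abelian_subgroup boundaries cycle_module by (rule abelian_subgroup_boundaries)
  show ?thesis
    using B.a_rcos_sum[of c d] assms
    by (simp add: group_homology_def quotient_module_def homology_class_def cycle_module_simps chains_add chains_smult)
qed

lemma homology_class_eqI:
  assumes "c \<in> bar_cycles G R \<rho> 1" "b \<in> boundaries" "d = (\<lambda>x. b x \<oplus>\<^bsub>R\<^esub> c x)"
  shows "homology_class d = homology_class c"
proof -
  interpret B: abelian_subgroup boundaries cycle_module by (rule abelian_subgroup_boundaries)
  have "d \<in> boundaries +>\<^bsub>cycle_module\<^esub> c"
    using assms by (auto simp: a_r_coset_def' cycle_module_simps chains_add)
  then show ?thesis
    unfolding homology_class_def using B.a_repr_independence'[of d c] assms(1) by (simp add: cycle_module_simps)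
qed

lemma homology_class_eqD:
  assumes "c \<in> bar_cycles G R \<rho> 1" "homology_class c = homology_class d"
  obtains b where "b \<in> boundaries" "c = (\<lambda>x. b x \<oplus>\<^bsub>R\<^esub> d x)"
proof -
  interpret B: abelian_subgroup boundaries cycle_module by (rule abelian_subgroup_boundaries)
  have "c \<in> boundaries +>\<^bsub>cycle_module\<^esub> d"
    using B.a_rcos_self[of c] assms unfolding homology_class_def by (simp add: cycle_module_simps)
  then show thesis using that by (auto simp: a_r_coset_def' cycle_module_simps chains_add)
qed

lemma homology_class_smult:
  assumes r: "r \<in> carrier R" and c: "c \<in> bar_cycles G R \<rho> 1"
  shows "r \<odot>\<^bsub>group_homology G R \<rho> 1\<^esub> homology_class c = homology_class (\<lambda>x. r \<otimes>\<^bsub>R\<^esub> c x)"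
proof -
  interpret B: abelian_subgroup boundaries cycle_module by (rule abelian_subgroup_boundaries)
  have "r \<odot>\<^bsub>group_homology G R \<rho> 1\<^esub> homology_class c = (\<Union>x\<in>homology_class c. homology_class (\<lambda>y. r \<otimes>\<^bsub>R\<^esub> x y))"
    by (simp add: group_homology_def quotient_module_def homology_class_def cycle_module_simps chains_add chains_smult)
  also have "\<dots> = (\<Union>x\<in>homology_class c. homology_class (\<lambda>x. r \<otimes>\<^bsub>R\<^esub> c x))"
  proof (rule SUP_cong[OF refl])
    fix x assume "x \<in> homology_class c"
    then obtain b where b: "b \<in> boundaries" "x = (\<lambda>y. b y \<oplus>\<^bsub>R\<^esub> c y)"
      by (auto simp: homology_class_def a_r_coset_def' cycle_module_simps chains_add)
    have cl: "b y \<in> carrier R" "c y \<in> carrier R" for y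
      using chain_closed cycle_chain c b(1) boundaries_subset by blast+
    show "homology_class (\<lambda>y. r \<otimes>\<^bsub>R\<^esub> x y) = homology_class (\<lambda>x. r \<otimes>\<^bsub>R\<^esub> c x)"
      by (rule homology_class_eqI[OF cycle_smult[OF r c] boundaries_smult[OF r b(1)]])
         (use r cl in \<open>simp add: b(2) r_distr\<close>)
  qed
  also have "\<dots> = homology_class (\<lambda>x. r \<otimes>\<^bsub>R\<^esub> c x)"
    using B.a_rcos_self[of c] c by (auto simp: homology_class_def cycle_module_simps chains_add chains_smult)
  finally show ?thesis .
qed

end

section \<open>Idempotent matrices and crossed homomorphisms\<close>

fun word_prod :: "('g, 'm) monoid_scheme \<Rightarrow> (nat \<Rightarrow> 'g) \<Rightarrow> nat list \<Rightarrow> 'g" where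
  "word_prod G s [] = \<one>\<^bsub>G\<^esub>"
| "word_prod G s (i # w) = s i \<otimes>\<^bsub>G\<^esub> word_prod G s w"

lemma (in group) word_prod_closed:
  "(\<And>i. i < d \<Longrightarrow> s i \<in> carrier G) \<Longrightarrow> set w \<subseteq> {..<d} \<Longrightarrow> word_prod G s w \<in> carrier G"
  by (induction w) auto

lemma (in group) word_prod_append:
  "(\<And>i. i < d \<Longrightarrow> s i \<in> carrier G) \<Longrightarrow> set v \<subseteq> {..<d} \<Longrightarrow> set w \<subseteq> {..<d} \<Longrightarrow>
    word_prod G s (v @ w) = word_prod G s v \<otimes> word_prod G s w"
  by (induction v) (auto simp: m_assoc word_prod_closed[of d])

context group_in_ring
begin

text \<open>
  The chain \<open>\<Sum>i<d. x i [s i]\<close>, for \<open>s\<close> injective.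
\<close>

definition chain_of :: "nat \<Rightarrow> (nat \<Rightarrow> 'g) \<Rightarrow> (nat \<Rightarrow> 'r) \<Rightarrow> 'g list \<Rightarrow> 'r" where
  "chain_of d s x l =
    (if length l = 1 \<and> hd l \<in> s ` {..<d} then x (inv_into {..<d} s (hd l)) else \<zero>\<^bsub>R\<^esub>)"

lemma chain_of_chain:
  assumes "\<And>i. i < d \<Longrightarrow> s i \<in> carrier G" "inj_on s {..<d}" "\<And>i. i < d \<Longrightarrow> x i \<in> carrier R"
  shows "chain_of d s x \<in> carrier (bchains 1)"
proof (rule chainI[of _ "(\<lambda>i. [s i]) ` {..<d}"])
  show "l \<in> (\<lambda>i. [s i]) ` {..<d}" if "chain_of d s x l \<noteq> \<zero>\<^bsub>R\<^esub>" for l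
    using that by (cases l) (auto simp: chain_of_def split: if_splits)
  show "chain_of d s x l \<in> carrier R" for l
    using assms by (auto simp: chain_of_def)
qed (use assms(1) in auto)

lemma chain_of_pairing:
  assumes "\<And>i. i < d \<Longrightarrow> s i \<in> carrier G" "inj_on s {..<d}" "\<And>i. i < d \<Longrightarrow> x i \<in> carrier R"
    "\<And>g. g \<in> carrier G \<Longrightarrow> z g \<in> carrier R"
  shows "(\<Oplus>\<^bsub>R\<^esub>l\<in>{l. chain_of d s x l \<noteq> \<zero>\<^bsub>R\<^esub>}. chain_of d s x l \<otimes>\<^bsub>R\<^esub> z (hd l)) = (\<Oplus>\<^bsub>R\<^esub>i\<in>{..<d}. x i \<otimes>\<^bsub>R\<^esub> z (s i))"
proof -
  let ?A = "(\<lambda>i. [s i]) ` {..<d}"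
  have c: "chain_of d s x \<in> carrier (bchains 1)" by (rule chain_of_chain[OF assms(1-3)])
  have "(\<Oplus>\<^bsub>R\<^esub>l\<in>{l. chain_of d s x l \<noteq> \<zero>\<^bsub>R\<^esub>}. chain_of d s x l \<otimes>\<^bsub>R\<^esub> z (hd l)) = (\<Oplus>\<^bsub>R\<^esub>l\<in>?A. chain_of d s x l \<otimes>\<^bsub>R\<^esub> z (hd l))"
  proof (rule add.finprod_mono_neutral_cong)
    show "finite {l. chain_of d s x l \<noteq> \<zero>\<^bsub>R\<^esub>}" by (rule chain_finite[OF c])
    show "(\<lambda>l. chain_of d s x l \<otimes>\<^bsub>R\<^esub> z (hd l)) \<in> {l. chain_of d s x l \<noteq> \<zero>\<^bsub>R\<^esub>} \<rightarrow> carrier R"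
      using chain_closed[OF c] assms(4) by (auto elim!: chain1_cases[OF c])
    show "chain_of d s x l \<otimes>\<^bsub>R\<^esub> z (hd l) = \<zero>\<^bsub>R\<^esub>" if "l \<in> {l. chain_of d s x l \<noteq> \<zero>\<^bsub>R\<^esub>} - ?A" for l
      using that by (cases l) (auto simp: chain_of_def split: if_splits)
  qed (use chain_closed[OF c] assms in auto)
  also have "\<dots> = (\<Oplus>\<^bsub>R\<^esub>i\<in>{..<d}. chain_of d s x [s i] \<otimes>\<^bsub>R\<^esub> z (hd [s i]))"
    by (rule finsum_reindex) (use chain_closed[OF c] assms in \<open>auto simp: inj_on_def\<close>)
  also have "\<dots> = (\<Oplus>\<^bsub>R\<^esub>i\<in>{..<d}. x i \<otimes>\<^bsub>R\<^esub> z (s i))"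
    by (rule finsum_cong') (use assms in \<open>auto simp: chain_of_def\<close>)
  finally show ?thesis .
qed

lemma row_times_matrix_assoc:
  fixes d :: nat
  assumes y: "\<And>k. k < d \<Longrightarrow> y k \<in> carrier R" and A: "\<And>k i. k < d \<Longrightarrow> i < d \<Longrightarrow> A k i \<in> carrier R"
    and v: "\<And>i. i < d \<Longrightarrow> v i \<in> carrier R"
  shows "(\<Oplus>\<^bsub>R\<^esub>i\<in>{..<d}. (\<Oplus>\<^bsub>R\<^esub>k\<in>{..<d}. y k \<otimes>\<^bsub>R\<^esub> A k i) \<otimes>\<^bsub>R\<^esub> v i)
    = (\<Oplus>\<^bsub>R\<^esub>k\<in>{..<d}. y k \<otimes>\<^bsub>R\<^esub> (\<Oplus>\<^bsub>R\<^esub>i\<in>{..<d}. A k i \<otimes>\<^bsub>R\<^esub> v i))"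
proof -
  have "(\<Oplus>\<^bsub>R\<^esub>i\<in>{..<d}. (\<Oplus>\<^bsub>R\<^esub>k\<in>{..<d}. y k \<otimes>\<^bsub>R\<^esub> A k i) \<otimes>\<^bsub>R\<^esub> v i)
      = (\<Oplus>\<^bsub>R\<^esub>i\<in>{..<d}. \<Oplus>\<^bsub>R\<^esub>k\<in>{..<d}. y k \<otimes>\<^bsub>R\<^esub> (A k i \<otimes>\<^bsub>R\<^esub> v i))"
  proof (rule finsum_cong')
    fix i assume i: "i \<in> {..<d}"
    have "(\<Oplus>\<^bsub>R\<^esub>k\<in>{..<d}. y k \<otimes>\<^bsub>R\<^esub> A k i) \<otimes>\<^bsub>R\<^esub> v i = (\<Oplus>\<^bsub>R\<^esub>k\<in>{..<d}. y k \<otimes>\<^bsub>R\<^esub> A k i \<otimes>\<^bsub>R\<^esub> v i)"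
      by (rule finsum_ldistr) (use i y A v in auto)
    also have "\<dots> = (\<Oplus>\<^bsub>R\<^esub>k\<in>{..<d}. y k \<otimes>\<^bsub>R\<^esub> (A k i \<otimes>\<^bsub>R\<^esub> v i))"
      by (rule finsum_cong') (use i y A v in \<open>auto simp: m_assoc\<close>)
    finally show "(\<Oplus>\<^bsub>R\<^esub>k\<in>{..<d}. y k \<otimes>\<^bsub>R\<^esub> A k i) \<otimes>\<^bsub>R\<^esub> v i = \<dots>" .
  qed (use y A v in \<open>auto intro!: finsum_closed\<close>)
  also have "\<dots> = (\<Oplus>\<^bsub>R\<^esub>k\<in>{..<d}. \<Oplus>\<^bsub>R\<^esub>i\<in>{..<d}. y k \<otimes>\<^bsub>R\<^esub> (A k i \<otimes>\<^bsub>R\<^esub> v i))"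
    by (rule finsum_finsum_swap) (use y A v in auto)
  also have "\<dots> = (\<Oplus>\<^bsub>R\<^esub>k\<in>{..<d}. y k \<otimes>\<^bsub>R\<^esub> (\<Oplus>\<^bsub>R\<^esub>i\<in>{..<d}. A k i \<otimes>\<^bsub>R\<^esub> v i))"
  proof (rule finsum_cong')
    fix k assume k: "k \<in> {..<d}"
    show "(\<Oplus>\<^bsub>R\<^esub>i\<in>{..<d}. y k \<otimes>\<^bsub>R\<^esub> (A k i \<otimes>\<^bsub>R\<^esub> v i)) = y k \<otimes>\<^bsub>R\<^esub> (\<Oplus>\<^bsub>R\<^esub>i\<in>{..<d}. A k i \<otimes>\<^bsub>R\<^esub> v i)"
      by (rule finsum_rdistr[symmetric]) (use k y A v in auto)
  qed (use y A v in \<open>auto intro!: finsum_closed\<close>)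
  finally show ?thesis .
qed

lemma chain_of_add:
  assumes "\<And>i. i < d \<Longrightarrow> x i \<in> carrier R" "\<And>i. i < d \<Longrightarrow> y i \<in> carrier R"
  shows "chain_of d s (\<lambda>i\<in>{..<d}. x i \<oplus>\<^bsub>R\<^esub> y i) = (\<lambda>l. chain_of d s x l \<oplus>\<^bsub>R\<^esub> chain_of d s y l)"
  using inv_into_into[of _ s "{..<d}"] by (auto simp: chain_of_def fun_eq_iff)

lemma chain_of_smult:
  assumes "\<And>i. i < d \<Longrightarrow> x i \<in> carrier R" "r \<in> carrier R"
  shows "chain_of d s (\<lambda>i\<in>{..<d}. r \<otimes>\<^bsub>R\<^esub> x i) = (\<lambda>l. r \<otimes>\<^bsub>R\<^esub> chain_of d s x l)"
  using inv_into_into[of _ s "{..<d}"] assms by (auto simp: chain_of_def fun_eq_iff)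

text \<open>
  An element of the row module satisfies \<open>x = x A\<close> and is sent to the class of the chain
  \<open>\<Sum> x i [s i]\<close>. The crossed homomorphism \<open>z j\<close> restricts to the column \<open>j\<close> of \<open>A\<close> on the generators,
  so its pairing with this chain is the entry \<open>j\<close> of \<open>x A\<close>, that is, \<open>x j\<close>. Boundaries pair to zero,
  so the class of the chain determines \<open>x\<close>.
\<close>

lemma row_module_embeds:
  assumes s: "\<And>i. i < d \<Longrightarrow> s i \<in> carrier G" "inj_on s {..<d}"
    and A: "idempotent_matrix R d A"
    and cyc: "\<And>k. k < d \<Longrightarrow> (\<Oplus>\<^bsub>R\<^esub>i\<in>{..<d}. A k i \<otimes>\<^bsub>R\<^esub> (\<rho> (s i) \<ominus>\<^bsub>R\<^esub> \<one>\<^bsub>R\<^esub>)) = \<zero>\<^bsub>R\<^esub>"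
    and z: "\<And>j g. j < d \<Longrightarrow> g \<in> carrier G \<Longrightarrow> z j g \<in> carrier R"
      "\<And>j g h. j < d \<Longrightarrow> g \<in> carrier G \<Longrightarrow> h \<in> carrier G \<Longrightarrow> z j (g \<otimes>\<^bsub>G\<^esub> h) = z j g \<oplus>\<^bsub>R\<^esub> \<rho> g \<otimes>\<^bsub>R\<^esub> z j h"
      "\<And>i j. i < d \<Longrightarrow> j < d \<Longrightarrow> z j (s i) = A i j"
  shows "\<exists>\<phi> \<in> module_hom R (row_module R d A) (group_homology G R \<rho> 1).
    inj_on \<phi> (carrier (row_module R d A))"
proof -
  have Ac: "A i j \<in> carrier R" if "i < d" "j < d" for i j
    using A that by (auto simp: idempotent_matrix_def)
  have AA: "(\<Oplus>\<^bsub>R\<^esub>j\<in>{..<d}. A i j \<otimes>\<^bsub>R\<^esub> A j k) = A i k" if "i < d" "k < d" for i k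
    using A that by (auto simp: idempotent_matrix_def)
  let ?M = "row_module R d A"
  have add: "x \<oplus>\<^bsub>?M\<^esub> y = (\<lambda>i\<in>{..<d}. x i \<oplus>\<^bsub>R\<^esub> y i)"
    and smult: "r \<odot>\<^bsub>?M\<^esub> x = (\<lambda>i\<in>{..<d}. r \<otimes>\<^bsub>R\<^esub> x i)" for x y r
    by (simp_all add: row_module_def func_space_def)
  have M: "\<exists>y. (\<forall>k<d. y k \<in> carrier R) \<and> x = (\<lambda>j\<in>{..<d}. \<Oplus>\<^bsub>R\<^esub>i\<in>{..<d}. y i \<otimes>\<^bsub>R\<^esub> A i j)"
    if "x \<in> carrier ?M" for x
    using that by (auto simp: row_module_def)
  have Mc: "x i \<in> carrier R" if "x \<in> carrier ?M" "i < d" for x i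
    using M[OF that(1)] that(2) Ac by (auto intro!: finsum_closed)
  have xA: "(\<Oplus>\<^bsub>R\<^esub>i\<in>{..<d}. x i \<otimes>\<^bsub>R\<^esub> A i j) = x j" if x: "x \<in> carrier ?M" and j: "j < d" for x j
  proof -
    obtain y where y: "\<forall>k<d. y k \<in> carrier R" "x = (\<lambda>j\<in>{..<d}. \<Oplus>\<^bsub>R\<^esub>i\<in>{..<d}. y i \<otimes>\<^bsub>R\<^esub> A i j)"
      using M[OF x] by blast
    have "(\<Oplus>\<^bsub>R\<^esub>i\<in>{..<d}. x i \<otimes>\<^bsub>R\<^esub> A i j) = (\<Oplus>\<^bsub>R\<^esub>i\<in>{..<d}. (\<Oplus>\<^bsub>R\<^esub>k\<in>{..<d}. y k \<otimes>\<^bsub>R\<^esub> A k i) \<otimes>\<^bsub>R\<^esub> A i j)"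
      by (rule finsum_cong') (use y Ac j in \<open>auto intro!: finsum_closed m_closed\<close>)
    also have "\<dots> = (\<Oplus>\<^bsub>R\<^esub>k\<in>{..<d}. y k \<otimes>\<^bsub>R\<^esub> (\<Oplus>\<^bsub>R\<^esub>i\<in>{..<d}. A k i \<otimes>\<^bsub>R\<^esub> A i j))"
      by (rule row_times_matrix_assoc) (use y Ac j in auto)
    also have "\<dots> = (\<Oplus>\<^bsub>R\<^esub>k\<in>{..<d}. y k \<otimes>\<^bsub>R\<^esub> A k j)"
      by (rule finsum_cong') (use y Ac j AA in auto)
    finally show ?thesis using y j by simp
  qed
  have cycle: "chain_of d s x \<in> bar_cycles G R \<rho> 1" if x: "x \<in> carrier ?M" for x
  proof -
    have c: "chain_of d s x \<in> carrier (bchains 1)" by (rule chain_of_chain[OF s Mc[OF x]])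
    obtain y where y: "\<forall>k<d. y k \<in> carrier R" "x = (\<lambda>j\<in>{..<d}. \<Oplus>\<^bsub>R\<^esub>i\<in>{..<d}. y i \<otimes>\<^bsub>R\<^esub> A i j)"
      using M[OF x] by blast
    have "(\<Oplus>\<^bsub>R\<^esub>i\<in>{..<d}. x i \<otimes>\<^bsub>R\<^esub> (\<rho> (s i) \<ominus>\<^bsub>R\<^esub> \<one>\<^bsub>R\<^esub>))
        = (\<Oplus>\<^bsub>R\<^esub>i\<in>{..<d}. (\<Oplus>\<^bsub>R\<^esub>k\<in>{..<d}. y k \<otimes>\<^bsub>R\<^esub> A k i) \<otimes>\<^bsub>R\<^esub> (\<rho> (s i) \<ominus>\<^bsub>R\<^esub> \<one>\<^bsub>R\<^esub>))"
      by (rule finsum_cong') (use y Ac s in \<open>auto intro!: finsum_closed m_closed\<close>)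
    also have "\<dots> = (\<Oplus>\<^bsub>R\<^esub>k\<in>{..<d}. y k \<otimes>\<^bsub>R\<^esub> (\<Oplus>\<^bsub>R\<^esub>i\<in>{..<d}. A k i \<otimes>\<^bsub>R\<^esub> (\<rho> (s i) \<ominus>\<^bsub>R\<^esub> \<one>\<^bsub>R\<^esub>)))"
      by (rule row_times_matrix_assoc) (use y Ac s in auto)
    also have "\<dots> = (\<Oplus>\<^bsub>R\<^esub>k\<in>{..<d}. \<zero>\<^bsub>R\<^esub>)"
      by (rule finsum_cong') (use y cyc in auto)
    finally have "(\<Oplus>\<^bsub>R\<^esub>i\<in>{..<d}. x i \<otimes>\<^bsub>R\<^esub> (\<rho> (s i) \<ominus>\<^bsub>R\<^esub> \<one>\<^bsub>R\<^esub>)) = \<zero>\<^bsub>R\<^esub>" by simp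
    then have "bar_boundary G R \<rho> (chain_of d s x) y = \<zero>\<^bsub>R\<^esub>" for y
      unfolding boundary_1[OF c] using chain_of_pairing[OF s Mc[OF x], where z = "\<lambda>g. \<rho> g \<ominus>\<^bsub>R\<^esub> \<one>\<^bsub>R\<^esub>"] by simp
    then show ?thesis using c by (auto simp: bar_cycles_def)
  qed
  let ?\<phi> = "\<lambda>x. homology_class (chain_of d s x)"
  have hom: "?\<phi> \<in> module_hom R ?M (group_homology G R \<rho> 1)"
    unfolding module_hom_def
  proof (intro CollectI conjI allI impI)
    show "?\<phi> \<in> carrier ?M \<rightarrow> carrier (group_homology G R \<rho> 1)"
      unfolding homology_simps using cycle by blast
  next
    fix x y assume xy: "x \<in> carrier ?M \<and> y \<in> carrier ?M"
    then have "chain_of d s (\<lambda>i\<in>{..<d}. x i \<oplus>\<^bsub>R\<^esub> y i) = (\<lambda>l. chain_of d s x l \<oplus>\<^bsub>R\<^esub> chain_of d s y l)"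
      by (intro chain_of_add) (use Mc in blast)+
    then show "?\<phi> (x \<oplus>\<^bsub>?M\<^esub> y) = ?\<phi> x \<oplus>\<^bsub>group_homology G R \<rho> 1\<^esub> ?\<phi> y"
      using xy unfolding add by (simp only: homology_class_add[OF cycle cycle])
  next
    fix r x assume rx: "r \<in> carrier R \<and> x \<in> carrier ?M"
    then have "chain_of d s (\<lambda>i\<in>{..<d}. r \<otimes>\<^bsub>R\<^esub> x i) = (\<lambda>l. r \<otimes>\<^bsub>R\<^esub> chain_of d s x l)"
      by (intro chain_of_smult) (use Mc in blast)+
    then show "?\<phi> (r \<odot>\<^bsub>?M\<^esub> x) = r \<odot>\<^bsub>group_homology G R \<rho> 1\<^esub> ?\<phi> x"
      using rx unfolding smult by (simp only: homology_class_smult[OF _ cycle])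
  qed
  have "inj_on ?\<phi> (carrier ?M)"
  proof (rule inj_onI)
    fix x y assume x: "x \<in> carrier ?M" and y: "y \<in> carrier ?M" and eq: "?\<phi> x = ?\<phi> y"
    obtain b where b: "b \<in> boundaries" "chain_of d s x = (\<lambda>l. b l \<oplus>\<^bsub>R\<^esub> chain_of d s y l)"
      using homology_class_eqD[OF cycle[OF x] eq] .
    obtain c where c: "c \<in> carrier (bchains 2)" "b = bar_boundary G R \<rho> c" using boundariesE[OF b(1)] .
    have bc: "b \<in> carrier (bchains 1)" using boundary_2_chain[OF c(1)] c(2) by simp
    have "x j = y j" if j: "j < d" for j
    proof -
      define \<zeta> where "\<zeta> l = (if length l = 1 \<and> set l \<subseteq> carrier G then z j (hd l) else \<zero>\<^bsub>R\<^esub>)" for l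
      have zc: "\<zeta> l \<in> carrier R" for l using z(1)[OF j] by (cases l) (auto simp: \<zeta>_def)
      have p: "pairing e \<zeta> = (\<Oplus>\<^bsub>R\<^esub>l\<in>{l. e l \<noteq> \<zero>\<^bsub>R\<^esub>}. e l \<otimes>\<^bsub>R\<^esub> z j (hd l))" if e: "e \<in> carrier (bchains 1)" for e
        unfolding pairing_def
        by (rule finsum_cong')
           (use chain_closed[OF e] z(1)[OF j] in \<open>auto elim!: chain1_cases[OF e] simp: \<zeta>_def\<close>)
      have px: "pairing (chain_of d s v) \<zeta> = v j" if v: "v \<in> carrier ?M" for v
      proof -
        have "pairing (chain_of d s v) \<zeta> = (\<Oplus>\<^bsub>R\<^esub>i\<in>{..<d}. v i \<otimes>\<^bsub>R\<^esub> z j (s i))"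
          by (rule trans[OF p[OF chain_of_chain[OF s Mc[OF v]]] chain_of_pairing[OF s Mc[OF v] z(1)[OF j]]])
        also have "\<dots> = (\<Oplus>\<^bsub>R\<^esub>i\<in>{..<d}. v i \<otimes>\<^bsub>R\<^esub> A i j)"
          by (rule finsum_cong') (use Mc[OF v] Ac z(3) j in auto)
        finally show ?thesis using xA[OF v j] by simp
      qed
      have "pairing b \<zeta> = \<zero>\<^bsub>R\<^esub>"
        by (rule trans[OF p[OF bc] pairing_boundary[OF c(1) z(1,2)[OF j], folded c(2)]])
      moreover have "pairing (chain_of d s x) \<zeta> = pairing b \<zeta> \<oplus>\<^bsub>R\<^esub> pairing (chain_of d s y) \<zeta>"
        unfolding b(2) by (rule pairing_add[OF bc cycle_chain[OF cycle[OF y]] zc])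
      ultimately show ?thesis using px[OF x] px[OF y] Mc[OF y j] by simp
    qed
    moreover have "x \<in> extensional {..<d}" "y \<in> extensional {..<d}"
      using x y by (auto simp: row_module_def)
    ultimately show "x = y" by (auto intro: extensionalityI)
  qed
  with hom show ?thesis by blast
qed

text \<open>
  The Fox derivative of a word: the extension of the column \<open>j\<close> of \<open>A\<close> from letters to words by the
  rule of a crossed homomorphism.
\<close>

fun fox :: "(nat \<Rightarrow> 'g) \<Rightarrow> (nat \<Rightarrow> nat \<Rightarrow> 'r) \<Rightarrow> nat \<Rightarrow> nat list \<Rightarrow> 'r" where
  "fox s A j [] = \<zero>\<^bsub>R\<^esub>"
| "fox s A j (i # w) = A i j \<oplus>\<^bsub>R\<^esub> \<rho> (s i) \<otimes>\<^bsub>R\<^esub> fox s A j w"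

text \<open>
  Since the Fox derivatives vanish on loops, they depend only on the product of a word, and so
  define crossed homomorphisms on the group.
\<close>

lemma harmonic_idempotent_embeds:
  assumes s: "\<And>i. i < d \<Longrightarrow> s i \<in> carrier G" "inj_on s {..<d}"
    and gen: "\<And>g. g \<in> carrier G \<Longrightarrow> \<exists>w. set w \<subseteq> {..<d} \<and> word_prod G s w = g"
    and A: "idempotent_matrix R d A"
    and cyc: "\<And>k. k < d \<Longrightarrow> (\<Oplus>\<^bsub>R\<^esub>i\<in>{..<d}. A k i \<otimes>\<^bsub>R\<^esub> (\<rho> (s i) \<ominus>\<^bsub>R\<^esub> \<one>\<^bsub>R\<^esub>)) = \<zero>\<^bsub>R\<^esub>"
    and loop: "\<And>w j. set w \<subseteq> {..<d} \<Longrightarrow> j < d \<Longrightarrow> word_prod G s w = \<one>\<^bsub>G\<^esub> \<Longrightarrow> fox s A j w = \<zero>\<^bsub>R\<^esub>"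
  shows "\<exists>\<phi> \<in> module_hom R (row_module R d A) (group_homology G R \<rho> 1).
    inj_on \<phi> (carrier (row_module R d A))"
proof -
  have Ac: "A i j \<in> carrier R" if "i < d" "j < d" for i j
    using A that by (auto simp: idempotent_matrix_def)
  have fc: "fox s A j w \<in> carrier R" if "set w \<subseteq> {..<d}" "j < d" for w j
    using that by (induction w) (auto simp: Ac s)
  have wc: "word_prod G s w \<in> carrier G" if "set w \<subseteq> {..<d}" for w
    by (rule word_prod_closed[OF s(1) that])
  have app: "fox s A j (v @ w) = fox s A j v \<oplus>\<^bsub>R\<^esub> \<rho> (word_prod G s v) \<otimes>\<^bsub>R\<^esub> fox s A j w"
    if "set v \<subseteq> {..<d}" "set w \<subseteq> {..<d}" "j < d" for v w j
    using that(1)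
  proof (induction v)
    case Nil
    then show ?case using fc[OF that(2,3)] by (simp add: rho_one)
  next
    case (Cons i v)
    then have i: "i < d" "set v \<subseteq> {..<d}" by auto
    show ?case
      using Cons.IH[OF i(2)] i fc[OF that(2,3)] fc[OF i(2) that(3)] Ac[OF i(1) that(3)] s(1)[OF i(1)] wc[OF i(2)]
      by (simp add: rho_mult r_distr a_assoc m_assoc)
  qed
  have eq: "fox s A j v = fox s A j w"
    if v: "set v \<subseteq> {..<d}" and w: "set w \<subseteq> {..<d}" and j: "j < d" and e: "word_prod G s v = word_prod G s w" for v w j
  proof -
    (* A common inverse word u turns both v and w into loops. *)
    obtain u where u: "set u \<subseteq> {..<d}" "word_prod G s u = inv\<^bsub>G\<^esub> (word_prod G s v)"
      using gen[of "inv\<^bsub>G\<^esub> (word_prod G s v)"] wc[OF v] by auto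
    have "fox s A j (v @ u) = \<zero>\<^bsub>R\<^esub>" "fox s A j (w @ u) = \<zero>\<^bsub>R\<^esub>"
      by (rule loop; use v w u j e wc in \<open>simp add: word_prod_append[OF s(1)]\<close>)+
    then have "fox s A j v \<oplus>\<^bsub>R\<^esub> \<rho> (word_prod G s v) \<otimes>\<^bsub>R\<^esub> fox s A j u
        = fox s A j w \<oplus>\<^bsub>R\<^esub> \<rho> (word_prod G s v) \<otimes>\<^bsub>R\<^esub> fox s A j u"
      unfolding app[OF v u(1) j] app[OF w u(1) j] e by simp
    then show ?thesis using fc[OF v j] fc[OF w j] fc[OF u(1) j] wc[OF v] by simp
  qed
  define word where "word g = (SOME w. set w \<subseteq> {..<d} \<and> word_prod G s w = g)" for g
  have word: "set (word g) \<subseteq> {..<d}" "word_prod G s (word g) = g" if "g \<in> carrier G" for g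
    using someI_ex[OF gen[OF that]] by (simp_all add: word_def)
  show ?thesis
  proof (rule row_module_embeds[OF s A cyc, where z = "\<lambda>j g. fox s A j (word g)"])
    fix j g assume "j < d" "g \<in> carrier G"
    then show "fox s A j (word g) \<in> carrier R" using fc word by blast
  next
    fix j g h assume j: "j < d" and g: "g \<in> carrier G" and h: "h \<in> carrier G"
    have "fox s A j (word (g \<otimes>\<^bsub>G\<^esub> h)) = fox s A j (word g @ word h)"
      by (rule eq) (use j g h word word_prod_append[OF s(1)] in auto)
    then show "fox s A j (word (g \<otimes>\<^bsub>G\<^esub> h)) = fox s A j (word g) \<oplus>\<^bsub>R\<^esub> \<rho> g \<otimes>\<^bsub>R\<^esub> fox s A j (word h)"
      using app[of "word g" "word h" j] word j g h by simp
  next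
    fix i j assume ij: "i < d" "j < d"
    have "fox s A j (word (s i)) = fox s A j [i]"
      by (rule eq) (use ij word s in auto)
    then show "fox s A j (word (s i)) = A i j" using Ac[OF ij] s(1)[OF ij(1)] by simp
  qed
qed

end

section \<open>The group von Neumann algebra as a ring\<close>

context group
begin

lemma l2_summable_UNIV:
  assumes "f \<in> l2 G" shows "(\<lambda>x. (cmod (f x))\<^sup>2) summable_on UNIV"
proof -
  have "(\<lambda>x. (cmod (f x))\<^sup>2) summable_on carrier G" using assms by (simp add: l2_def)
  then show ?thesis
    by (rule iffD1[OF summable_on_cong_neutral, rotated -1]) (use assms in \<open>auto simp: l2_def\<close>)
qed

lemma coord_l2: "f \<in> l2 G \<Longrightarrow> coord (Ell2 f) = f"
  by (rule coord_Ell2[OF l2_summable_UNIV])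

lemma l2_outside: "f \<in> l2 G \<Longrightarrow> x \<notin> carrier G \<Longrightarrow> f x = 0"
  by (simp add: l2_def)

lemma coord_in_l2: "(\<And>x. x \<notin> carrier G \<Longrightarrow> coord F x = 0) \<Longrightarrow> coord F \<in> l2 G"
  by (auto simp: l2_def coord_summable)

lemma l2_norm_eq:
  assumes "f \<in> l2 G" shows "l2_norm G f = norm (Ell2 f)"
proof -
  have "(\<Sum>\<^sub>\<infinity>x\<in>carrier G. (cmod (f x))\<^sup>2) = (\<Sum>\<^sub>\<infinity>x. (cmod (f x))\<^sup>2)"
    by (rule infsum_cong_neutral) (use assms in \<open>auto simp: l2_def\<close>)
  also have "\<dots> = (norm (Ell2 f))\<^sup>2" by (simp add: norm_ell2 coord_l2[OF assms])
  finally show ?thesis by (simp add: l2_norm_def)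
qed

lemma l2_norm_coord: "coord F \<in> l2 G \<Longrightarrow> l2_norm G (coord F) = norm F"
  by (simp add: l2_norm_eq coord_inverse)

lemma l2_add: "f \<in> l2 G \<Longrightarrow> h \<in> l2 G \<Longrightarrow> (\<lambda>x. f x + h x) \<in> l2 G"
  by (auto simp: l2_def square_summable_add)

lemma l2_cmult: "f \<in> l2 G \<Longrightarrow> (\<lambda>x. a * f x) \<in> l2 G"
  by (auto simp: l2_def square_summable_cmult)

lemma l2_zero: "(\<lambda>x. 0) \<in> l2 G"
  by (simp add: l2_def)

lemma Ell2_add: "f \<in> l2 G \<Longrightarrow> h \<in> l2 G \<Longrightarrow> Ell2 (\<lambda>x. f x + h x) = Ell2 f + Ell2 h"
  by (simp add: plus_ell2_def coord_l2)

lemma l2_norm_triangle: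
  "f \<in> l2 G \<Longrightarrow> h \<in> l2 G \<Longrightarrow> l2_norm G (\<lambda>x. f x + h x) \<le> l2_norm G f + l2_norm G h"
  by (simp add: l2_norm_eq l2_add Ell2_add norm_triangle_ineq)

lemma l2_norm_nonneg: "f \<in> l2 G \<Longrightarrow> l2_norm G f \<ge> 0"
  by (simp add: l2_norm_eq)

lemma l2_norm_uminus: "l2_norm G (\<lambda>x. - f x) = l2_norm G f"
  by (simp add: l2_norm_def)

lemma l2_reindex:
  assumes f: "f \<in> l2 G" and b: "bij_betw s (carrier G) (carrier G)"
  shows "(\<lambda>x. if x \<in> carrier G then f (s x) else 0) \<in> l2 G"
    and "l2_norm G (\<lambda>x. if x \<in> carrier G then f (s x) else 0) = l2_norm G f"
proof -
  have "(\<lambda>x. (cmod (f x))\<^sup>2) summable_on carrier G" using f by (simp add: l2_def)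
  then have "(\<lambda>x. (cmod (f (s x)))\<^sup>2) summable_on carrier G"
    by (subst summable_on_reindex_bij_betw[OF b])
  then have "(\<lambda>x. (cmod (if x \<in> carrier G then f (s x) else 0))\<^sup>2) summable_on carrier G"
    by (rule summable_on_cong[THEN iffD1, rotated]) simp
  then show "(\<lambda>x. if x \<in> carrier G then f (s x) else 0) \<in> l2 G" by (simp add: l2_def)
  have "(\<Sum>\<^sub>\<infinity>x\<in>carrier G. (cmod (if x \<in> carrier G then f (s x) else 0))\<^sup>2)
      = (\<Sum>\<^sub>\<infinity>x\<in>carrier G. (cmod (f (s x)))\<^sup>2)"
    by (rule infsum_cong) simp
  also have "\<dots> = (\<Sum>\<^sub>\<infinity>x\<in>carrier G. (cmod (f x))\<^sup>2)"
    by (rule infsum_reindex_bij_betw[OF b])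
  finally show "l2_norm G (\<lambda>x. if x \<in> carrier G then f (s x) else 0) = l2_norm G f"
    by (simp add: l2_norm_def)
qed

lemma bij_betw_left: "g \<in> carrier G \<Longrightarrow> bij_betw (\<lambda>x. inv g \<otimes> x) (carrier G) (carrier G)"
  by (rule bij_betwI[of _ _ _ "\<lambda>x. g \<otimes> x"]) (auto simp: m_assoc[symmetric])

lemma bij_betw_right: "g \<in> carrier G \<Longrightarrow> bij_betw (\<lambda>x. x \<otimes> g) (carrier G) (carrier G)"
  by (rule bij_betwI[of _ _ _ "\<lambda>x. x \<otimes> inv g"]) (auto simp: m_assoc)

lemma left_translation_l2: "g \<in> carrier G \<Longrightarrow> f \<in> l2 G \<Longrightarrow> left_translation G g f \<in> l2 G"
  unfolding left_translation_def by (rule l2_reindex(1)[OF _ bij_betw_left])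

lemma left_translation_add:
  "left_translation G g (\<lambda>x. f x + h x) = (\<lambda>x. left_translation G g f x + left_translation G g h x)"
  by (auto simp: left_translation_def)

lemma vN_carrierD:
  assumes "T \<in> carrier (vN_algebra G)"
  shows "T \<in> extensional (l2 G)" "\<And>f. f \<in> l2 G \<Longrightarrow> T f \<in> l2 G"
    "\<And>f h. f \<in> l2 G \<Longrightarrow> h \<in> l2 G \<Longrightarrow> T (\<lambda>x. f x + h x) = (\<lambda>x. T f x + T h x)"
    "\<And>a f. f \<in> l2 G \<Longrightarrow> T (\<lambda>x. a * f x) = (\<lambda>x. a * T f x)"
    "\<exists>C\<ge>0. \<forall>f\<in>l2 G. l2_norm G (T f) \<le> C * l2_norm G f"
    "\<And>g f. g \<in> carrier G \<Longrightarrow> f \<in> l2 G \<Longrightarrow> T (left_translation G g f) = left_translation G g (T f)"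
proof -
  have T: "T \<in> l2 G \<rightarrow>\<^sub>E l2 G"
    "\<forall>f\<in>l2 G. \<forall>h\<in>l2 G. T (\<lambda>x. f x + h x) = (\<lambda>x. T f x + T h x)"
    "\<forall>a. \<forall>f\<in>l2 G. T (\<lambda>x. a * f x) = (\<lambda>x. a * T f x)"
    "\<exists>C. \<forall>f\<in>l2 G. l2_norm G (T f) \<le> C * l2_norm G f"
    "\<forall>g\<in>carrier G. \<forall>f\<in>l2 G. T (left_translation G g f) = left_translation G g (T f)"
    using assms by (simp_all add: vN_algebra_def)
  show "T \<in> extensional (l2 G)" using T(1) by (simp add: PiE_iff)
  show "T f \<in> l2 G" if "f \<in> l2 G" for f using T(1) that by blast
  show "T (\<lambda>x. f x + h x) = (\<lambda>x. T f x + T h x)" if "f \<in> l2 G" "h \<in> l2 G" for f h using T(2) that by blast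
  show "T (\<lambda>x. a * f x) = (\<lambda>x. a * T f x)" if "f \<in> l2 G" for a f using T(3) that by blast
  show "T (left_translation G g f) = left_translation G g (T f)" if "g \<in> carrier G" "f \<in> l2 G" for g f
    using T(5) that by blast
  obtain C where C: "\<forall>f\<in>l2 G. l2_norm G (T f) \<le> C * l2_norm G f" using T(4) by blast
  have "l2_norm G (T f) \<le> \<bar>C\<bar> * l2_norm G f" if "f \<in> l2 G" for f
    using C that mult_right_mono[OF abs_ge_self[of C] l2_norm_nonneg[OF that]] by fastforce
  then show "\<exists>C\<ge>0. \<forall>f\<in>l2 G. l2_norm G (T f) \<le> C * l2_norm G f" by (intro exI[of _ "\<bar>C\<bar>"]) auto
qed

lemma vN_carrierI:
  assumes "\<And>f. f \<in> l2 G \<Longrightarrow> T f \<in> l2 G"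
    "\<And>f h. f \<in> l2 G \<Longrightarrow> h \<in> l2 G \<Longrightarrow> T (\<lambda>x. f x + h x) = (\<lambda>x. T f x + T h x)"
    "\<And>a f. f \<in> l2 G \<Longrightarrow> T (\<lambda>x. a * f x) = (\<lambda>x. a * T f x)"
    "\<And>f. f \<in> l2 G \<Longrightarrow> l2_norm G (T f) \<le> C * l2_norm G f"
    "\<And>g f. g \<in> carrier G \<Longrightarrow> f \<in> l2 G \<Longrightarrow> T (left_translation G g f) = left_translation G g (T f)"
  shows "(\<lambda>f\<in>l2 G. T f) \<in> carrier (vN_algebra G)"
proof -
  have "\<exists>C. \<forall>f\<in>l2 G. l2_norm G ((\<lambda>f\<in>l2 G. T f) f) \<le> C * l2_norm G f"
    using assms(4) by auto
  then show ?thesis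
    using assms(1-3,5) by (simp add: vN_algebra_def l2_add l2_cmult left_translation_l2)
qed

lemma vN_simps:
  "S \<otimes>\<^bsub>vN_algebra G\<^esub> T = (\<lambda>f\<in>l2 G. S (T f))" "\<one>\<^bsub>vN_algebra G\<^esub> = (\<lambda>f\<in>l2 G. f)"
  "\<zero>\<^bsub>vN_algebra G\<^esub> = (\<lambda>f\<in>l2 G. \<lambda>x. 0)" "S \<oplus>\<^bsub>vN_algebra G\<^esub> T = (\<lambda>f\<in>l2 G. \<lambda>x. S f x + T f x)"
  by (simp_all add: vN_algebra_def)

lemma vN_add_closed:
  assumes S: "S \<in> carrier (vN_algebra G)" and T: "T \<in> carrier (vN_algebra G)"
  shows "S \<oplus>\<^bsub>vN_algebra G\<^esub> T \<in> carrier (vN_algebra G)"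
proof -
  obtain C D where C: "\<forall>f\<in>l2 G. l2_norm G (S f) \<le> C * l2_norm G f"
    and D: "\<forall>f\<in>l2 G. l2_norm G (T f) \<le> D * l2_norm G f"
    using vN_carrierD(5)[OF S] vN_carrierD(5)[OF T] by blast
  show ?thesis
    unfolding vN_simps
  proof (rule vN_carrierI[where C = "C + D"])
    fix f assume f: "f \<in> l2 G"
    have "l2_norm G (\<lambda>x. S f x + T f x) \<le> l2_norm G (S f) + l2_norm G (T f)"
      by (intro l2_norm_triangle vN_carrierD(2)[OF S f] vN_carrierD(2)[OF T f])
    also have "\<dots> \<le> (C + D) * l2_norm G f" using C D f by (force simp: distrib_right)
    finally show "l2_norm G (\<lambda>x. S f x + T f x) \<le> (C + D) * l2_norm G f" .
  qed (simp_all add: l2_add vN_carrierD(2-4,6)[OF S] vN_carrierD(2-4,6)[OF T] left_translation_add algebra_simps)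
qed

lemma vN_mult_closed:
  assumes S: "S \<in> carrier (vN_algebra G)" and T: "T \<in> carrier (vN_algebra G)"
  shows "S \<otimes>\<^bsub>vN_algebra G\<^esub> T \<in> carrier (vN_algebra G)"
proof -
  obtain C D where C: "C \<ge> 0" "\<forall>f\<in>l2 G. l2_norm G (S f) \<le> C * l2_norm G f"
    and D: "\<forall>f\<in>l2 G. l2_norm G (T f) \<le> D * l2_norm G f"
    using vN_carrierD(5)[OF S] vN_carrierD(5)[OF T] by blast
  show ?thesis
    unfolding vN_simps
  proof (rule vN_carrierI[where C = "C * D"])
    fix f assume f: "f \<in> l2 G"
    have "l2_norm G (S (T f)) \<le> C * l2_norm G (T f)" using C(2) vN_carrierD(2)[OF T f] by blast
    also have "\<dots> \<le> C * (D * l2_norm G f)" using C(1) D f by (intro mult_left_mono) auto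
    finally show "l2_norm G (S (T f)) \<le> C * D * l2_norm G f" by (simp add: mult.assoc)
  qed (simp_all add: vN_carrierD(2-4,6)[OF S] vN_carrierD(2-4,6)[OF T])
qed

lemma vN_neg_closed:
  assumes T: "T \<in> carrier (vN_algebra G)"
  shows "(\<lambda>f\<in>l2 G. \<lambda>x. - T f x) \<in> carrier (vN_algebra G)"
proof -
  obtain D where D: "\<forall>f\<in>l2 G. l2_norm G (T f) \<le> D * l2_norm G f"
    using vN_carrierD(5)[OF T] by blast
  have um: "(\<lambda>x. - T f x) \<in> l2 G" if "f \<in> l2 G" for f
    using l2_cmult[OF vN_carrierD(2)[OF T that], of "-1"] by simp
  show ?thesis
  proof (rule vN_carrierI[where C = D])
    show "(\<lambda>x. - T (left_translation G g f) x) = left_translation G g (\<lambda>x. - T f x)"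
      if "g \<in> carrier G" "f \<in> l2 G" for g f
      unfolding vN_carrierD(6)[OF T that] by (auto simp: left_translation_def)
  qed (use D in \<open>auto simp: um l2_norm_uminus vN_carrierD(3,4)[OF T]\<close>)
qed

lemma vN_ring: "ring (vN_algebra G)"
proof (rule ringI)
  have ext: "S = T" if "S \<in> carrier (vN_algebra G)" "T \<in> carrier (vN_algebra G)" "\<And>f. f \<in> l2 G \<Longrightarrow> S f = T f" for S T
    using extensionalityI[OF vN_carrierD(1) vN_carrierD(1)] that by blast
  have zero: "\<zero>\<^bsub>vN_algebra G\<^esub> \<in> carrier (vN_algebra G)"
    unfolding vN_simps
    by (rule vN_carrierI[where C = 0]) (auto simp: l2_zero l2_norm_def left_translation_def)
  have one: "\<one>\<^bsub>vN_algebra G\<^esub> \<in> carrier (vN_algebra G)"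
    unfolding vN_simps by (rule vN_carrierI[where C = 1]) auto
  show "abelian_group (vN_algebra G)"
  proof (rule abelian_groupI)
    fix T assume T: "T \<in> carrier (vN_algebra G)"
    show "\<zero>\<^bsub>vN_algebra G\<^esub> \<oplus>\<^bsub>vN_algebra G\<^esub> T = T"
      by (rule ext[OF vN_add_closed[OF zero T] T]) (simp add: vN_simps)
    show "\<exists>S\<in>carrier (vN_algebra G). S \<oplus>\<^bsub>vN_algebra G\<^esub> T = \<zero>\<^bsub>vN_algebra G\<^esub>"
      by (rule bexI[OF _ vN_neg_closed[OF T]]) (auto simp: vN_simps fun_eq_iff restrict_def)
  next
    fix R S T assume R: "R \<in> carrier (vN_algebra G)" and S: "S \<in> carrier (vN_algebra G)" and T: "T \<in> carrier (vN_algebra G)"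
    show "R \<oplus>\<^bsub>vN_algebra G\<^esub> S \<oplus>\<^bsub>vN_algebra G\<^esub> T = R \<oplus>\<^bsub>vN_algebra G\<^esub> (S \<oplus>\<^bsub>vN_algebra G\<^esub> T)"
      by (rule ext) (simp_all add: R S T vN_add_closed, simp add: vN_simps add.assoc)
  next
    fix S T
    show "S \<oplus>\<^bsub>vN_algebra G\<^esub> T = T \<oplus>\<^bsub>vN_algebra G\<^esub> S"
      by (simp add: vN_simps add.commute)
  qed (auto simp: zero vN_add_closed)
  show "monoid (vN_algebra G)"
  proof (rule monoidI)
    fix R S T assume R: "R \<in> carrier (vN_algebra G)" and S: "S \<in> carrier (vN_algebra G)" and T: "T \<in> carrier (vN_algebra G)"
    show "R \<otimes>\<^bsub>vN_algebra G\<^esub> S \<otimes>\<^bsub>vN_algebra G\<^esub> T = R \<otimes>\<^bsub>vN_algebra G\<^esub> (S \<otimes>\<^bsub>vN_algebra G\<^esub> T)"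
      by (rule ext) (simp_all add: R S T vN_mult_closed, simp add: vN_simps vN_carrierD(2)[OF T])
  next
    fix T assume T: "T \<in> carrier (vN_algebra G)"
    show "\<one>\<^bsub>vN_algebra G\<^esub> \<otimes>\<^bsub>vN_algebra G\<^esub> T = T"
      by (rule ext[OF vN_mult_closed[OF one T] T]) (simp add: vN_simps vN_carrierD(2)[OF T])
    show "T \<otimes>\<^bsub>vN_algebra G\<^esub> \<one>\<^bsub>vN_algebra G\<^esub> = T"
      by (rule ext[OF vN_mult_closed[OF T one] T]) (simp add: vN_simps)
  qed (simp_all add: one vN_mult_closed)
next
  have ext: "S = T" if "S \<in> carrier (vN_algebra G)" "T \<in> carrier (vN_algebra G)" "\<And>f. f \<in> l2 G \<Longrightarrow> S f = T f" for S T
    using extensionalityI[OF vN_carrierD(1) vN_carrierD(1)] that by blast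
  fix R S T assume R: "R \<in> carrier (vN_algebra G)" and S: "S \<in> carrier (vN_algebra G)" and T: "T \<in> carrier (vN_algebra G)"
  show "(R \<oplus>\<^bsub>vN_algebra G\<^esub> S) \<otimes>\<^bsub>vN_algebra G\<^esub> T = R \<otimes>\<^bsub>vN_algebra G\<^esub> T \<oplus>\<^bsub>vN_algebra G\<^esub> S \<otimes>\<^bsub>vN_algebra G\<^esub> T"
    by (rule ext) (simp_all add: R S T vN_mult_closed vN_add_closed, simp add: vN_simps vN_carrierD(2)[OF T])
  show "T \<otimes>\<^bsub>vN_algebra G\<^esub> (R \<oplus>\<^bsub>vN_algebra G\<^esub> S) = T \<otimes>\<^bsub>vN_algebra G\<^esub> R \<oplus>\<^bsub>vN_algebra G\<^esub> T \<otimes>\<^bsub>vN_algebra G\<^esub> S"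
    by (rule ext) (simp_all add: R S T vN_mult_closed vN_add_closed,
        simp add: vN_simps vN_carrierD(2)[OF R] vN_carrierD(2)[OF S] l2_add vN_carrierD(3)[OF T])
qed

lemma vN_minus_apply:
  assumes S: "S \<in> carrier (vN_algebra G)" and T: "T \<in> carrier (vN_algebra G)" and f: "f \<in> l2 G"
  shows "(S \<ominus>\<^bsub>vN_algebra G\<^esub> T) f = (\<lambda>x. S f x - T f x)"
proof -
  interpret vN: ring "vN_algebra G" by (rule vN_ring)
  have "\<ominus>\<^bsub>vN_algebra G\<^esub> T = (\<lambda>f\<in>l2 G. \<lambda>x. - T f x)"
    by (rule vN.minus_equality[OF _ T vN_neg_closed[OF T]]) (auto simp: vN_simps fun_eq_iff restrict_def)
  then show ?thesis using f by (simp add: vN.minus_eq vN_simps)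
qed

lemma vN_finsum_apply:
  assumes "finite J" "\<And>j. j \<in> J \<Longrightarrow> T j \<in> carrier (vN_algebra G)" "f \<in> l2 G"
  shows "(\<Oplus>\<^bsub>vN_algebra G\<^esub>j\<in>J. T j) f = (\<lambda>x. \<Sum>j\<in>J. T j f x)"
proof -
  interpret vN: ring "vN_algebra G" by (rule vN_ring)
  show ?thesis using assms(1,2)
  proof (induction J)
    case empty then show ?case using assms(3) by (simp add: vN_simps)
  next
    case (insert j J)
    have "(\<Oplus>\<^bsub>vN_algebra G\<^esub>j\<in>insert j J. T j) = T j \<oplus>\<^bsub>vN_algebra G\<^esub> (\<Oplus>\<^bsub>vN_algebra G\<^esub>j\<in>J. T j)"
      using insert by (intro vN.finsum_insert) auto
    then show ?case using insert assms(3) by (simp add: vN_simps)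
  qed
qed

lemma right_translation_closed:
  assumes g: "g \<in> carrier G" shows "right_translation G g \<in> carrier (vN_algebra G)"
  unfolding right_translation_def
proof (rule vN_carrierI[where C = 1])
  fix f assume f: "f \<in> l2 G"
  show "(\<lambda>x. if x \<in> carrier G then f (x \<otimes> g) else 0) \<in> l2 G"
    by (rule l2_reindex(1)[OF f bij_betw_right[OF g]])
  show "l2_norm G (\<lambda>x. if x \<in> carrier G then f (x \<otimes> g) else 0) \<le> 1 * l2_norm G f"
    by (simp add: l2_reindex(2)[OF f bij_betw_right[OF g]])
  show "(\<lambda>x. if x \<in> carrier G then left_translation G h f (x \<otimes> g) else 0)
      = left_translation G h (\<lambda>x. if x \<in> carrier G then f (x \<otimes> g) else 0)" if "h \<in> carrier G" for h
    using g that by (auto simp: left_translation_def m_assoc)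
qed auto

lemma group_in_vN: "group_in_ring G (vN_algebra G) (right_translation G)"
proof (intro group_in_ring.intro group_in_ring_axioms.intro)
  show "group G" by (rule group_axioms)
  show "ring (vN_algebra G)" by (rule vN_ring)
  show "right_translation G \<one> = \<one>\<^bsub>vN_algebra G\<^esub>"
    by (auto simp: right_translation_def vN_simps fun_eq_iff restrict_def l2_outside)
  show "right_translation G (g \<otimes> h) = right_translation G g \<otimes>\<^bsub>vN_algebra G\<^esub> right_translation G h"
    if g: "g \<in> carrier G" and h: "h \<in> carrier G" for g h
  proof
    fix f
    show "right_translation G (g \<otimes> h) f = (right_translation G g \<otimes>\<^bsub>vN_algebra G\<^esub> right_translation G h) f"
    proof (cases "f \<in> l2 G")
      case True
      then have "(\<lambda>x. if x \<in> carrier G then f (x \<otimes> h) else 0) \<in> l2 G"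
        by (rule l2_reindex(1)[OF _ bij_betw_right[OF h]])
      then show ?thesis using True g h by (auto simp: right_translation_def vN_simps m_assoc)
    qed (simp add: right_translation_def vN_simps)
  qed
qed (rule right_translation_closed)

end

section \<open>Harmonic cycles\<close>

text \<open>
  Applied at \<open>x\<close>, this row sums a cochain along the path that starts at \<open>x\<close> and follows the word,
  where the value at \<open>(x, i)\<close> belongs to the edge from \<open>x\<close> to \<open>x (s i)\<close>.
\<close>

fun path_row :: "('g, 'm) monoid_scheme \<Rightarrow> (nat \<Rightarrow> 'g) \<Rightarrow> nat list \<Rightarrow> 'g row" where
  "path_row G s [] = []"
| "path_row G s (i # w) = (i, 1, \<one>\<^bsub>G\<^esub>) # map (\<lambda>(k, c, g). (k, c, s i \<otimes>\<^bsub>G\<^esub> g)) (path_row G s w)"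

text \<open>
  At a vertex, the sum over the incoming edges minus the sum over the outgoing ones.
\<close>

definition divergence_row :: "('g, 'm) monoid_scheme \<Rightarrow> (nat \<Rightarrow> 'g) \<Rightarrow> nat \<Rightarrow> 'g row" where
  "divergence_row G s d = concat (map (\<lambda>i. [(i, 1, inv\<^bsub>G\<^esub> s i), (i, -1, \<one>\<^bsub>G\<^esub>)]) [0..<d])"

definition loops :: "('g, 'm) monoid_scheme \<Rightarrow> (nat \<Rightarrow> 'g) \<Rightarrow> nat \<Rightarrow> nat \<Rightarrow> nat list set" where
  "loops G s d m = {w. set w \<subseteq> {..<d} \<and> length w \<le> m \<and> word_prod G s w = \<one>\<^bsub>G\<^esub>}"

definition harmonic_rows :: "('g, 'm) monoid_scheme \<Rightarrow> (nat \<Rightarrow> 'g) \<Rightarrow> nat \<Rightarrow> nat \<Rightarrow> 'g row set" where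
  "harmonic_rows G s d m = insert (divergence_row G s d) (path_row G s ` loops G s d m)"

lemma finite_harmonic_rows: "finite (harmonic_rows G s d m)"
proof -
  have "loops G s d m \<subseteq> {w. set w \<subseteq> {..<d} \<and> length w \<le> m}" by (auto simp: loops_def)
  then have "finite (loops G s d m)" by (rule finite_subset) (rule finite_lists_length_le[OF finite_lessThan])
  then show ?thesis by (simp add: harmonic_rows_def)
qed

lemma harmonic_rows_mono: "harmonic_rows G s d m \<subseteq> harmonic_rows G s d (Suc m)"
  by (auto simp: harmonic_rows_def loops_def)

context right_action
begin

lemma row_apply_Nil: "row_apply act [] f x = 0"
  and row_apply_Cons: "row_apply act ((i, c, g) # L) f x = of_int c * f (act x g, i) + row_apply act L f x"
  by (simp_all add: row_apply_def)

lemma valid_path_row: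
  "(\<And>i. i < d \<Longrightarrow> s i \<in> carrier G) \<Longrightarrow> set w \<subseteq> {..<d} \<Longrightarrow> valid_row G d (path_row G s w)"
proof (induction w)
  case (Cons i w)
  then have i: "i < d" "s i \<in> carrier G" and v: "valid_row G d (path_row G s w)" by auto
  from v have "valid_row G d (map (\<lambda>(k, c, g). (k, c, s i \<otimes> g)) (path_row G s w))"
    using i by (auto simp: valid_row_def)
  then show ?case using i by simp
qed simp

lemma valid_divergence_row: "(\<And>i. i < d \<Longrightarrow> s i \<in> carrier G) \<Longrightarrow> valid_row G d (divergence_row G s d)"
  by (auto simp: valid_row_def divergence_row_def)

lemma valid_harmonic_rows:
  "(\<And>i. i < d \<Longrightarrow> s i \<in> carrier G) \<Longrightarrow> L \<in> harmonic_rows G s d m \<Longrightarrow> valid_row G d L"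
  by (auto simp: harmonic_rows_def loops_def valid_path_row valid_divergence_row)

lemma row_apply_path:
  assumes s: "\<And>i. i < d \<Longrightarrow> s i \<in> carrier G" and i: "i < d" and w: "set w \<subseteq> {..<d}" and x: "x \<in> X"
  shows "row_apply act (path_row G s (i # w)) f x = f (x, i) + row_apply act (path_row G s w) f (act x (s i))"
proof -
  have "row_apply act (map (\<lambda>(k, c, g). (k, c, s i \<otimes> g)) (path_row G s w)) f x
      = row_apply act (path_row G s w) f (act x (s i))"
    unfolding row_apply_def map_map
    by (rule sum_list_cong)
       (use valid_path_row[where d = d and s = s, OF s w] x s[OF i] in \<open>auto simp: valid_row_def act_mult\<close>)
  then show ?thesis by (simp add: row_apply_Cons act_one x)
qed

lemma row_apply_divergence:
  "x \<in> X \<Longrightarrow> row_apply act (divergence_row G s d) f x = (\<Sum>i<d. f (act x (inv (s i)), i) - f (x, i))"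
proof -
  assume x: "x \<in> X"
  have "row_apply act (concat (map (\<lambda>i. [(i, 1, inv s i), (i, -1, \<one>)]) xs)) f x
      = (\<Sum>i\<leftarrow>xs. f (act x (inv (s i)), i) - f (x, i))" for xs
    by (induction xs) (simp_all add: row_apply_Nil row_apply_Cons act_one x)
  then show ?thesis
    by (simp add: divergence_row_def sum_list_distinct_conv_sum_set atLeast0LessThan)
qed

end

context group
begin

text \<open>
  The limit \<open>P\<close> of the even powers of the heat steps, for growing exponents and then growing levels
  \<open>m\<close>, is turned into an idempotent matrix \<open>A\<close> over the von Neumann algebra. The trace of \<open>A\<close> is the sum of the squared
  norms of the \<open>P \<delta>(1, i)\<close>, and the row module of \<open>A\<close> embeds into homology, so the trace is a lower
  bound for the \<open>\<ell>\<^sup>2\<close> Betti number.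
\<close>

lemma harmonic_projection:
  assumes s: "\<And>i. i < d \<Longrightarrow> s i \<in> carrier G" "inj_on s {..<d}"
    and gen: "\<And>g. g \<in> carrier G \<Longrightarrow> \<exists>w. set w \<subseteq> {..<d} \<and> word_prod G s w = g"
    and e: "e > 0"
  shows "\<exists>m k. ereal (\<Sum>i<d. (norm ((heat_step G (carrier G) (\<lambda>x g. x \<otimes> g) (harmonic_rows G s d m) ^^ k)
      (unit_vec (\<one>, i))))\<^sup>2) \<le> l2_betti_number 1 G + ereal e"
proof -
  interpret self: right_action G "carrier G" "\<lambda>x g. x \<otimes> g" by (rule right_action_self)
  interpret vN: group_in_ring G "vN_algebra G" "right_translation G" by (rule group_in_vN)
  let ?R = "\<lambda>m. harmonic_rows G s d m"
  let ?T = "\<lambda>m. heat_step G (carrier G) (\<lambda>x g. x \<otimes> g) (?R m)"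
  let ?act = "\<lambda>x g. x \<otimes> g"
  note fin = finite_harmonic_rows[of G s d]
  have val: "valid_row G d L" if "L \<in> ?R m" for L m
    by (rule self.valid_harmonic_rows[OF s(1) that])
  have fixed: "?T m x = x \<longleftrightarrow> (\<forall>L\<in>?R m. row_op (carrier G) ?act L x = 0)" for m x
    by (rule self.heat_step_fixed_iff[OF fin val])
  have stop: "?T m x = x" if "norm (?T m x) = norm x" for m x
    unfolding fixed using self.norm_heat_step_eq_imp[OF fin, OF val[of _ m], OF _ that] by blast
  have lin: "linear (?T m)" for m by (rule self.linear_heat_step[OF fin val])
  have symm: "?T m x \<bullet> y = x \<bullet> ?T m y" for m x y by (rule self.heat_step_symmetric[OF fin val])
  have contr: "norm (?T m x) \<le> norm x" for m x by (rule self.heat_step_contraction[OF fin val])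
  have nest: "?T m x = x" if "?T (Suc m) x = x" for m x
    using that harmonic_rows_mono[of G s d m] unfolding fixed by blast
  show ?thesis
  proof (rule nested_contractions_projection[of ?T, OF lin symm contr])
    show "?T m x = x" if "norm (?T m x) = norm x" for m x using that by (rule stop)
    show "?T m x = x" if "?T (Suc m) x = x" for m x using that by (rule nest)
  next
  fix P
  assume P: "linear P" "\<And>x y. P x \<bullet> y = x \<bullet> P y" "\<And>x. norm (P x) \<le> norm x"
    "\<And>m x. ?T m (P x) = P x" "\<And>x. P (P x) = P x"
    "\<And>R x. bounded_linear R \<Longrightarrow> (\<And>m x. R (?T m x) = ?T m (R x)) \<Longrightarrow> R (P x) = P (R x)"
    "\<And>A e. finite A \<Longrightarrow> e > 0 \<Longrightarrow>
        \<exists>m k. (\<Sum>a\<in>A. (norm ((?T m ^^ k) a))\<^sup>2) \<le> (\<Sum>a\<in>A. (norm (P a))\<^sup>2) + e"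
  have killed: "row_op (carrier G) ?act L (P F) = 0" if "L \<in> ?R m" for L m F
    using P(4)[of m F] that unfolding fixed by blast
  have tw: "twist (carrier G) d a \<sigma> (P F) = P (twist (carrier G) d a \<sigma> F)"
    if \<sigma>: "inj_on \<sigma> (carrier G)" "\<And>x. x \<in> carrier G \<Longrightarrow> \<sigma> x \<in> carrier G"
      "\<And>x g. x \<in> carrier G \<Longrightarrow> g \<in> carrier G \<Longrightarrow> \<sigma> (x \<otimes> g) = \<sigma> x \<otimes> g" for a \<sigma> F
    by (rule P(6)[OF self.bounded_linear_twist[OF \<sigma>(1)]], rule self.twist_heat_step[OF fin val \<sigma>])
  (* V i restricts to component i and W j is the inclusion of component j,
     so that the A i j below are the matrix entries of P. *)
  define V where "V i = shift (carrier G) ?act i \<one>" for i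
  define W where "W j f = shift_adj G (carrier G) ?act j \<one> (Ell2 f)" for j f
  have cV: "coord (V i F) x = (if x \<in> carrier G then coord F (x, i) else 0)" for i F x
    by (simp add: V_def self.coord_shift)
  have cW: "coord (W j f) (x, k) = (if k = j then f x else 0)" if "f \<in> l2 G" for j f x k
    using that by (simp add: W_def self.coord_shift_adj coord_l2 l2_outside)
  have Vl2: "coord (V i F) \<in> l2 G" for i F by (rule coord_in_l2) (simp add: cV)
  have Wadd: "W j (\<lambda>x. f x + h x) = W j f + W j h" if "f \<in> l2 G" "h \<in> l2 G" for j f h
    using that by (simp add: W_def Ell2_add self.shift_adj_add)
  have Wtw: "W j (\<lambda>x. if x \<in> carrier G then a * f (\<sigma> x) else 0) = twist (carrier G) d a \<sigma> (W j f)"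
    if "f \<in> l2 G" "(\<lambda>x. if x \<in> carrier G then a * f (\<sigma> x) else 0) \<in> l2 G" "inj_on \<sigma> (carrier G)" "j < d" for j f a \<sigma>
  proof (rule ell2_eqI)
    fix p :: "'a \<times> nat"
    show "coord (W j (\<lambda>x. if x \<in> carrier G then a * f (\<sigma> x) else 0)) p = coord (twist (carrier G) d a \<sigma> (W j f)) p"
      by (cases p) (use that in \<open>auto simp: cW self.coord_twist\<close>)
  qed
  have PW: "coord (V i (P (W j (\<lambda>x. if x \<in> carrier G then a * f (\<sigma> x) else 0)))) =
      (\<lambda>x. if x \<in> carrier G then a * coord (V i (P (W j f))) (\<sigma> x) else 0)"
    if f: "f \<in> l2 G" "(\<lambda>x. if x \<in> carrier G then a * f (\<sigma> x) else 0) \<in> l2 G" and ij: "i < d" "j < d"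
    and \<sigma>: "inj_on \<sigma> (carrier G)" "\<And>x. x \<in> carrier G \<Longrightarrow> \<sigma> x \<in> carrier G"
      "\<And>x g. x \<in> carrier G \<Longrightarrow> g \<in> carrier G \<Longrightarrow> \<sigma> (x \<otimes> g) = \<sigma> x \<otimes> g" for i j a f \<sigma>
  proof -
    have "P (W j (\<lambda>x. if x \<in> carrier G then a * f (\<sigma> x) else 0)) = twist (carrier G) d a \<sigma> (P (W j f))"
      unfolding Wtw[OF f \<sigma>(1) ij(2)] by (rule tw[OF \<sigma>, symmetric])
    then show ?thesis using ij(1) \<sigma>(2) by (auto simp: fun_eq_iff cV self.coord_twist[OF \<sigma>(1)])
  qed
  define A where "A i j = (\<lambda>f\<in>l2 G. coord (V i (P (W j f))))" for i j
  have Aapp: "A i j f = coord (V i (P (W j f)))" if "f \<in> l2 G" for i j f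
    using that by (simp add: A_def)
  have Ac: "A i j \<in> carrier (vN_algebra G)" if ij: "i < d" "j < d" for i j
    unfolding A_def
  proof (rule vN_carrierI[where C = 1])
    fix f assume f: "f \<in> l2 G"
    show "coord (V i (P (W j f))) \<in> l2 G" by (rule Vl2)
    show "coord (V i (P (W j (\<lambda>x. f x + h x)))) = (\<lambda>x. coord (V i (P (W j f))) x + coord (V i (P (W j h))) x)"
      if h: "h \<in> l2 G" for h
      by (simp add: Wadd[OF f h] linear_add[OF P(1)] V_def self.shift_add coord_add)
    show "coord (V i (P (W j (\<lambda>x. a * f x)))) = (\<lambda>x. a * coord (V i (P (W j f))) x)" for a
    proof -
      have eq: "(\<lambda>x. a * f x) = (\<lambda>x. if x \<in> carrier G then a * f (id x) else 0)"
        using l2_outside[OF f] by auto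
      have "coord (V i (P (W j (\<lambda>x. if x \<in> carrier G then a * f (id x) else 0)))) =
          (\<lambda>x. if x \<in> carrier G then a * coord (V i (P (W j f))) (id x) else 0)"
        by (rule PW[OF f _ ij]) (use l2_cmult[OF f, of a] eq in simp_all)
      also have "\<dots> = (\<lambda>x. a * coord (V i (P (W j f))) x)" by (auto simp: cV)
      finally show ?thesis unfolding eq .
    qed
    show "l2_norm G (coord (V i (P (W j f)))) \<le> 1 * l2_norm G f"
    proof -
      have "l2_norm G (coord (V i (P (W j f)))) = norm (V i (P (W j f)))" by (rule l2_norm_coord[OF Vl2])
      also have "\<dots> \<le> norm (P (W j f))" unfolding V_def by (rule self.norm_shift) simp
      also have "\<dots> \<le> norm (W j f)" by (rule P(3))
      also have "\<dots> \<le> norm (Ell2 f)" unfolding W_def by (rule self.norm_shift_adj) simp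
      finally show ?thesis by (simp add: l2_norm_eq[OF f])
    qed
    show "coord (V i (P (W j (left_translation G g f)))) = left_translation G g (coord (V i (P (W j f))))"
      if g: "g \<in> carrier G" for g
    proof -
      have eq: "left_translation G g h = (\<lambda>x. if x \<in> carrier G then 1 * h ((\<lambda>x. inv g \<otimes> x) x) else 0)" for h
        by (auto simp: left_translation_def)
      show ?thesis
        unfolding eq
        by (rule PW[OF f _ ij])
           (use left_translation_l2[OF g f] bij_betw_left[OF g] g in
             \<open>auto simp: eq[symmetric] bij_betw_def m_assoc\<close>)
    qed
  qed
  (* The components beyond d are discarded by the twist; on the image of W k nothing is lost. *)
  have split_sum: "(\<Sum>j<d. W j (coord (V j F))) = twist (carrier G) d 1 id F" for F
  proof (rule ell2_eqI)
    fix p :: "'a \<times> nat"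
    obtain x k where p: "p = (x, k)" by (cases p)
    have "coord (\<Sum>j<d. W j (coord (V j F))) p = (\<Sum>j<d. if k = j then coord (V j F) x else 0)"
      by (simp add: coord_sum p cW[OF Vl2])
    also have "\<dots> = coord (twist (carrier G) d 1 id F) p"
      by (simp add: p self.coord_twist cV sum.delta)
    finally show "coord (\<Sum>j<d. W j (coord (V j F))) p = coord (twist (carrier G) d 1 id F) p" .
  qed
  have idem: "idempotent_matrix (vN_algebra G) d A"
    unfolding idempotent_matrix_def
  proof (intro conjI allI impI)
    fix i k assume ik: "i < d" "k < d"
    have cl: "A i j \<otimes>\<^bsub>vN_algebra G\<^esub> A j k \<in> carrier (vN_algebra G)" if "j \<in> {..<d}" for j
      using that ik Ac by auto
    have sumc: "(\<Oplus>\<^bsub>vN_algebra G\<^esub>j\<in>{..<d}. A i j \<otimes>\<^bsub>vN_algebra G\<^esub> A j k) \<in> carrier (vN_algebra G)"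
      using cl by (intro vN.finsum_closed) auto
    show "(\<Oplus>\<^bsub>vN_algebra G\<^esub>j\<in>{..<d}. A i j \<otimes>\<^bsub>vN_algebra G\<^esub> A j k) = A i k"
    proof (rule extensionalityI[OF vN_carrierD(1)[OF sumc] vN_carrierD(1)[OF Ac[OF ik]]])
      fix f assume f: "f \<in> l2 G"
      have twid: "twist (carrier G) d 1 id (P F) = P (twist (carrier G) d 1 id F)" for F
        by (rule tw) auto
      have Pl: "P (twist (carrier G) d 1 id (P (W k f))) = P (W k f)"
      proof -
        have "P (twist (carrier G) d 1 id (P (W k f))) = P (P (twist (carrier G) d 1 id (W k f)))"
          by (subst twid) (rule refl)
        also have "twist (carrier G) d 1 id (W k f) = W k f"
        proof (rule ell2_eqI)
          fix p :: "'a \<times> nat"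
          show "coord (twist (carrier G) d 1 id (W k f)) p = coord (W k f) p"
            by (cases p) (use ik f in \<open>auto simp: self.coord_twist cW l2_outside\<close>)
        qed
        finally show ?thesis unfolding P(5) .
      qed
      have "(\<Oplus>\<^bsub>vN_algebra G\<^esub>j\<in>{..<d}. A i j \<otimes>\<^bsub>vN_algebra G\<^esub> A j k) f
          = (\<lambda>x. \<Sum>j<d. (A i j \<otimes>\<^bsub>vN_algebra G\<^esub> A j k) f x)"
        by (rule vN_finsum_apply[OF finite_lessThan cl f])
      also have "\<dots> = (\<lambda>x. \<Sum>j<d. coord (V i (P (W j (coord (V j (P (W k f))))))) x)"
        using f by (simp add: vN_simps Aapp Vl2)
      also have "\<dots> = coord (V i (P (\<Sum>j<d. W j (coord (V j (P (W k f)))))))"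
        by (rule ext) (simp add: cV linear_sum[OF P(1)] coord_sum)
      also have "\<dots> = A i k f" unfolding split_sum Pl by (simp add: Aapp f)
      finally show "(\<Oplus>\<^bsub>vN_algebra G\<^esub>j\<in>{..<d}. A i j \<otimes>\<^bsub>vN_algebra G\<^esub> A j k) f = A i k f" .
    qed
  qed (rule Ac)
  have ccl: "A k i \<otimes>\<^bsub>vN_algebra G\<^esub> (right_translation G (s i) \<ominus>\<^bsub>vN_algebra G\<^esub> \<one>\<^bsub>vN_algebra G\<^esub>) \<in> carrier (vN_algebra G)"
    if "k < d" "i < d" for k i using that Ac s(1) by auto
  (* The rho (s i) - 1 are the components of the adjoint of the divergence, and P annihilates the
     image of this adjoint because the divergence annihilates the image of P. *)
  have cyc: "(\<Oplus>\<^bsub>vN_algebra G\<^esub>i\<in>{..<d}. A k i \<otimes>\<^bsub>vN_algebra G\<^esub> (right_translation G (s i) \<ominus>\<^bsub>vN_algebra G\<^esub> \<one>\<^bsub>vN_algebra G\<^esub>))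
      = \<zero>\<^bsub>vN_algebra G\<^esub>" if k: "k < d" for k
  proof (rule extensionalityI[OF vN_carrierD(1) vN_carrierD(1)])
    show "(\<Oplus>\<^bsub>vN_algebra G\<^esub>i\<in>{..<d}. A k i \<otimes>\<^bsub>vN_algebra G\<^esub> (right_translation G (s i) \<ominus>\<^bsub>vN_algebra G\<^esub> \<one>\<^bsub>vN_algebra G\<^esub>)) \<in> carrier (vN_algebra G)"
      using ccl[OF k] by (intro vN.finsum_closed) auto
    fix f assume f: "f \<in> l2 G"
    let ?L = "divergence_row G s d"
    have vL: "valid_row G d ?L" by (rule self.valid_divergence_row[OF s(1)])
    have grad: "(right_translation G (s i) \<ominus>\<^bsub>vN_algebra G\<^esub> \<one>\<^bsub>vN_algebra G\<^esub>) f \<in> l2 G" if "i < d" for i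
      using vN_carrierD(2)[OF _ f] s(1)[OF that] vN.minus_closed vN.rho_closed vN.one_closed by blast
    have gradc: "(right_translation G (s i) \<ominus>\<^bsub>vN_algebra G\<^esub> \<one>\<^bsub>vN_algebra G\<^esub>) f x = (if x \<in> carrier G then f (x \<otimes> s i) - f x else 0)"
      if "i < d" for i x
      using vN_minus_apply[OF vN.rho_closed[OF s(1)[OF that]] vN.one_closed f] f
      by (simp add: right_translation_def vN_simps l2_outside)
    have "(\<Sum>i<d. W i ((right_translation G (s i) \<ominus>\<^bsub>vN_algebra G\<^esub> \<one>\<^bsub>vN_algebra G\<^esub>) f)) = row_adj G (carrier G) ?act ?L (Ell2 f)"
    proof (rule ell2_eqI)
      fix p :: "'a \<times> nat"
      obtain x j where p: "p = (x, j)" by (cases p)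
      have lhs: "coord (\<Sum>i<d. W i ((right_translation G (s i) \<ominus>\<^bsub>vN_algebra G\<^esub> \<one>\<^bsub>vN_algebra G\<^esub>) f)) p
          = (\<Sum>i<d. if j = i then (if x \<in> carrier G then f (x \<otimes> s i) - f x else 0) else 0)"
        unfolding coord_sum p by (rule sum.cong) (auto simp: cW grad gradc)
      have "(\<Sum>(i, c, g)\<leftarrow>concat (map (\<lambda>i. [(i, 1, inv s i), (i, -1, \<one>)]) xs). if i = j then of_int c * f (x \<otimes> inv g) else 0)
          = (\<Sum>i\<leftarrow>xs. if i = j then f (x \<otimes> inv (inv (s i))) - f (x \<otimes> inv \<one>) else 0)" for xs
        by (induction xs) simp_all
      then have "coord (row_adj G (carrier G) ?act ?L (Ell2 f)) p
          = (if x \<in> carrier G then \<Sum>i<d. if i = j then f (x \<otimes> inv (inv (s i))) - f (x \<otimes> inv \<one>) else 0 else 0)"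
        unfolding p self.coord_row_adj[OF vL] coord_l2[OF f]
        by (simp add: divergence_row_def sum_list_distinct_conv_sum_set atLeast0LessThan)
      also have "\<dots> = (\<Sum>i<d. if j = i then (if x \<in> carrier G then f (x \<otimes> s i) - f x else 0) else 0)"
        using s(1) by (auto intro!: sum.cong)
      finally show "coord (\<Sum>i<d. W i ((right_translation G (s i) \<ominus>\<^bsub>vN_algebra G\<^esub> \<one>\<^bsub>vN_algebra G\<^esub>) f)) p
          = coord (row_adj G (carrier G) ?act ?L (Ell2 f)) p" using lhs by simp
    qed
    moreover have "P (row_adj G (carrier G) ?act ?L h) = 0" for h
    proof -
      have "P (row_adj G (carrier G) ?act ?L h) \<bullet> y = 0" for y
      proof -
        have "P (row_adj G (carrier G) ?act ?L h) \<bullet> y = row_adj G (carrier G) ?act ?L h \<bullet> P y" by (rule P(2))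
        also have "\<dots> = P y \<bullet> row_adj G (carrier G) ?act ?L h" by (rule inner_commute)
        also have "\<dots> = row_op (carrier G) ?act ?L (P y) \<bullet> h" by (rule self.inner_row_op[OF vL, symmetric])
        finally have "P (row_adj G (carrier G) ?act ?L h) \<bullet> y = row_op (carrier G) ?act ?L (P y) \<bullet> h" .
        then show ?thesis using killed[of ?L 0 y] by (simp add: harmonic_rows_def)
      qed
      then show ?thesis using inner_eq_zero_iff by blast
    qed
    ultimately have z: "P (\<Sum>i<d. W i ((right_translation G (s i) \<ominus>\<^bsub>vN_algebra G\<^esub> \<one>\<^bsub>vN_algebra G\<^esub>) f)) = 0" by simp
    have "(\<Oplus>\<^bsub>vN_algebra G\<^esub>i\<in>{..<d}. A k i \<otimes>\<^bsub>vN_algebra G\<^esub> (right_translation G (s i) \<ominus>\<^bsub>vN_algebra G\<^esub> \<one>\<^bsub>vN_algebra G\<^esub>)) f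
        = (\<lambda>x. \<Sum>i<d. (A k i \<otimes>\<^bsub>vN_algebra G\<^esub> (right_translation G (s i) \<ominus>\<^bsub>vN_algebra G\<^esub> \<one>\<^bsub>vN_algebra G\<^esub>)) f x)"
      by (rule vN_finsum_apply[OF finite_lessThan _ f]) (use ccl[OF k] in auto)
    also have "\<dots> = (\<lambda>x. \<Sum>i<d. coord (V k (P (W i ((right_translation G (s i) \<ominus>\<^bsub>vN_algebra G\<^esub> \<one>\<^bsub>vN_algebra G\<^esub>) f)))) x)"
      using f grad by (simp add: vN_simps(1) Aapp)
    also have "\<dots> = coord (V k (P (\<Sum>i<d. W i ((right_translation G (s i) \<ominus>\<^bsub>vN_algebra G\<^esub> \<one>\<^bsub>vN_algebra G\<^esub>) f))))"
      by (rule ext) (simp add: cV linear_sum[OF P(1)] coord_sum)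
    also have "\<dots> = \<zero>\<^bsub>vN_algebra G\<^esub> f" unfolding z using f by (auto simp: cV vN_simps)
    finally show "(\<Oplus>\<^bsub>vN_algebra G\<^esub>i\<in>{..<d}. A k i \<otimes>\<^bsub>vN_algebra G\<^esub> (right_translation G (s i) \<ominus>\<^bsub>vN_algebra G\<^esub> \<one>\<^bsub>vN_algebra G\<^esub>)) f = \<zero>\<^bsub>vN_algebra G\<^esub> f" .
  qed simp
  have foxc: "vN.fox s A j w \<in> carrier (vN_algebra G)" if "set w \<subseteq> {..<d}" "j < d" for w j
    using that by (induction w) (auto simp: Ac s)
  (* On the columns of P, Fox derivatives are sums along paths. *)
  have fox: "vN.fox s A j w f x = (if x \<in> carrier G then row_apply ?act (path_row G s w) (coord (P (W j f))) x else 0)"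
    if "set w \<subseteq> {..<d}" "j < d" "f \<in> l2 G" for w j f x
    using that(1)
  proof (induction w arbitrary: x)
    case Nil
    then show ?case using that by (simp add: vN_simps self.row_apply_Nil)
  next
    case (Cons i w)
    then have iw: "i < d" "set w \<subseteq> {..<d}" by auto
    have rp: "row_apply ?act (path_row G s (i # w)) F x = F (x, i) + row_apply ?act (path_row G s w) F (x \<otimes> s i)"
      if "x \<in> carrier G" for F :: "'a \<times> nat \<Rightarrow> complex"
      by (rule self.row_apply_path[where s = s and d = d, OF s(1) iw that])
    have "vN.fox s A j (i # w) f x = A i j f x + right_translation G (s i) (vN.fox s A j w f) x"
      using that(3) by (simp add: vN_simps)
    also have "\<dots> = (if x \<in> carrier G then coord (P (W j f)) (x, i) + vN.fox s A j w f (x \<otimes> s i) else 0)"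
      using that(3) vN_carrierD(2)[OF foxc[OF iw(2) that(2)] that(3)]
      by (simp add: Aapp cV right_translation_def)
    also have "\<dots> = (if x \<in> carrier G then row_apply ?act (path_row G s (i # w)) (coord (P (W j f))) x else 0)"
      using Cons.IH[OF iw(2)] s(1)[OF iw(1)] by (cases "x \<in> carrier G") (simp_all add: rp del: path_row.simps)
    finally show ?case .
  qed
  have loop: "vN.fox s A j w = \<zero>\<^bsub>vN_algebra G\<^esub>"
    if w: "set w \<subseteq> {..<d}" and j: "j < d" and l: "word_prod G s w = \<one>" for w j
  proof (rule extensionalityI[OF vN_carrierD(1)[OF foxc[OF w j]] vN_carrierD(1)[OF vN.zero_closed]])
    fix f assume f: "f \<in> l2 G"
    have "path_row G s w \<in> ?R (length w)" using w l by (auto simp: harmonic_rows_def loops_def)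
    from killed[OF this, of "W j f"] have z: "coord (row_op (carrier G) ?act (path_row G s w) (P (W j f))) x = 0" for x
      by simp
    have "coord (row_op (carrier G) ?act (path_row G s w) (P (W j f))) x =
        (if x \<in> carrier G then row_apply ?act (path_row G s w) (coord (P (W j f))) x else 0)" for x
      by (rule self.coord_row_op[OF self.valid_path_row[where s = s and d = d, OF s(1) w]])
    then have "vN.fox s A j w f x = 0" for x using z[of x] by (simp add: fox[OF w j f])
    then show "vN.fox s A j w f = \<zero>\<^bsub>vN_algebra G\<^esub> f" using f by (auto simp: vN_simps)
  qed
  have emb: "\<exists>\<phi> \<in> module_hom (vN_algebra G) (row_module (vN_algebra G) d A)
       (group_homology G (vN_algebra G) (right_translation G) 1). inj_on \<phi> (carrier (row_module (vN_algebra G) d A))"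
    by (rule vN.harmonic_idempotent_embeds[OF s gen idem cyc loop])
  have Wd: "W i (\<lambda>x. if x = \<one> then 1 else 0) = unit_vec (\<one>, i)" for i
  proof (rule ell2_eqI)
    have "coord (unit_vec \<one>) \<in> l2 G" by (rule coord_in_l2) (auto simp: coord_unit_vec)
    then have dl: "(\<lambda>x. if x = \<one> then 1 else 0) \<in> l2 G" by (simp add: coord_unit_vec)
    fix p :: "'a \<times> nat"
    show "coord (W i (\<lambda>x. if x = \<one> then 1 else 0)) p = coord (unit_vec (\<one>, i)) p"
      by (cases p) (auto simp: cW[OF dl] coord_unit_vec)
  qed
  (* As P is a symmetric idempotent, its diagonal entries are squared norms. *)
  have tr: "Re (vN_trace G (A i i)) = (norm (P (unit_vec (\<one>, i))))\<^sup>2" for i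
  proof -
    have "coord (unit_vec \<one>) \<in> l2 G" by (rule coord_in_l2) (auto simp: coord_unit_vec)
    then have "(\<lambda>x. if x = \<one> then 1 else 0) \<in> l2 G" by (simp add: coord_unit_vec)
    then have "vN_trace G (A i i) = coord (P (unit_vec (\<one>, i))) (\<one>, i)"
      by (simp add: vN_trace_def Aapp Wd cV)
    then have "Re (vN_trace G (A i i)) = unit_vec (\<one>, i) \<bullet> P (unit_vec (\<one>, i))" by (simp add: inner_unit_vec)
    also have "\<dots> = P (unit_vec (\<one>, i)) \<bullet> P (unit_vec (\<one>, i))"
      by (simp add: P(2) P(5))
    finally show ?thesis by (simp add: power2_norm_eq_inner)
  qed
  have "ereal (\<Sum>i<d. Re (vN_trace G (A i i))) \<le> l2_betti_number 1 G"
    unfolding l2_betti_number_def vN_dim_def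
    by (rule Sup_upper) (use idem emb in blast)
  then have lower: "ereal (\<Sum>i<d. (norm (P (unit_vec (\<one>, i))))\<^sup>2) \<le> l2_betti_number 1 G" by (simp add: tr)
  have inj: "inj_on (\<lambda>i. unit_vec (\<one>, i)) {..<d}"
  proof (rule inj_onI)
    fix i j assume "unit_vec (\<one>, i) = unit_vec (\<one>, j)"
    then have "coord (unit_vec (\<one>, i)) (\<one>, i) = coord (unit_vec (\<one>, j)) (\<one>, i)" by simp
    then show "i = j" by (simp add: coord_unit_vec split: if_splits)
  qed
  have "finite ((\<lambda>i. unit_vec (\<one>, i)) ` {..<d})" by simp
  from P(7)[OF this e] obtain m k where
    "(\<Sum>a\<in>(\<lambda>i. unit_vec (\<one>, i)) ` {..<d}. (norm ((?T m ^^ k) a))\<^sup>2)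
      \<le> (\<Sum>a\<in>(\<lambda>i. unit_vec (\<one>, i)) ` {..<d}. (norm (P a))\<^sup>2) + e" by blast
  then have "(\<Sum>i<d. (norm ((?T m ^^ k) (unit_vec (\<one>, i))))\<^sup>2) \<le> (\<Sum>i<d. (norm (P (unit_vec (\<one>, i))))\<^sup>2) + e"
    by (simp add: sum.reindex[OF inj])
  then have "ereal (\<Sum>i<d. (norm ((?T m ^^ k) (unit_vec (\<one>, i))))\<^sup>2) \<le> ereal (\<Sum>i<d. (norm (P (unit_vec (\<one>, i))))\<^sup>2) + ereal e"
    by simp
  also have "\<dots> \<le> l2_betti_number 1 G + ereal e" using lower by (rule add_right_mono)
  finally show "\<exists>m k. ereal (\<Sum>i<d. (norm ((?T m ^^ k) (unit_vec (\<one>, i))))\<^sup>2) \<le> l2_betti_number 1 G + ereal e"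
    by blast
  qed
qed

end

section \<open>Counting solutions modulo a prime\<close>

lemma closed_under_sum:
  assumes comb: "\<And>a z w. z \<in> K \<Longrightarrow> w \<in> K \<Longrightarrow> (\<lambda>e. z e + a * w e) \<in> K"
    and "finite J" "w \<in> K" "\<And>j. j \<in> J \<Longrightarrow> v j \<in> K"
  shows "(\<lambda>e. w e + (\<Sum>j\<in>J. a j * v j e) :: real) \<in> K"
  using assms(2,4)
proof (induction J)
  case empty then show ?case using assms(3) by simp
next
  case (insert j J)
  then have "(\<lambda>e. (w e + (\<Sum>j\<in>J. a j * v j e)) + a j * v j e) \<in> K" by (intro comb) auto
  then show ?case using insert by (simp add: algebra_simps)
qed

text \<open>
  Gaussian elimination and orthonormalization at the same time: a subspace of \<open>\<real>\<^sup>E\<close> is determined by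
  as many coordinates as it has orthonormal vectors. In the induction on \<open>E\<close>, the subspace of the
  vectors vanishing at \<open>e0\<close> is treated first; if there is a further vector, its component orthogonal
  to that subspace is added, together with the coordinate \<open>e0\<close>.
\<close>

lemma orthonormal_coordinates:
  fixes K :: "('e \<Rightarrow> real) set"
  assumes "finite E" "\<And>z e. z \<in> K \<Longrightarrow> e \<notin> E \<Longrightarrow> z e = 0"
    "\<And>a z w. z \<in> K \<Longrightarrow> w \<in> K \<Longrightarrow> (\<lambda>e. z e + a * w e) \<in> K"
  shows "\<exists>J v. J \<subseteq> E \<and> (\<forall>j\<in>J. v j \<in> K) \<and>
    (\<forall>i\<in>J. \<forall>j\<in>J. (\<Sum>e\<in>E. v i e * v j e) = (if i = j then 1 else 0)) \<and>
    (\<forall>z\<in>K. (\<forall>j\<in>J. z j = 0) \<longrightarrow> z = (\<lambda>e. 0))"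
  using assms
proof (induction E arbitrary: K)
  case empty
  then show ?case by (intro exI[of _ "{}"]) auto
next
  case (insert e0 E)
  define K' where "K' = {z \<in> K. z e0 = 0}"
  have "\<exists>J v. J \<subseteq> E \<and> (\<forall>j\<in>J. v j \<in> K') \<and>
    (\<forall>i\<in>J. \<forall>j\<in>J. (\<Sum>e\<in>E. v i e * v j e) = (if i = j then 1 else 0)) \<and>
    (\<forall>z\<in>K'. (\<forall>j\<in>J. z j = 0) \<longrightarrow> z = (\<lambda>e. 0))"
  proof (rule insert.IH)
    fix z e assume "z \<in> K'" "e \<notin> E" then show "z e = 0"
      using insert.prems(1)[of z e] by (cases "e = e0") (auto simp: K'_def)
  qed (auto simp: K'_def insert.prems(2))
  then obtain J v where *: "J \<subseteq> E \<and> (\<forall>j\<in>J. v j \<in> K') \<and>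
    (\<forall>i\<in>J. \<forall>j\<in>J. (\<Sum>e\<in>E. v i e * v j e) = (if i = j then 1 else 0)) \<and>
    (\<forall>z\<in>K'. (\<forall>j\<in>J. z j = 0) \<longrightarrow> z = (\<lambda>e. 0))"
    by (elim exE)
  have J: "J \<subseteq> E" using * by (elim conjE)
  have vK': "v j \<in> K'" if "j \<in> J" for j using * that by (elim conjE) (rule bspec)
  have orth: "(\<Sum>e\<in>E. v i e * v j e) = (if i = j then 1 else 0)" if "i \<in> J" "j \<in> J" for i j
    using * that by (elim conjE) (drule bspec, assumption, erule bspec)
  have inj: "z = (\<lambda>e. 0)" if "z \<in> K'" "\<And>j. j \<in> J \<Longrightarrow> z j = 0" for z
    using * that(1) that(2) by metis
  have finJ: "finite J" using J insert.hyps(1) by (rule finite_subset)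
  have v0: "v j e0 = 0" "v j \<in> K" if "j \<in> J" for j using vK'[OF that] by (auto simp: K'_def)
  have orth': "(\<Sum>e\<in>insert e0 E. v i e * v j e) = (if i = j then 1 else 0)" if "i \<in> J" "j \<in> J" for i j
    using orth[OF that] v0(1)[OF that(1)] insert.hyps by simp
  show ?case
  proof (cases "\<forall>z\<in>K. z e0 = 0")
    case True
    then have "K' = K" by (auto simp: K'_def)
    show ?thesis
    proof (intro exI[of _ J] exI[of _ v] conjI ballI impI)
      show "J \<subseteq> insert e0 E" using J by blast
      fix z assume "z \<in> K" "\<forall>j\<in>J. z j = 0"
      then show "z = (\<lambda>e. 0)" using \<open>K' = K\<close> by (intro inj) auto
    qed (use v0(2) orth' in auto)
  next
    case False
    then obtain w where w: "w \<in> K" "w e0 \<noteq> 0" by blast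
    define c where "c j = (\<Sum>e\<in>insert e0 E. w e * v j e)" for j
    define u where "u e = w e + (\<Sum>j\<in>J. (- c j) * v j e)" for e
    have uK: "u \<in> K"
      unfolding u_def[abs_def] by (rule closed_under_sum[OF insert.prems(2) finJ w(1) v0(2)])
    have u0: "u e0 \<noteq> 0" using w(2) by (simp add: u_def v0(1))
    have uv: "(\<Sum>e\<in>insert e0 E. u e * v j e) = 0" if j: "j \<in> J" for j
    proof -
      have "(\<Sum>e\<in>insert e0 E. u e * v j e)
          = c j + (\<Sum>e\<in>insert e0 E. \<Sum>i\<in>J. (- c i) * (v i e * v j e))"
        by (simp only: u_def distrib_right sum.distrib sum_distrib_right c_def mult.assoc)
      also have "(\<Sum>e\<in>insert e0 E. \<Sum>i\<in>J. (- c i) * (v i e * v j e))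
          = (\<Sum>i\<in>J. (- c i) * (\<Sum>e\<in>insert e0 E. v i e * v j e))"
        by (subst sum.swap) (simp only: sum_distrib_left)
      also have "\<dots> = (\<Sum>i\<in>J. (- c i) * (if i = j then 1 else 0))"
        by (rule sum.cong[OF refl]) (simp only: orth'[OF _ j])
      also have "\<dots> = - c j" using j finJ by (simp add: sum.delta if_distrib cong: if_cong)
      finally show ?thesis by simp
    qed
    define N where "N = (\<Sum>e\<in>insert e0 E. u e * u e)"
    have "u e0 * u e0 \<le> N"
      unfolding N_def by (rule member_le_sum) (use insert.hyps in auto)
    moreover have "u e0 * u e0 > 0" using u0 by (metis not_real_square_gt_zero)
    ultimately have N: "N > 0" by linarith
    define v' where "v' = v(e0 := \<lambda>e. u e / sqrt N)"
    have e0J: "e0 \<notin> J" using J insert.hyps by blast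
    have v'J: "v' j = v j" if "j \<in> J" for j using that e0J by (auto simp: v'_def)
    have v'e0: "v' e0 = (\<lambda>e. u e / sqrt N)" by (simp add: v'_def)
    show ?thesis
    proof (intro exI[of _ "insert e0 J"] exI[of _ v'] conjI ballI impI)
      show "insert e0 J \<subseteq> insert e0 E" using J by blast
      fix j assume "j \<in> insert e0 J"
      moreover have "(\<lambda>e. u e / sqrt N) \<in> K"
      proof -
        have "(\<lambda>e. u e + (1 / sqrt N - 1) * u e) \<in> K" by (rule insert.prems(2)[OF uK uK])
        then show ?thesis by (simp add: field_simps)
      qed
      ultimately show "v' j \<in> K" using v'J v0(2) v'e0 by auto
    next
      fix i j assume ij: "i \<in> insert e0 J" "j \<in> insert e0 J"
      have 1: "(\<Sum>e\<in>insert e0 E. u e / sqrt N * (u e / sqrt N)) = 1"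
      proof -
        have "(\<Sum>e\<in>insert e0 E. u e / sqrt N * (u e / sqrt N)) = N / N"
          unfolding N_def sum_divide_distrib using N[unfolded N_def]
          by (intro sum.cong) (auto simp: power2_eq_square[symmetric] power_divide)
        then show ?thesis using N by simp
      qed
      have 2: "(\<Sum>e\<in>insert e0 E. u e / sqrt N * v k e) = 0" if "k \<in> J" for k
      proof -
        have "(\<Sum>e\<in>insert e0 E. u e / sqrt N * v k e) = (\<Sum>e\<in>insert e0 E. u e * v k e) / sqrt N"
          by (simp only: sum_divide_distrib times_divide_eq_left)
        then show ?thesis by (simp only: uv[OF that] div_0)
      qed
      have 3: "(\<Sum>e\<in>insert e0 E. v k e * (u e / sqrt N)) = 0" if "k \<in> J" for k
        using 2[OF that] by (simp only: mult.commute)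
      show "(\<Sum>e\<in>insert e0 E. v' i e * v' j e) = (if i = j then 1 else 0)"
      proof (cases "i = e0"; cases "j = e0")
        assume "i = e0" "j = e0" then show ?thesis using 1 by (simp only: v'e0 refl if_True)
      next
        assume i: "i = e0" and "j \<noteq> e0"
        then have j: "j \<in> J" using ij by blast
        show ?thesis unfolding i v'e0 v'J[OF j] using 2[OF j] \<open>j \<noteq> e0\<close> by auto
      next
        assume "i \<noteq> e0" and j: "j = e0"
        then have i: "i \<in> J" using ij by blast
        show ?thesis unfolding j v'e0 v'J[OF i] using 3[OF i] \<open>i \<noteq> e0\<close> by auto
      next
        assume "i \<noteq> e0" "j \<noteq> e0"
        then have "i \<in> J" "j \<in> J" using ij by auto
        then show ?thesis using orth' by (simp only: v'J)
      qed
    next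
      fix z assume z: "z \<in> K" "\<forall>j\<in>insert e0 J. z j = 0"
      then show "z = (\<lambda>e. 0)" by (intro inj) (auto simp: K'_def)
    qed
  qed
qed

lemma bessel_inequality:
  fixes V :: "'j \<Rightarrow> 'h::real_inner"
  assumes "finite J" "\<And>i j. i \<in> J \<Longrightarrow> j \<in> J \<Longrightarrow> V i \<bullet> V j = (if i = j then 1 else 0)"
  shows "(\<Sum>j\<in>J. (x \<bullet> V j)\<^sup>2) \<le> (norm x)\<^sup>2"
proof -
  define y where "y = (\<Sum>j\<in>J. (x \<bullet> V j) *\<^sub>R V j)"
  have xy: "x \<bullet> y = (\<Sum>j\<in>J. (x \<bullet> V j)\<^sup>2)"
    by (simp add: y_def inner_sum_right power2_eq_square)
  have "y \<bullet> V j = x \<bullet> V j" if j: "j \<in> J" for j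
  proof -
    have "y \<bullet> V j = (\<Sum>i\<in>J. (x \<bullet> V i) * (if i = j then 1 else 0))"
      unfolding y_def inner_sum_left by (rule sum.cong) (use assms(2) j in auto)
    also have "\<dots> = x \<bullet> V j" using j assms(1) by (simp add: sum.delta if_distrib cong: if_cong)
    finally show ?thesis .
  qed
  then have yy: "y \<bullet> y = (\<Sum>j\<in>J. (x \<bullet> V j)\<^sup>2)"
    by (subst (2) y_def) (simp add: inner_sum_right power2_eq_square)
  have "0 \<le> (x - y) \<bullet> (x - y)" by simp
  also have "(x - y) \<bullet> (x - y) = (norm x)\<^sup>2 - (\<Sum>j\<in>J. (x \<bullet> V j)\<^sup>2)"
    using xy yy by (simp add: inner_diff_left inner_diff_right inner_commute[of y x] power2_norm_eq_inner)
  finally show ?thesis by simp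
qed

text \<open>
  The sum on the right is a partial trace of \<open>T\<^sup>2\<close>, which is compared with the squared norms of the
  fixed vectors \<open>v j\<close>: the value \<open>v j e\<close> is the inner product of \<open>\<delta> e\<close> with \<open>v j\<close>, hence that of \<open>T \<delta> e\<close> with \<open>v j\<close>, and Bessel's
  inequality applies for each \<open>e\<close>.
\<close>

lemma card_fixed_orthonormal_le:
  fixes v :: "'i \<Rightarrow> 'i \<Rightarrow> real" and T :: "'i ell2 \<Rightarrow> 'i ell2"
  assumes E: "finite E" "J \<subseteq> E"
    and supp: "\<And>j e. j \<in> J \<Longrightarrow> e \<notin> E \<Longrightarrow> v j e = 0"
    and orth: "\<And>i j. i \<in> J \<Longrightarrow> j \<in> J \<Longrightarrow> (\<Sum>e\<in>E. v i e * v j e) = (if i = j then 1 else 0)"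
    and sym: "\<And>x y. T x \<bullet> y = x \<bullet> T y"
    and fixed: "\<And>j. j \<in> J \<Longrightarrow> T (Ell2 (\<lambda>e. of_real (v j e))) = Ell2 (\<lambda>e. of_real (v j e))"
  shows "real (card J) \<le> (\<Sum>e\<in>E. (norm (T (unit_vec e)))\<^sup>2)"
proof -
  define V where "V j = Ell2 (\<lambda>e. complex_of_real (v j e))" for j
  have cV: "coord (V j) = (\<lambda>e. of_real (v j e))" if "j \<in> J" for j
    unfolding V_def
  proof (rule coord_Ell2, rule finite_nonzero_values_imp_summable_on)
    show "finite {x \<in> UNIV. (cmod (complex_of_real (v j x)))\<^sup>2 \<noteq> 0}"
      by (rule finite_subset[OF _ E(1)]) (use supp[OF that] in auto)
  qed
  have VV: "V i \<bullet> V j = (if i = j then 1 else 0)" if ij: "i \<in> J" "j \<in> J" for i j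
  proof -
    have "V i \<bullet> V j = (\<Sum>\<^sub>\<infinity>e. v i e * v j e)"
      unfolding inner_ell2_def cV[OF ij(1)] cV[OF ij(2)] by (simp add: inner_complex_def)
    also have "\<dots> = (\<Sum>\<^sub>\<infinity>e\<in>E. v i e * v j e)"
      by (rule infsum_cong_neutral) (use supp ij in auto)
    finally show ?thesis using orth[OF ij] E(1) by simp
  qed
  have finJ: "finite J" using E finite_subset by blast
  have "real (card J) = (\<Sum>j\<in>J. \<Sum>e\<in>E. v j e * v j e)" using orth by simp
  also have "\<dots> = (\<Sum>e\<in>E. \<Sum>j\<in>J. v j e * v j e)" by (rule sum.swap)
  also have "\<dots> = (\<Sum>e\<in>E. \<Sum>j\<in>J. (T (unit_vec e) \<bullet> V j)\<^sup>2)"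
  proof (intro sum.cong refl)
    fix e j assume j: "j \<in> J"
    have "T (unit_vec e) \<bullet> V j = unit_vec e \<bullet> V j"
      using fixed[OF j] by (simp add: sym V_def)
    then show "v j e * v j e = (T (unit_vec e) \<bullet> V j)\<^sup>2"
      by (simp add: inner_unit_vec cV[OF j] power2_eq_square)
  qed
  also have "\<dots> \<le> (\<Sum>e\<in>E. (norm (T (unit_vec e)))\<^sup>2)"
    by (rule sum_mono, rule bessel_inequality[OF finJ VV])
  finally show ?thesis .
qed

text \<open>
  The cube \<open>[0, p)\<^sup>E\<close> is cut into \<open>l\<^bsup>|E|\<^esup>\<close> cubes of side \<open>R + 1\<close>, where \<open>l R < p\<close>. The difference of
  two solutions in the same small cube has entries at most \<open>R\<close> in absolute value, so its value under
  each equation is less than \<open>p\<close> in absolute value, and being divisible by \<open>p\<close>, it is zero. Hence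
  the difference is determined by its coordinates in \<open>J\<close>, for which there are at most \<open>p\<^bsup>|J|\<^esup>\<close>
  possibilities.
\<close>

lemma card_solutions_mod_le:
  fixes lam :: "'r \<Rightarrow> ('e \<Rightarrow> int) \<Rightarrow> int" and p l :: nat
  assumes E: "finite E" "J \<subseteq> E" and p: "p > 0" and l: "l > 0"
    and diff: "\<And>r z w. r \<in> B \<Longrightarrow> lam r (\<lambda>e. z e - w e) = lam r z - lam r w"
    and bound: "\<And>r z R. r \<in> B \<Longrightarrow> (\<And>e. \<bar>z e\<bar> \<le> R) \<Longrightarrow> \<bar>lam r z\<bar> \<le> int l * R"
    and inj: "\<And>z. (\<And>e. e \<notin> E \<Longrightarrow> z e = 0) \<Longrightarrow> (\<And>r. r \<in> B \<Longrightarrow> lam r z = 0) \<Longrightarrow>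
      (\<And>j. j \<in> J \<Longrightarrow> z j = 0) \<Longrightarrow> z = (\<lambda>e. 0)"
  shows "finite {z. (\<forall>e\<in>E. z e \<in> {0..<int p}) \<and> (\<forall>e. e \<notin> E \<longrightarrow> z e = 0) \<and> (\<forall>r\<in>B. int p dvd lam r z)}"
    and "card {z. (\<forall>e\<in>E. z e \<in> {0..<int p}) \<and> (\<forall>e. e \<notin> E \<longrightarrow> z e = 0) \<and> (\<forall>r\<in>B. int p dvd lam r z)}
      \<le> l ^ card E * p ^ card J"
proof -
  define S where "S = {z. (\<forall>e\<in>E. z e \<in> {0..<int p}) \<and> (\<forall>e. e \<notin> E \<longrightarrow> z e = 0) \<and> (\<forall>r\<in>B. int p dvd lam r z)}"
  (* The largest R with l R < p; then l intervals of length R + 1 cover [0, p). *)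
  define R where "R = (int p - 1) div int l"
  have R0: "R \<ge> 0" using p l by (simp add: R_def pos_imp_zdiv_nonneg_iff)
  have Rl: "int l * R < int p"
  proof -
    have "int l * R \<le> int p - 1" using l unfolding R_def by (metis add_le_same_cancel1 le_add_same_cancel1 mult_div_mod_eq of_nat_0_less_iff pos_mod_sign)
    then show ?thesis by simp
  qed
  have Ru: "int p - 1 < int l * (R + 1)"
  proof -
    have "int p - 1 = int l * R + (int p - 1) mod int l" unfolding R_def by simp
    moreover have "(int p - 1) mod int l < int l" using l by simp
    ultimately show ?thesis by (simp add: distrib_left)
  qed
  define F where "F z = (restrict (\<lambda>e. z e div (R + 1)) E, restrict z J)" for z
  have maps: "F ` S \<subseteq> (E \<rightarrow>\<^sub>E {0..<int l}) \<times> (J \<rightarrow>\<^sub>E {0..<int p})"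
  proof -
    have "z e div (R + 1) \<in> {0..<int l}" if "z \<in> S" "e \<in> E" for z e
    proof -
      have z: "0 \<le> z e" "z e \<le> int p - 1" using that by (auto simp: S_def)
      have "z e < int l * (R + 1)" using z(2) Ru by linarith
      moreover have "(R + 1) * (z e div (R + 1)) \<le> z e"
        using mult_div_mod_eq[of "R + 1" "z e"] pos_mod_sign[of "R + 1" "z e"] R0 by linarith
      ultimately have "(R + 1) * (z e div (R + 1)) < (R + 1) * int l" by (simp add: mult.commute)
      then have "z e div (R + 1) < int l" using R0 by simp
      moreover have "z e div (R + 1) \<ge> 0" using z(1) R0 by (simp add: pos_imp_zdiv_nonneg_iff)
      ultimately show ?thesis by simp
    qed
    moreover have "z j \<in> {0..<int p}" if "z \<in> S" "j \<in> J" for z j using that E(2) by (auto simp: S_def)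
    ultimately show ?thesis by (auto simp: F_def)
  qed
  have "inj_on F S"
  proof (rule inj_onI)
    fix z w assume z: "z \<in> S" and w: "w \<in> S" and eq: "F z = F w"
    have blk: "z e div (R + 1) = w e div (R + 1)" if "e \<in> E" for e
      using eq that unfolding F_def by (auto dest: fun_cong[of _ _ e])
    have co: "z j = w j" if "j \<in> J" for j
      using eq that unfolding F_def by (auto dest: fun_cong[of _ _ j])
    have zero: "z e = 0" "w e = 0" if "e \<notin> E" for e using that z w by (auto simp: S_def)
    have small: "\<bar>z e - w e\<bar> \<le> R" for e
    proof (cases "e \<in> E")
      case True
      have "z e = (R + 1) * (w e div (R + 1)) + z e mod (R + 1)"
        using mult_div_mod_eq[of "R + 1" "z e"] blk[OF True] by simp
      moreover have "w e = (R + 1) * (w e div (R + 1)) + w e mod (R + 1)" by simp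
      ultimately have "z e - w e = z e mod (R + 1) - w e mod (R + 1)" by linarith
      moreover have "0 \<le> z e mod (R + 1)" "0 \<le> w e mod (R + 1)" using R0 by simp_all
      moreover have "z e mod (R + 1) < R + 1" "w e mod (R + 1) < R + 1"
        by (rule pos_mod_bound, use R0 in simp)+
      ultimately show ?thesis by linarith
    qed (use zero R0 in simp)
    have "(\<lambda>e. z e - w e) = (\<lambda>e. 0)"
    proof (rule inj)
      fix r assume r: "r \<in> B"
      have "int p dvd lam r (\<lambda>e. z e - w e)" using r z w by (auto simp: diff S_def)
      moreover have "\<bar>lam r (\<lambda>e. z e - w e)\<bar> < int p" using bound[of r "\<lambda>e. z e - w e" R, OF r small] Rl by linarith
      ultimately show "lam r (\<lambda>e. z e - w e) = 0"
        using zdvd_imp_le[of "int p" "\<bar>lam r (\<lambda>e. z e - w e)\<bar>"] by fastforce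
    qed (simp_all add: zero co)
    then show "z = w" by (metis eq_iff_diff_eq_0 ext)
  qed
  have finT: "finite ((E \<rightarrow>\<^sub>E {0..<int l}) \<times> (J \<rightarrow>\<^sub>E {0..<int p}))"
    using E finite_subset by (intro finite_cartesian_product finite_PiE) auto
  show "finite {z. (\<forall>e\<in>E. z e \<in> {0..<int p}) \<and> (\<forall>e. e \<notin> E \<longrightarrow> z e = 0) \<and> (\<forall>r\<in>B. int p dvd lam r z)}"
    unfolding S_def[symmetric] by (rule inj_on_finite[OF \<open>inj_on F S\<close> maps finT])
  have "card S \<le> card ((E \<rightarrow>\<^sub>E {0..<int l}) \<times> (J \<rightarrow>\<^sub>E {0..<int p}))"
    by (rule card_inj_on_le[OF \<open>inj_on F S\<close> maps finT])
  also have "\<dots> = l ^ card E * p ^ card J"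
    using E finite_subset[OF E(2,1)] by (simp add: card_cartesian_product card_PiE)
  finally show "card {z. (\<forall>e\<in>E. z e \<in> {0..<int p}) \<and> (\<forall>e. e \<notin> E \<longrightarrow> z e = 0) \<and> (\<forall>r\<in>B. int p dvd lam r z)}
      \<le> l ^ card E * p ^ card J" by (simp add: S_def)
qed

section \<open>Homomorphisms of a stabilizer and harmonic cochains\<close>

lemma row_apply_diff:
  "row_apply act L (\<lambda>e. z e - w e) x = row_apply act L z x - row_apply act L w x"
  unfolding row_apply_def by (induction L) (auto simp: algebra_simps)

lemma row_apply_cong_mod:
  fixes z w :: "'x \<times> nat \<Rightarrow> int"
  assumes "\<And>i c g. (i, c, g) \<in> set L \<Longrightarrow> [z (act x g, i) = w (act x g, i)] (mod m)"
  shows "[row_apply act L z x = row_apply act L w x] (mod m)"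
  using assms
proof (induction L)
  case (Cons a L)
  obtain i c g where a: "a = (i, c, g)" by (cases a)
  have "[of_int c * z (act x g, i) + row_apply act L z x = of_int c * w (act x g, i) + row_apply act L w x] (mod m)"
    using Cons a by (intro cong_add cong_mult) auto
  then show ?case by (simp add: a row_apply_def)
qed (simp add: row_apply_def)

lemma row_apply_of_int:
  "row_apply act L (\<lambda>e. of_int (z e)) x = of_int (row_apply act L z x)"
  unfolding row_apply_def by (induction L) auto

lemma row_apply_of_real:
  "row_apply act L (\<lambda>e. complex_of_real (z e)) x = of_real (row_apply act L z x)"
  unfolding row_apply_def by (induction L) auto

lemma row_apply_bound:
  fixes z :: "'x \<times> nat \<Rightarrow> int"
  assumes "\<And>e. \<bar>z e\<bar> \<le> R"
  shows "\<bar>row_apply act L z x\<bar> \<le> (\<Sum>(i, c, g)\<leftarrow>L. \<bar>c\<bar>) * R"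
proof (induction L)
  case (Cons a L)
  obtain i c g where a: "a = (i, c, g)" by (cases a)
  have "\<bar>row_apply act (a # L) z x\<bar> \<le> \<bar>c\<bar> * \<bar>z (act x g, i)\<bar> + \<bar>row_apply act L z x\<bar>"
    by (simp add: a row_apply_def abs_mult[symmetric])
  also have "\<dots> \<le> \<bar>c\<bar> * R + (\<Sum>(i, c, g)\<leftarrow>L. \<bar>c\<bar>) * R"
    by (intro add_mono mult_left_mono assms Cons) auto
  finally show ?case by (simp add: a algebra_simps)
qed (simp add: row_apply_def)

context right_action
begin

text \<open>
  If \<open>t x\<close> is an element that takes \<open>x0\<close> to \<open>x\<close>, put \<open>\<theta> x g = t(x) g t(x g)\<^sup>-\<^sup>1\<close>. On the stabilizer
  of \<open>x0\<close>, the map \<open>\<theta> x0\<close> is conjugation by \<open>t x0\<close>, whence it is onto.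
\<close>

lemma stabilizer_cocycle:
  assumes x0: "x0 \<in> X" and trans: "\<And>x. x \<in> X \<Longrightarrow> \<exists>g\<in>carrier G. act x0 g = x"
  shows "\<exists>\<theta>. (\<forall>x\<in>X. \<forall>g\<in>carrier G. \<theta> x g \<in> {g \<in> carrier G. act x0 g = x0}) \<and>
    (\<forall>x\<in>X. \<forall>g\<in>carrier G. \<forall>h\<in>carrier G. \<theta> x (g \<otimes> h) = \<theta> x g \<otimes> \<theta> (act x g) h) \<and>
    (\<forall>x\<in>X. \<theta> x \<one> = \<one>) \<and>
    (\<forall>g\<in>carrier G. act x0 g = x0 \<longrightarrow> (\<exists>g'\<in>carrier G. act x0 g' = x0 \<and> \<theta> x0 g' = g))"
proof -
  define t where "t x = (SOME g. g \<in> carrier G \<and> act x0 g = x)" for x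
  have t: "t x \<in> carrier G" "act x0 (t x) = x" if "x \<in> X" for x
    using someI_ex[of "\<lambda>g. g \<in> carrier G \<and> act x0 g = x"] trans[OF that] by (auto simp: t_def)
  define \<theta> where "\<theta> x g = t x \<otimes> g \<otimes> inv (t (act x g))" for x g
  have theta: "\<theta> x g \<in> {g \<in> carrier G. act x0 g = x0}" if "x \<in> X" "g \<in> carrier G" for x g
  proof -
    have y: "act x g \<in> X" using that by (rule act_closed)
    have "act x0 (\<theta> x g) = act (act (act x0 (t x)) g) (inv (t (act x g)))"
      using that t(1)[OF that(1)] t(1)[OF y] x0 by (simp add: \<theta>_def act_mult[symmetric])
    also have "\<dots> = act (act x0 (t (act x g))) (inv (t (act x g)))" using t[OF that(1)] t[OF y] by simp
    also have "\<dots> = x0" using t(1)[OF y] x0 by (rule act_inv1[rotated])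
    finally show ?thesis using that t[OF that(1)] t[OF y] by (simp add: \<theta>_def)
  qed
  have theta_mult: "\<theta> x (g \<otimes> h) = \<theta> x g \<otimes> \<theta> (act x g) h" if "x \<in> X" "g \<in> carrier G" "h \<in> carrier G" for x g h
  proof -
    have y: "act x g \<in> X" "act (act x g) h \<in> X" using that by (auto intro: act_closed)
    have e: "inv u \<otimes> (u \<otimes> v) = v" if "u \<in> carrier G" "v \<in> carrier G" for u v
      using that by (simp add: m_assoc[symmetric])
    show ?thesis
      using that t(1)[OF that(1)] t(1)[OF y(1)] t(1)[OF y(2)] by (simp add: \<theta>_def m_assoc act_mult[symmetric] e)
  qed
  show ?thesis
  proof (intro exI[of _ \<theta>] conjI ballI impI)
    show "\<theta> x g \<in> {g \<in> carrier G. act x0 g = x0}" if "x \<in> X" "g \<in> carrier G" for x g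
      using that by (rule theta)
    show "\<theta> x (g \<otimes> h) = \<theta> x g \<otimes> \<theta> (act x g) h" if "x \<in> X" "g \<in> carrier G" "h \<in> carrier G" for x g h
      using that by (rule theta_mult)
    show "\<theta> x \<one> = \<one>" if "x \<in> X" for x using that t by (simp add: \<theta>_def act_one)
    fix g assume gG: "g \<in> carrier G" "act x0 g = x0"
    have t0: "t x0 \<in> carrier G" "act x0 (t x0) = x0" using t[OF x0] .
    have it0: "act x0 (inv (t x0)) = x0" using act_inv1[OF x0 t0(1)] t0(2) by simp
    define g' where "g' = inv (t x0) \<otimes> g \<otimes> t x0"
    have g'G: "g' \<in> carrier G" using gG t0 by (simp add: g'_def)
    have g'0: "act x0 g' = x0"
      using gG t0 it0 x0 by (simp add: g'_def act_mult[symmetric])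
    have "\<theta> x0 g' = g"
      using gG t0 g'0 by (simp add: \<theta>_def g'_def m_assoc[symmetric]) (simp add: m_assoc)
    then show "\<exists>g'\<in>carrier G. act x0 g' = x0 \<and> \<theta> x0 g' = g" using g'G g'0 by blast
  qed
qed

text \<open>
  This is the combinatorial form of the Shapiro isomorphism and of the Hodge decomposition. A
  homomorphism \<open>\<phi>\<close> of the stabilizer gives the cochain \<open>\<phi> (\<theta> x (s i))\<close>, which sums to zero along
  loops, and so does its sum with the coboundary of a function \<open>h\<close> on \<open>X\<close>. In general no
  choice of \<open>h\<close> makes the divergence zero modulo \<open>p\<close>, but it suffices to have many pairs \<open>(\<phi>, h)\<close>
  with the same divergence. Normalizing \<open>h\<close> at \<open>x0\<close>, there are \<open>p\<^bsup>|X|-1\<^esup>\<close> functions \<open>h\<close>, and at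
  most as many divergences, as these sum to zero over \<open>X\<close>. So some divergence is attained by at least as many pairs \<open>(\<phi>, h)\<close> as there are
  homomorphisms, and the differences of the corresponding cochains are harmonic.
\<close>

lemma card_homs_le_card_cochains:
  fixes \<phi> :: "'c \<Rightarrow> 'g \<Rightarrow> int" and p d m :: nat and s :: "nat \<Rightarrow> 'g" and S :: "('x \<times> nat \<Rightarrow> int) set"
  assumes S_def: "S = {z. (\<forall>e\<in>X \<times> {..<d}. z e \<in> {0..<int p}) \<and> (\<forall>e. e \<notin> X \<times> {..<d} \<longrightarrow> z e = 0) \<and>
      (\<forall>r\<in>harmonic_rows G s d m \<times> X. int p dvd row_apply act (fst r) z (snd r))}"
    and s: "\<And>i. i < d \<Longrightarrow> s i \<in> carrier G"
    and gen: "\<And>g. g \<in> carrier G \<Longrightarrow> \<exists>w. set w \<subseteq> {..<d} \<and> word_prod G s w = g"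
    and X: "finite X" "x0 \<in> X" "\<And>x. x \<in> X \<Longrightarrow> \<exists>g\<in>carrier G. act x0 g = x"
    and N: "N = {g \<in> carrier G. act x0 g = x0}"
    and p: "p > 0" and C: "finite C" and S: "finite S"
    and hom: "\<And>c g h. c \<in> C \<Longrightarrow> g \<in> N \<Longrightarrow> h \<in> N \<Longrightarrow> [\<phi> c (g \<otimes> h) = \<phi> c g + \<phi> c h] (mod int p)"
    and inj: "\<And>c c'. c \<in> C \<Longrightarrow> c' \<in> C \<Longrightarrow> (\<And>g. g \<in> N \<Longrightarrow> [\<phi> c g = \<phi> c' g] (mod int p)) \<Longrightarrow> c = c'"
  shows "card C \<le> card S"
proof -
  define q where "q = int p"
  have q: "q > 0" using p by (simp add: q_def)
  from stabilizer_cocycle[OF X(2,3), folded N] obtain \<theta> where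
    *: "(\<forall>x\<in>X. \<forall>g\<in>carrier G. \<theta> x g \<in> N) \<and>
      (\<forall>x\<in>X. \<forall>g\<in>carrier G. \<forall>h\<in>carrier G. \<theta> x (g \<otimes> h) = \<theta> x g \<otimes> \<theta> (act x g) h) \<and>
      (\<forall>x\<in>X. \<theta> x \<one> = \<one>) \<and>
      (\<forall>g\<in>carrier G. act x0 g = x0 \<longrightarrow> (\<exists>g'\<in>carrier G. act x0 g' = x0 \<and> \<theta> x0 g' = g))"
    by (rule exE)
  have theta: "\<theta> x g \<in> N" if "x \<in> X" "g \<in> carrier G" for x g using * that by simp
  have theta_mult: "\<theta> x (g \<otimes> h) = \<theta> x g \<otimes> \<theta> (act x g) h"
    if "x \<in> X" "g \<in> carrier G" "h \<in> carrier G" for x g h using * that by simp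
  have theta_one: "\<theta> x \<one> = \<one>" if "x \<in> X" for x using * that by simp
  have theta_onto: "\<exists>g'\<in>carrier G. act x0 g' = x0 \<and> \<theta> x0 g' = g"
    if "g \<in> carrier G" "act x0 g = x0" for g using * that by simp
  (* The functions h on X that vanish at x0 (this value is supplied by val), so that their
     coboundaries are distinct. *)
  define H where "H = ((X - {x0}) \<rightarrow>\<^sub>E {0..<q})"
  define val where "val h x = (if x = x0 then 0 else h x)" for h :: "'x \<Rightarrow> int" and x
  define \<psi> where "\<psi> ch = (\<lambda>(x, i). if x \<in> X \<and> i < d
      then (\<phi> (fst ch) (\<theta> x (s i)) + val (snd ch) (act x (s i)) - val (snd ch) x) mod q else 0)" for ch
  have N1: "\<one> \<in> N" using X(2) by (simp add: N act_one)
  have hom1: "[\<phi> c \<one> = 0] (mod q)" if "c \<in> C" for c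
  proof -
    have "[\<phi> c \<one> = \<phi> c \<one> + \<phi> c \<one>] (mod q)" using hom[OF that N1 N1] by (simp add: q_def)
    then show ?thesis by (simp add: cong_iff_dvd_diff)
  qed
  (* Along a path the coboundary telescopes, and the values of theta multiply by the cocycle rule. *)
  have path: "[row_apply act (path_row G s w) (\<psi> (c, h)) x =
      \<phi> c (\<theta> x (word_prod G s w)) + val h (act x (word_prod G s w)) - val h x] (mod q)"
    if c: "c \<in> C" and "set w \<subseteq> {..<d}" "x \<in> X" for c h w x
    using that(2,3)
  proof (induction w arbitrary: x)
    case Nil
    have "\<theta> x \<one> = \<one>" using Nil theta_one by simp
    then show ?case using hom1[OF c] Nil by (simp add: row_apply_def act_one cong_sym)
  next
    case (Cons i w)
    then have i: "i < d" and w: "set w \<subseteq> {..<d}" and x: "x \<in> X" by auto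
    have si: "s i \<in> carrier G" by (rule s[OF i])
    have y: "act x (s i) \<in> X" by (rule act_closed[OF x si])
    have wp: "word_prod G s w \<in> carrier G" by (rule word_prod_closed[where d = d, OF s w])
    have "row_apply act (path_row G s (i # w)) (\<psi> (c, h)) x
        = \<psi> (c, h) (x, i) + row_apply act (path_row G s w) (\<psi> (c, h)) (act x (s i))"
      by (rule row_apply_path[where s = s and d = d, OF s i w x])
    also have "[\<dots> = (\<phi> c (\<theta> x (s i)) + val h (act x (s i)) - val h x) +
       (\<phi> c (\<theta> (act x (s i)) (word_prod G s w)) + val h (act (act x (s i)) (word_prod G s w)) - val h (act x (s i)))] (mod q)"
      by (intro cong_add Cons.IH w y) (use x i in \<open>simp add: \<psi>_def\<close>)
    also have "(\<phi> c (\<theta> x (s i)) + val h (act x (s i)) - val h x) +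
       (\<phi> c (\<theta> (act x (s i)) (word_prod G s w)) + val h (act (act x (s i)) (word_prod G s w)) - val h (act x (s i)))
       = (\<phi> c (\<theta> x (s i)) + \<phi> c (\<theta> (act x (s i)) (word_prod G s w))) + val h (act x (word_prod G s (i # w))) - val h x"
      by (simp add: act_mult x si wp)
    also have "[\<dots> = \<phi> c (\<theta> x (s i) \<otimes> \<theta> (act x (s i)) (word_prod G s w)) + val h (act x (word_prod G s (i # w))) - val h x] (mod q)"
      by (intro cong_add cong_diff cong_refl cong_sym[OF hom[folded q_def]] c theta x si y wp)
    also have "\<theta> x (s i) \<otimes> \<theta> (act x (s i)) (word_prod G s w) = \<theta> x (word_prod G s (i # w))"
      using theta_mult[OF x si wp] by simp
    finally show ?case .
  qed
  define dv where "dv ch = (\<lambda>x\<in>X. row_apply act (divergence_row G s d) (\<psi> ch) x mod q)" for ch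
  define Y where "Y = {y \<in> X \<rightarrow>\<^sub>E {0..<q}. q dvd (\<Sum>x\<in>X. y x)}"
  have divY: "dv ch \<in> Y" for ch
  proof -
    have "(\<Sum>x\<in>X. row_apply act (divergence_row G s d) (\<psi> ch) x)
        = (\<Sum>x\<in>X. \<Sum>i<d. \<psi> ch (act x (inv (s i)), i) - \<psi> ch (x, i))"
      by (rule sum.cong[OF refl]) (simp add: row_apply_divergence)
    also have "\<dots> = (\<Sum>i<d. (\<Sum>x\<in>X. \<psi> ch (act x (inv (s i)), i)) - (\<Sum>x\<in>X. \<psi> ch (x, i)))"
      by (subst sum.swap) (simp add: sum_subtractf)
    also have "\<dots> = 0"
    proof (rule sum.neutral, rule ballI)
      fix i assume "i \<in> {..<d}"
      then have "inv (s i) \<in> carrier G" using s by auto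
      from sum.reindex_bij_betw[OF bij_betw_act[OF this], of "\<lambda>x. \<psi> ch (x, i)"]
      show "(\<Sum>x\<in>X. \<psi> ch (act x (inv (s i)), i)) - (\<Sum>x\<in>X. \<psi> ch (x, i)) = 0" by simp
    qed
    finally have z: "(\<Sum>x\<in>X. row_apply act (divergence_row G s d) (\<psi> ch) x) = 0" .
    have "[(\<Sum>x\<in>X. dv ch x) = (\<Sum>x\<in>X. row_apply act (divergence_row G s d) (\<psi> ch) x)] (mod q)"
      by (rule cong_sum) (simp add: dv_def)
    then show ?thesis using q z by (auto simp: Y_def dv_def cong_0_iff)
  qed
  have finX': "finite (X - {x0})" using X(1) by simp
  have finH: "finite H" unfolding H_def using finX' by (intro finite_PiE) auto
  have finY: "finite Y"
    unfolding Y_def by (rule finite_subset[of _ "X \<rightarrow>\<^sub>E {0..<q}"]) (use X(1) in \<open>auto intro: finite_PiE\<close>)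
  (* A function with sum zero is determined by its values outside x0. *)
  have cardY: "card Y \<le> card H"
  proof (rule card_inj_on_le[OF _ _ finH])
    show "(\<lambda>y. restrict y (X - {x0})) ` Y \<subseteq> H"
    proof (rule image_subsetI)
      fix y assume "y \<in> Y"
      then have "y x \<in> {0..<q}" if "x \<in> X" for x using that unfolding Y_def by (blast dest: PiE_mem)
      then show "restrict y (X - {x0}) \<in> H" unfolding H_def by (intro PiE_I) auto
    qed
    show "inj_on (\<lambda>y. restrict y (X - {x0})) Y"
    proof (rule inj_onI)
      fix y y' assume y: "y \<in> Y" "y' \<in> Y" and eq: "restrict y (X - {x0}) = restrict y' (X - {x0})"
      have off: "y x = y' x" if "x \<in> X - {x0}" for x using fun_cong[OF eq, of x] that by simp
      have "q dvd (\<Sum>x\<in>X. y x) - (\<Sum>x\<in>X. y' x)" using y by (intro dvd_diff) (auto simp: Y_def)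
      also have "(\<Sum>x\<in>X. y x) - (\<Sum>x\<in>X. y' x) = y x0 - y' x0"
        using off by (simp add: sum.remove[OF X(1,2)])
      finally have "y x0 = y' x0"
        using y X(2) by (intro cong_less_imp_eq_int[of "y x0" q "y' x0"]) (auto simp: Y_def cong_iff_dvd_diff PiE_iff)
      then show "y = y'"
        using y off by (intro PiE_ext[of y X "\<lambda>_. {0..<q}" y']) (auto simp: Y_def)
    qed
  qed
  have Hne: "card H > 0"
    unfolding H_def using finX' q by (subst card_PiE) (auto intro!: prod_pos)
  have Yne: "Y \<noteq> {}" using divY by blast
  obtain y where y: "y \<in> Y" "card (C \<times> H) \<le> card (dv -` {y} \<inter> (C \<times> H)) * card Y"
    using pigeonhole_card[of dv "C \<times> H" Y] divY C finH finY Yne by auto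
  define A where "A = dv -` {y} \<inter> (C \<times> H)"
  have "card C * card H \<le> card A * card Y"
    using y(2) by (simp add: card_cartesian_product A_def)
  also have "\<dots> \<le> card A * card H" by (rule mult_le_mono2[OF cardY])
  finally have CA: "card C \<le> card A" using Hne by simp
  show "card C \<le> card S"
  proof (cases "A = {}")
    case True then show ?thesis using CA by simp
  next
    case False
    then obtain a where a: "a \<in> A" by blast
    define D where "D b e = (\<psi> b e - \<psi> a e) mod q" for b e
    have "D ` A \<subseteq> S"
    proof
      fix z assume "z \<in> D ` A"
      then obtain b where b: "b \<in> A" "z = D b" by blast
      obtain c h where bc: "b = (c, h)" by (cases b)
      obtain c' h' where ac: "a = (c', h')" by (cases a)
      have cc: "c \<in> C" "c' \<in> C" using a b bc ac by (auto simp: A_def)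
      have ra: "[row_apply act L z x = row_apply act L (\<psi> b) x - row_apply act L (\<psi> a) x] (mod q)" for L x
        unfolding row_apply_diff[symmetric] by (rule row_apply_cong_mod) (simp add: b(2) D_def)
      have "q dvd row_apply act L z x" if L: "L \<in> harmonic_rows G s d m" and x: "x \<in> X" for L x
      proof -
        have "[row_apply act L (\<psi> b) x = row_apply act L (\<psi> a) x] (mod q)"
        proof (cases "L = divergence_row G s d")
          case True
          have "dv b x = dv a x" using a b(1) by (simp add: A_def)
          then show ?thesis using x True by (simp add: dv_def cong_def)
        next
          case False
          then obtain w where w: "L = path_row G s w" "set w \<subseteq> {..<d}" "word_prod G s w = \<one>"
            using L by (auto simp: harmonic_rows_def loops_def)
          have 0: "[row_apply act L (\<psi> (c, h)) x = 0] (mod q)" if "c \<in> C" for c h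
          proof -
            have "\<theta> x \<one> = \<one>" using x by (rule theta_one)
            then have "[\<phi> c (\<theta> x (word_prod G s w)) + val h (act x (word_prod G s w)) - val h x = 0] (mod q)"
              using hom1[OF that] x by (simp add: w(3) act_one)
            then show ?thesis using path[OF that w(2) x, of h] unfolding w(1) by (rule cong_trans[rotated])
          qed
          show ?thesis unfolding bc ac by (rule cong_trans[OF 0[OF cc(1)] cong_sym[OF 0[OF cc(2)]]])
        qed
        then have "[row_apply act L (\<psi> b) x - row_apply act L (\<psi> a) x = 0] (mod q)"
          by (simp add: cong_diff_iff_cong_0)
        with ra[of L x] have "[row_apply act L z x = 0] (mod q)" by (rule cong_trans)
        then show ?thesis by (simp add: cong_0_iff)
      qed
      moreover have "z e \<in> {0..<int p}" for e using q by (simp add: b(2) D_def q_def)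
      moreover have "z e = 0" if "e \<notin> X \<times> {..<d}" for e
        using that by (cases e) (auto simp: b(2) D_def \<psi>_def)
      ultimately show "z \<in> S" by (auto simp: S_def q_def)
    qed
    moreover have "inj_on D A"
    proof (rule inj_onI)
      fix b b' assume b: "b \<in> A" "b' \<in> A" and eq: "D b = D b'"
      obtain c h where bc: "b = (c, h)" by (cases b)
      obtain c' h' where bc': "b' = (c', h')" by (cases b')
      have cc: "c \<in> C" "c' \<in> C" "h \<in> H" "h' \<in> H" using b bc bc' by (auto simp: A_def)
      have "[\<psi> b e = \<psi> b' e] (mod q)" for e
      proof -
        have "[\<psi> b e - \<psi> a e = \<psi> b' e - \<psi> a e] (mod q)" using fun_cong[OF eq, of e] by (simp add: D_def cong_def)
        then show ?thesis by (simp add: cong_iff_dvd_diff)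
      qed
      then have rr: "[row_apply act L (\<psi> b) x = row_apply act L (\<psi> b') x] (mod q)" for L x
        by (rule row_apply_cong_mod)
      have pp: "[\<phi> c (\<theta> x0 (word_prod G s w)) + val h (act x0 (word_prod G s w)) - val h x0
          = \<phi> c' (\<theta> x0 (word_prod G s w)) + val h' (act x0 (word_prod G s w)) - val h' x0] (mod q)"
        if w: "set w \<subseteq> {..<d}" for w
        using cong_trans[OF cong_trans[OF cong_sym[OF path[OF cc(1) w X(2), of h]] rr[of "path_row G s w" x0, unfolded bc bc']]
            path[OF cc(2) w X(2), of h']] .
      have "c = c'"
      proof (rule inj[OF cc(1,2)])
        fix g assume g: "g \<in> N"
        have gG: "g \<in> carrier G" "act x0 g = x0" using g by (auto simp: N)
        obtain g' where g': "g' \<in> carrier G" "act x0 g' = x0" "\<theta> x0 g' = g" using theta_onto[OF gG] by blast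
        obtain w where "set w \<subseteq> {..<d}" "word_prod G s w = g'" using gen[OF g'(1)] by blast
        then show "[\<phi> c g = \<phi> c' g] (mod int p)"
          using pp[of w] g'(2,3) by (simp add: val_def q_def)
      qed
      have "h x = h' x" if x: "x \<in> X - {x0}" for x
      proof -
        obtain g where g: "g \<in> carrier G" "act x0 g = x" using X(3) x by blast
        obtain w where w: "set w \<subseteq> {..<d}" "word_prod G s w = g" using gen[OF g(1)] by blast
        have "[val h x = val h' x] (mod q)"
          using pp[OF w(1)] \<open>c = c'\<close> by (simp add: w(2) g(2) val_def[of _ x0] cong_add_lcancel)
        then have "[h x = h' x] (mod q)" using x by (simp add: val_def)
        then show ?thesis
          using cc(3,4) x by (intro cong_less_imp_eq_int[of "h x" q "h' x"]) (auto simp: H_def PiE_iff)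
      qed
      then have "h = h'" using cc(3,4) unfolding H_def by (intro PiE_ext[of h "X - {x0}" "\<lambda>_. {0..<q}" h']) auto
      then show "b = b'" using \<open>c = c'\<close> bc bc' by simp
    qed
    ultimately have "card A \<le> card S" using S by (intro card_inj_on_le)
    then show ?thesis using CA by simp
  qed
qed

end

section \<open>Betti numbers over prime fields and homomorphisms\<close>

context group_in_ring
begin

lemma homology_class_zero: "homology_class (\<lambda>x. \<zero>\<^bsub>R\<^esub>) = boundaries"
proof -
  interpret B: abelian_subgroup boundaries cycle_module by (rule abelian_subgroup_boundaries)
  show ?thesis
    unfolding homology_class_def using B.a_rcos_const[OF boundaries_zero] .
qed

lemma homology_vectorspace:
  assumes "field R" shows "vectorspace R (group_homology G R \<rho> 1)"
proof -
  let ?V = "group_homology G R \<rho> 1"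
  have V: thesis if "v \<in> carrier ?V" "\<And>c. c \<in> bar_cycles G R \<rho> 1 \<Longrightarrow> v = homology_class c \<Longrightarrow> thesis" for v thesis
    using that unfolding homology_simps by blast
  have VI: "homology_class c \<in> carrier ?V" if "c \<in> bar_cycles G R \<rho> 1" for c
    using that unfolding homology_simps by blast
  have cl: "c x \<in> carrier R" if "c \<in> bar_cycles G R \<rho> 1" for c x
    using chain_closed[OF cycle_chain[OF that]] .
  show ?thesis
  proof (rule vs_criteria[OF assms]; (intro allI ballI impI)?)
    show "\<zero>\<^bsub>?V\<^esub> \<in> carrier ?V"
      unfolding homology_simps(2) homology_class_zero[symmetric] by (rule VI[OF cycle_zero])
  next
    fix v w assume vw: "v \<in> carrier ?V \<and> w \<in> carrier ?V"
    obtain c where c: "c \<in> bar_cycles G R \<rho> 1" "v = homology_class c" by (rule V[OF conjunct1[OF vw]])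
    obtain e where e: "e \<in> bar_cycles G R \<rho> 1" "w = homology_class e" by (rule V[OF conjunct2[OF vw]])
    note ce = c e
    show "v \<oplus>\<^bsub>?V\<^esub> w \<in> carrier ?V" using ce by (simp add: homology_class_add VI cycle_add)
    have "(\<lambda>x. c x \<oplus>\<^bsub>R\<^esub> e x) = (\<lambda>x. e x \<oplus>\<^bsub>R\<^esub> c x)" using cl ce by (auto simp: a_comm)
    then show "v \<oplus>\<^bsub>?V\<^esub> w = w \<oplus>\<^bsub>?V\<^esub> v" using ce by (simp add: homology_class_add)
  next
    fix v assume v: "v \<in> carrier ?V"
    obtain c where c: "c \<in> bar_cycles G R \<rho> 1" "v = homology_class c" by (rule V[OF v])
    have nc: "(\<lambda>x. \<ominus>\<^bsub>R\<^esub> \<one>\<^bsub>R\<^esub> \<otimes>\<^bsub>R\<^esub> c x) \<in> bar_cycles G R \<rho> 1" by (rule cycle_smult[OF _ c(1)]) simp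
    have "(\<lambda>x. c x \<oplus>\<^bsub>R\<^esub> \<ominus>\<^bsub>R\<^esub> \<one>\<^bsub>R\<^esub> \<otimes>\<^bsub>R\<^esub> c x) = (\<lambda>x. \<zero>\<^bsub>R\<^esub>)" using cl[OF c(1)] by (auto simp: l_minus r_neg)
    then show "\<exists>w\<in>carrier ?V. v \<oplus>\<^bsub>?V\<^esub> w = \<zero>\<^bsub>?V\<^esub>"
      using c nc by (intro bexI[OF _ VI[OF nc]]) (simp add: homology_class_add homology_simps(2) homology_class_zero)
    show "v \<oplus>\<^bsub>?V\<^esub> \<zero>\<^bsub>?V\<^esub> = v"
      unfolding homology_simps(2) homology_class_zero[symmetric]
      using c cl[OF c(1)] by (simp add: homology_class_add cycle_zero)
    show "\<one>\<^bsub>R\<^esub> \<odot>\<^bsub>?V\<^esub> v = v" using c cl[OF c(1)] by (simp add: homology_class_smult)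
  next
    fix r v assume rv: "r \<in> carrier R \<and> v \<in> carrier ?V"
    obtain c where c: "c \<in> bar_cycles G R \<rho> 1" "v = homology_class c" by (rule V[OF conjunct2[OF rv]])
    show "r \<odot>\<^bsub>?V\<^esub> v \<in> carrier ?V" using c conjunct1[OF rv] by (simp add: homology_class_smult VI cycle_smult)
  next
    fix v w u assume vwu: "v \<in> carrier ?V \<and> w \<in> carrier ?V \<and> u \<in> carrier ?V"
    obtain c where c: "c \<in> bar_cycles G R \<rho> 1" "v = homology_class c" by (rule V[OF conjunct1[OF vwu]])
    obtain e where e: "e \<in> bar_cycles G R \<rho> 1" "w = homology_class e" by (rule V[OF conjunct1[OF conjunct2[OF vwu]]])
    obtain f where f: "f \<in> bar_cycles G R \<rho> 1" "u = homology_class f" by (rule V[OF conjunct2[OF conjunct2[OF vwu]]])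
    note ce = c e f
    then show "v \<oplus>\<^bsub>?V\<^esub> w \<oplus>\<^bsub>?V\<^esub> u = v \<oplus>\<^bsub>?V\<^esub> (w \<oplus>\<^bsub>?V\<^esub> u)"
      using cl by (simp add: homology_class_add cycle_add a_assoc)
  next
    fix a b v assume abv: "a \<in> carrier R \<and> b \<in> carrier R \<and> v \<in> carrier ?V"
    obtain c' where c': "c' \<in> bar_cycles G R \<rho> 1" "v = homology_class c'" by (rule V[OF conjunct2[OF conjunct2[OF abv]]])
    note c = c' conjunct1[OF abv] conjunct1[OF conjunct2[OF abv]]
    show "(a \<otimes>\<^bsub>R\<^esub> b) \<odot>\<^bsub>?V\<^esub> v = a \<odot>\<^bsub>?V\<^esub> (b \<odot>\<^bsub>?V\<^esub> v)"
      using c cl by (simp add: homology_class_smult cycle_smult m_assoc)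
    show "(a \<oplus>\<^bsub>R\<^esub> b) \<odot>\<^bsub>?V\<^esub> v = a \<odot>\<^bsub>?V\<^esub> v \<oplus>\<^bsub>?V\<^esub> b \<odot>\<^bsub>?V\<^esub> v"
      using c cl by (simp add: homology_class_smult homology_class_add cycle_smult l_distr)
  next
    fix a v w assume avw: "a \<in> carrier R \<and> v \<in> carrier ?V \<and> w \<in> carrier ?V"
    obtain c where c: "c \<in> bar_cycles G R \<rho> 1" "v = homology_class c" by (rule V[OF conjunct1[OF conjunct2[OF avw]]])
    obtain e where e: "e \<in> bar_cycles G R \<rho> 1" "w = homology_class e" by (rule V[OF conjunct2[OF conjunct2[OF avw]]])
    note ce = c e conjunct1[OF avw]
    then show "a \<odot>\<^bsub>?V\<^esub> (v \<oplus>\<^bsub>?V\<^esub> w) = a \<odot>\<^bsub>?V\<^esub> v \<oplus>\<^bsub>?V\<^esub> a \<odot>\<^bsub>?V\<^esub> w"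
      using cl by (simp add: homology_class_smult homology_class_add cycle_smult cycle_add r_distr)
  qed
qed

definition unit_chain :: "'g \<Rightarrow> 'g list \<Rightarrow> 'r" where
  "unit_chain g l = (if l = [g] then \<one>\<^bsub>R\<^esub> else \<zero>\<^bsub>R\<^esub>)"

lemma unit_chain_chain: "g \<in> carrier G \<Longrightarrow> unit_chain g \<in> carrier (bchains 1)"
  by (rule chainI[of _ "{[g]}"]) (auto simp: unit_chain_def split: if_splits)

text \<open>
  Chains are built from the symbols \<open>[g]\<close> one at a time, so that a statement about classes need be
  checked only on classes of symbols.
\<close>

lemma chain1_induct:
  assumes c: "c \<in> carrier (bchains 1)" and zero: "P (\<lambda>l. \<zero>\<^bsub>R\<^esub>)"
    and step: "\<And>c r g. c \<in> carrier (bchains 1) \<Longrightarrow> P c \<Longrightarrow> r \<in> carrier R \<Longrightarrow> g \<in> carrier G \<Longrightarrow>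
      P (\<lambda>l. c l \<oplus>\<^bsub>R\<^esub> r \<otimes>\<^bsub>R\<^esub> unit_chain g l)"
  shows "P c"
  using c
proof (induction "card {x. c x \<noteq> \<zero>\<^bsub>R\<^esub>}" arbitrary: c)
  case 0
  then have "{x. c x \<noteq> \<zero>\<^bsub>R\<^esub>} = {}" using chain_finite[OF 0(2)] by auto
  then have "c = (\<lambda>l. \<zero>\<^bsub>R\<^esub>)" by auto
  then show ?case using zero by simp
next
  case (Suc n)
  have "{x. c x \<noteq> \<zero>\<^bsub>R\<^esub>} \<noteq> {}" using Suc.hyps(2) by (metis card.empty nat.distinct(1))
  then obtain x where x: "c x \<noteq> \<zero>\<^bsub>R\<^esub>" by blast
  obtain g where g: "x = [g]" "g \<in> carrier G" using chain1_cases[OF Suc.prems x] .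
  define c' where "c' = c(x := \<zero>\<^bsub>R\<^esub>)"
  have supp: "{y. c' y \<noteq> \<zero>\<^bsub>R\<^esub>} = {y. c y \<noteq> \<zero>\<^bsub>R\<^esub>} - {x}" by (auto simp: c'_def)
  have cl: "c y \<in> carrier R" for y by (rule chain_closed[OF Suc.prems])
  have c': "c' \<in> carrier (bchains 1)"
  proof (rule chainI[of _ "{y. c y \<noteq> \<zero>\<^bsub>R\<^esub>}"])
    show "length y = 1 \<and> set y \<subseteq> carrier G" if "y \<in> {y. c y \<noteq> \<zero>\<^bsub>R\<^esub>}" for y
      using that chain_support[OF Suc.prems] by blast
  qed (use cl chain_finite[OF Suc.prems] in \<open>auto simp: c'_def split: if_splits\<close>)
  have "n = card {y. c' y \<noteq> \<zero>\<^bsub>R\<^esub>}"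
    unfolding supp using Suc.hyps(2) x chain_finite[OF Suc.prems] by (subst card_Diff_singleton) auto
  from Suc.hyps(1)[OF this c'] have "P c'" .
  then have "P (\<lambda>l. c' l \<oplus>\<^bsub>R\<^esub> c x \<otimes>\<^bsub>R\<^esub> unit_chain g l)" by (rule step[OF c' _ cl g(2)])
  moreover have "(\<lambda>l. c' l \<oplus>\<^bsub>R\<^esub> c x \<otimes>\<^bsub>R\<^esub> unit_chain g l) = c"
    using cl by (auto simp: c'_def unit_chain_def g(1))
  ultimately show ?case by simp
qed

lemma trivial_cycle:
  assumes "\<And>g. \<rho> g = \<one>\<^bsub>R\<^esub>" "c \<in> carrier (bchains 1)"
  shows "c \<in> bar_cycles G R \<rho> 1"
proof -
  have "(\<Oplus>\<^bsub>R\<^esub>x\<in>{x. c x \<noteq> \<zero>\<^bsub>R\<^esub>}. c x \<otimes>\<^bsub>R\<^esub> (\<rho> (hd x) \<ominus>\<^bsub>R\<^esub> \<one>\<^bsub>R\<^esub>)) = (\<Oplus>\<^bsub>R\<^esub>x\<in>{x. c x \<noteq> \<zero>\<^bsub>R\<^esub>}. \<zero>\<^bsub>R\<^esub>)"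
    by (rule finsum_cong') (use chain_closed[OF assms(2)] in \<open>auto simp: assms(1) minus_eq r_neg\<close>)
  then have "bar_boundary G R \<rho> c = (\<lambda>y. \<zero>\<^bsub>R\<^esub>)" by (auto simp: boundary_1[OF assms(2)])
  then show ?thesis using assms(2) by (simp add: bar_cycles_def)
qed

text \<open>
  For trivial coefficients the boundary of \<open>[g, h]\<close> is \<open>[h] - [g h] + [g]\<close>.
\<close>

lemma unit_class_mult:
  assumes triv: "\<And>g. \<rho> g = \<one>\<^bsub>R\<^esub>" and ne: "\<one>\<^bsub>R\<^esub> \<noteq> \<zero>\<^bsub>R\<^esub>" and gh: "g \<in> carrier G" "h \<in> carrier G"
  shows "homology_class (unit_chain (g \<otimes>\<^bsub>G\<^esub> h)) =
    homology_class (unit_chain g) \<oplus>\<^bsub>group_homology G R \<rho> 1\<^esub> homology_class (unit_chain h)"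
proof -
  define c where "c l = (if l = [g, h] then \<one>\<^bsub>R\<^esub> else \<zero>\<^bsub>R\<^esub>)" for l
  have c: "c \<in> carrier (bchains 2)"
    by (rule chainI[of _ "{[g, h]}"]) (auto simp: c_def gh split: if_splits)
  have supp: "{l. c l \<noteq> \<zero>\<^bsub>R\<^esub>} = {[g, h]}" using ne by (auto simp: c_def)
  have cyc: "unit_chain k \<in> bar_cycles G R \<rho> 1" if "k \<in> carrier G" for k
    by (rule trivial_cycle[OF triv unit_chain_chain[OF that]])
  have b: "bar_boundary G R \<rho> c y = bar_coeff G R \<rho> [g, h] y" for y
    unfolding bar_boundary_def supp
    using gh bar_coeff_closed[of "[g, h]" y] by (simp add: c_def)
  have "(\<lambda>x. unit_chain g x \<oplus>\<^bsub>R\<^esub> unit_chain h x) = (\<lambda>x. bar_boundary G R \<rho> c x \<oplus>\<^bsub>R\<^esub> unit_chain (g \<otimes>\<^bsub>G\<^esub> h) x)"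
  proof
    fix x
    define u v where "u = unit_chain g x" and "v = unit_chain h x"
    have uv: "u \<in> carrier R" "v \<in> carrier R" by (auto simp: u_def v_def unit_chain_def)
    have "bar_boundary G R \<rho> c x = v \<oplus>\<^bsub>R\<^esub> ((if x = [g \<otimes>\<^bsub>G\<^esub> h] then \<ominus>\<^bsub>R\<^esub> \<one>\<^bsub>R\<^esub> else \<zero>\<^bsub>R\<^esub>) \<oplus>\<^bsub>R\<^esub> u)"
      unfolding b bar_coeff_2[OF gh] triv u_def v_def unit_chain_def ..
    moreover have "v \<oplus>\<^bsub>R\<^esub> (\<ominus>\<^bsub>R\<^esub> \<one>\<^bsub>R\<^esub> \<oplus>\<^bsub>R\<^esub> u) \<oplus>\<^bsub>R\<^esub> \<one>\<^bsub>R\<^esub> = u \<oplus>\<^bsub>R\<^esub> v"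
    proof -
      have "v \<oplus>\<^bsub>R\<^esub> (\<ominus>\<^bsub>R\<^esub> \<one>\<^bsub>R\<^esub> \<oplus>\<^bsub>R\<^esub> u) \<oplus>\<^bsub>R\<^esub> \<one>\<^bsub>R\<^esub> = (u \<oplus>\<^bsub>R\<^esub> v) \<oplus>\<^bsub>R\<^esub> (\<ominus>\<^bsub>R\<^esub> \<one>\<^bsub>R\<^esub> \<oplus>\<^bsub>R\<^esub> \<one>\<^bsub>R\<^esub>)"
        using uv by (simp add: a_ac del: l_neg r_neg)
      then show ?thesis using uv by (simp add: l_neg)
    qed
    moreover have "v \<oplus>\<^bsub>R\<^esub> (\<zero>\<^bsub>R\<^esub> \<oplus>\<^bsub>R\<^esub> u) \<oplus>\<^bsub>R\<^esub> \<zero>\<^bsub>R\<^esub> = u \<oplus>\<^bsub>R\<^esub> v" using uv by (simp add: a_comm)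
    ultimately have "bar_boundary G R \<rho> c x \<oplus>\<^bsub>R\<^esub> unit_chain (g \<otimes>\<^bsub>G\<^esub> h) x = u \<oplus>\<^bsub>R\<^esub> v"
      by (simp add: unit_chain_def)
    then show "unit_chain g x \<oplus>\<^bsub>R\<^esub> unit_chain h x = bar_boundary G R \<rho> c x \<oplus>\<^bsub>R\<^esub> unit_chain (g \<otimes>\<^bsub>G\<^esub> h) x"
      by (simp add: u_def v_def)
  qed
  then have "homology_class (\<lambda>x. unit_chain g x \<oplus>\<^bsub>R\<^esub> unit_chain h x) = homology_class (unit_chain (g \<otimes>\<^bsub>G\<^esub> h))"
    using gh by (intro homology_class_eqI[OF cyc boundariesI[OF c]]) auto
  then show ?thesis using gh by (simp add: homology_class_add[OF cyc cyc])
qed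

end

text \<open>
  First homology over a field is spanned by the classes of the generators, since the class of \<open>[g]\<close>
  is additive in \<open>g\<close>; so it has a finite basis \<open>A\<close>. A linear functional is given by its values \<open>c\<close> on
  \<open>A\<close>, and composing it with \<open>g \<mapsto> [g]\<close> yields a homomorphism. As the classes of all \<open>[g]\<close> span,
  distinct functionals yield distinct homomorphisms. Homomorphisms to the prime field are rendered
  as integer-valued functions up to congruence.
\<close>

lemma (in group) homs_of_betti_number:
  assumes p: "prime p" and T: "finite T" "T \<subseteq> carrier G" "carrier G \<subseteq> generate G T"
  shows "\<exists>(C :: (('a list \<Rightarrow> int) set \<Rightarrow> int) set) (\<phi> :: (('a list \<Rightarrow> int) set \<Rightarrow> int) \<Rightarrow> 'a \<Rightarrow> int).
    finite C \<and> card C = p ^ betti_number 1 G (residue_ring (int p)) \<and>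
    (\<forall>c\<in>C. \<forall>g\<in>carrier G. \<forall>h\<in>carrier G. [\<phi> c (g \<otimes> h) = \<phi> c g + \<phi> c h] (mod int p)) \<and>
    (\<forall>c\<in>C. \<forall>c'\<in>C. (\<forall>g\<in>carrier G. [\<phi> c g = \<phi> c' g] (mod int p)) \<longrightarrow> c = c')"
proof -
  define R where "R = residue_ring (int p)"
  interpret R: residues_prime p R by unfold_locales (use p in \<open>auto simp: R_def\<close>)
  note Rs = R.res_carrier_eq R.res_add_eq R.res_mult_eq R.res_zero_eq R.res_one_eq
  have p1: "1 < int p" using prime_gt_1_nat[OF p] by simp
  interpret B: group_in_ring G R "\<lambda>_. \<one>\<^bsub>R\<^esub>"
    by unfold_locales auto
  define V where "V = group_homology G R (\<lambda>_. \<one>\<^bsub>R\<^esub>) 1"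
  interpret V: vectorspace R V unfolding V_def by (rule B.homology_vectorspace[OF R.is_field])
  define cl where "cl g = B.homology_class (B.unit_chain g)" for g
  have Vc: "carrier V = B.homology_class ` carrier (B.bchains 1)"
  proof -
    have "bar_cycles G R (\<lambda>_. \<one>\<^bsub>R\<^esub>) 1 = carrier (B.bchains 1)"
      using B.trivial_cycle[OF refl] B.cycle_chain by blast
    then show ?thesis unfolding V_def B.homology_simps by simp
  qed
  have cyc: "c \<in> bar_cycles G R (\<lambda>_. \<one>\<^bsub>R\<^esub>) 1" if "c \<in> carrier (B.bchains 1)" for c
    by (rule B.trivial_cycle[OF refl that])
  have clV: "cl g \<in> carrier V" if "g \<in> carrier G" for g
    unfolding Vc cl_def using B.unit_chain_chain[OF that] by blast
  have ne: "\<one>\<^bsub>R\<^esub> \<noteq> \<zero>\<^bsub>R\<^esub>" by (simp add: Rs)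
  have cl_mult: "cl (g \<otimes> h) = cl g \<oplus>\<^bsub>V\<^esub> cl h" if "g \<in> carrier G" "h \<in> carrier G" for g h
    unfolding cl_def V_def by (rule B.unit_class_mult[OF refl ne that])
  have V_induct: "Q v" if v: "v \<in> carrier V" and zero: "Q \<zero>\<^bsub>V\<^esub>"
    and step: "\<And>v r g. v \<in> carrier V \<Longrightarrow> Q v \<Longrightarrow> r \<in> carrier R \<Longrightarrow> g \<in> carrier G \<Longrightarrow> Q (v \<oplus>\<^bsub>V\<^esub> r \<odot>\<^bsub>V\<^esub> cl g)" for Q v
  proof -
    obtain c where c: "c \<in> carrier (B.bchains 1)" "v = B.homology_class c" using v unfolding Vc by blast
    have "Q (B.homology_class c)"
    proof (rule B.chain1_induct[OF c(1), where P = "\<lambda>c. Q (B.homology_class c)"])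
      show "Q (B.homology_class (\<lambda>l. \<zero>\<^bsub>R\<^esub>))"
        using zero unfolding V_def B.homology_simps(2) B.homology_class_zero .
      fix c r g assume c: "c \<in> carrier (B.bchains 1)" "Q (B.homology_class c)" "r \<in> carrier R" "g \<in> carrier G"
      have ug: "B.unit_chain g \<in> carrier (B.bchains 1)" by (rule B.unit_chain_chain[OF c(4)])
      have "B.homology_class (\<lambda>l. c l \<oplus>\<^bsub>R\<^esub> r \<otimes>\<^bsub>R\<^esub> B.unit_chain g l) = B.homology_class c \<oplus>\<^bsub>V\<^esub> r \<odot>\<^bsub>V\<^esub> cl g"
        unfolding V_def cl_def B.homology_class_smult[OF c(3) cyc[OF ug]]
        by (rule B.homology_class_add[OF cyc[OF c(1)] B.cycle_smult[OF c(3) cyc[OF ug]], symmetric])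
      moreover have "Q (B.homology_class c \<oplus>\<^bsub>V\<^esub> r \<odot>\<^bsub>V\<^esub> cl g)"
        by (rule step) (use c Vc in auto)
      ultimately show "Q (B.homology_class (\<lambda>l. c l \<oplus>\<^bsub>R\<^esub> r \<otimes>\<^bsub>R\<^esub> B.unit_chain g l))" by simp
    qed
    then show ?thesis using c(2) by simp
  qed
  let ?W = "V.span (cl ` T)"
  have clT: "cl ` T \<subseteq> carrier V" using clV T(2) by blast
  interpret W: submodule R ?W V by (rule V.span_is_submodule[OF clT])
  have cl1: "cl \<one> = \<zero>\<^bsub>V\<^esub>"
  proof -
    have "cl \<one> \<oplus>\<^bsub>V\<^esub> cl \<one> = cl \<one>" using cl_mult[of \<one> \<one>] by simp
    then show ?thesis using clV[of \<one>] by (simp add: V.add.l_cancel_one)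
  qed
  have inW: "cl g \<in> ?W \<and> g \<in> carrier G" if "g \<in> generate G T" for g
    using that
  proof (induction rule: generate.induct)
    case one then show ?case by (simp add: cl1)
  next
    case (incl h) then show ?case using V.in_own_span[OF clT] T(2) by blast
  next
    case (inv h)
    then have h: "h \<in> carrier G" "cl h \<in> ?W" using V.in_own_span[OF clT] T(2) by auto
    have "cl h \<oplus>\<^bsub>V\<^esub> cl (inv h) = \<zero>\<^bsub>V\<^esub>" using cl_mult[of h "inv h"] h cl1 by simp
    then have "cl (inv h) = \<ominus>\<^bsub>V\<^esub> cl h"
      using clV[OF h(1)] clV[of "inv h"] h(1) by (metis V.a_comm V.minus_equality inv_closed)
    also have "\<dots> = (\<ominus>\<^bsub>R\<^esub> \<one>\<^bsub>R\<^esub>) \<odot>\<^bsub>V\<^esub> cl h"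
      using clV[OF h(1)] by (simp add: V.smult_l_minus)
    finally show ?case using h by simp
  next
    case (eng h1 h2) then show ?case by (simp add: cl_mult)
  qed
  have "V.gen_set (cl ` T)"
  proof
    show "?W \<subseteq> carrier V" by (rule W.subset)
    show "carrier V \<subseteq> ?W"
    proof
      fix v assume "v \<in> carrier V"
      then show "v \<in> ?W"
        by (rule V_induct) (use inW T(3) in auto)
    qed
  qed
  then have "V.fin_dim" unfolding V.fin_dim_def using T(1) clT by blast
  then obtain A where A: "finite A" "V.basis A" using V.finite_basis_exists by blast
  have dim: "betti_number 1 G (residue_ring (int p)) = card A"
    using V.dim_basis[OF A] by (simp add: betti_number_def V_def R_def del: One_nat_def)
  have AV: "A \<subseteq> carrier V" using A(2) by (simp add: V.basis_def)
  have ex1: "\<exists>!a. a \<in> A \<rightarrow>\<^sub>E carrier R \<and> V.lincomb a A = v" if "v \<in> carrier V" for v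
    using V.basis_criterion[OF A(1) AV] A(2) that by blast
  define co where "co v = (THE a. a \<in> A \<rightarrow>\<^sub>E carrier R \<and> V.lincomb a A = v)" for v
  have co: "co v \<in> A \<rightarrow>\<^sub>E carrier R" "V.lincomb (co v) A = v" if "v \<in> carrier V" for v
    using theI'[OF ex1[OF that]] by (simp_all add: co_def)
  have co_eq: "co v x = a x" if a: "a \<in> A \<rightarrow> carrier R" "V.lincomb a A = v" and v: "v \<in> carrier V" and x: "x \<in> A" for v a x
  proof -
    have "restrict a A \<in> A \<rightarrow>\<^sub>E carrier R" using a(1) by auto
    moreover have "V.lincomb (restrict a A) A = v"
      using a AV unfolding V.lincomb_def by (subst a(2)[symmetric], unfold V.lincomb_def, intro V.finsum_cong') auto
    ultimately have "co v = restrict a A" using ex1[OF v] co[OF v] by blast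
    then show ?thesis using x by simp
  qed
  have coR: "co v x \<in> carrier R" if "v \<in> carrier V" "x \<in> A" for v x using co(1)[OF that(1)] that(2) by auto
  have co_add: "co (v \<oplus>\<^bsub>V\<^esub> w) x = (co v x + co w x) mod int p" if "v \<in> carrier V" "w \<in> carrier V" "x \<in> A" for v w x
  proof -
    have "co (v \<oplus>\<^bsub>V\<^esub> w) x = co v x \<oplus>\<^bsub>R\<^esub> co w x"
      by (rule co_eq[of "\<lambda>x. co v x \<oplus>\<^bsub>R\<^esub> co w x"])
         (use that coR co V.lincomb_sum[OF A(1) AV, of "co v" "co w"] in \<open>auto simp: PiE_iff\<close>)
    then show ?thesis by (simp add: Rs)
  qed
  have co_smult: "co (r \<odot>\<^bsub>V\<^esub> v) x = (r * co v x) mod int p" if "r \<in> carrier R" "v \<in> carrier V" "x \<in> A" for r v x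
  proof -
    have "co (r \<odot>\<^bsub>V\<^esub> v) x = r \<otimes>\<^bsub>R\<^esub> co v x"
      by (rule co_eq[of "\<lambda>x. r \<otimes>\<^bsub>R\<^esub> co v x"])
         (use that coR co V.lincomb_smult[OF AV, of "co v" r] in \<open>auto simp: PiE_iff\<close>)
    then show ?thesis by (simp add: Rs)
  qed
  have co_basis: "co a x = (if x = a then 1 else 0)" if "a \<in> A" "x \<in> A" for a x
  proof -
    have aV: "a \<in> carrier V" using that AV by blast
    have "V.lincomb (\<lambda>x. if x = a then \<one>\<^bsub>R\<^esub> else \<zero>\<^bsub>R\<^esub>) A = (\<Oplus>\<^bsub>V\<^esub>x\<in>A. if x = a then x else \<zero>\<^bsub>V\<^esub>)"
      unfolding V.lincomb_def by (rule V.finsum_cong') (use AV in auto)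
    also have "\<dots> = a"
      using V.add.finprod_singleton_swap[OF that(1) A(1), of "\<lambda>x. x"] AV by auto
    finally have "co a x = (if x = a then \<one>\<^bsub>R\<^esub> else \<zero>\<^bsub>R\<^esub>)"
      by (intro co_eq[of "\<lambda>x. if x = a then \<one>\<^bsub>R\<^esub> else \<zero>\<^bsub>R\<^esub>"] aV that(2)) auto
    then show ?thesis by (simp add: Rs)
  qed
  define C where "C = (A \<rightarrow>\<^sub>E {0..<int p})"
  define \<phi> where "\<phi> c g = (\<Sum>a\<in>A. co (cl g) a * c a)" for c g
  have cardC: "card C = p ^ card A" unfolding C_def using A(1) by (subst card_PiE) auto
  have finC: "finite C" unfolding C_def using A(1) by (intro finite_PiE) auto
  have hom: "[\<phi> c (g \<otimes> h) = \<phi> c g + \<phi> c h] (mod int p)" if "g \<in> carrier G" "h \<in> carrier G" for c g h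
  proof -
    have "[\<phi> c (g \<otimes> h) = (\<Sum>a\<in>A. (co (cl g) a + co (cl h) a) * c a)] (mod int p)"
      unfolding \<phi>_def
    proof (rule cong_sum, rule cong_mult[OF _ cong_refl])
      fix a assume a: "a \<in> A"
      show "[co (cl (g \<otimes> h)) a = co (cl g) a + co (cl h) a] (mod int p)"
        unfolding cl_mult[OF that] co_add[OF clV[OF that(1)] clV[OF that(2)] a] by simp
    qed
    then show ?thesis by (simp add: \<phi>_def distrib_right sum.distrib)
  qed
  have inj: "c = c'" if c: "c \<in> C" "c' \<in> C" and eq: "\<And>g. g \<in> carrier G \<Longrightarrow> [\<phi> c g = \<phi> c' g] (mod int p)" for c c'
  proof -
    define L where "L v = (\<Sum>a\<in>A. co v a * (c a - c' a))" for v
    have "[L v = 0] (mod int p)" if "v \<in> carrier V" for v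
      using that
    proof (rule V_induct)
      have "co \<zero>\<^bsub>V\<^esub> a = 0" if "a \<in> A" for a
        using co_smult[OF R.zero_closed V.zero_closed that]
        unfolding V.smult_r_null[OF R.zero_closed] by (simp add: R.res_zero_eq)
      then show "[L \<zero>\<^bsub>V\<^esub> = 0] (mod int p)" by (simp add: L_def)
      fix v r g assume v: "v \<in> carrier V" "[L v = 0] (mod int p)" "r \<in> carrier R" "g \<in> carrier G"
      have "[L (v \<oplus>\<^bsub>V\<^esub> r \<odot>\<^bsub>V\<^esub> cl g) = (\<Sum>a\<in>A. (co v a + r * co (cl g) a) * (c a - c' a))] (mod int p)"
        unfolding L_def
      proof (rule cong_sum, rule cong_mult[OF _ cong_refl])
        fix a assume a: "a \<in> A"
        have "[co v a + (r * co (cl g) a) mod int p = co v a + r * co (cl g) a] (mod int p)"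
          by (intro cong_add cong_refl) simp
        then show "[co (v \<oplus>\<^bsub>V\<^esub> r \<odot>\<^bsub>V\<^esub> cl g) a = co v a + r * co (cl g) a] (mod int p)"
          using v clV[OF v(4)] a by (simp add: co_add co_smult)
      qed
      also have "(\<Sum>a\<in>A. (co v a + r * co (cl g) a) * (c a - c' a)) = L v + r * (\<phi> c g - \<phi> c' g)"
        by (simp add: L_def \<phi>_def distrib_right sum.distrib sum_distrib_left right_diff_distrib sum_subtractf algebra_simps)
      also have "[\<dots> = 0 + r * 0] (mod int p)"
        by (intro cong_add cong_mult v cong_refl) (use eq[OF v(4)] in \<open>simp add: cong_diff_iff_cong_0\<close>)
      finally show "[L (v \<oplus>\<^bsub>V\<^esub> r \<odot>\<^bsub>V\<^esub> cl g) = 0] (mod int p)" by simp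
    qed
    then have L: "[L a = 0] (mod int p)" if "a \<in> A" for a using that AV by blast
    have "c a = c' a" if a: "a \<in> A" for a
    proof -
      have "L a = (\<Sum>x\<in>A. if x = a then c a - c' a else 0)"
        unfolding L_def by (rule sum.cong) (auto simp: co_basis[OF a])
      also have "\<dots> = c a - c' a" using A(1) a by simp
      finally have "[c a = c' a] (mod int p)" using L[OF a] by (simp add: cong_diff_iff_cong_0)
      then show ?thesis
        using c a by (intro cong_less_imp_eq_int[of "c a" "int p" "c' a"]) (auto simp: C_def PiE_iff)
    qed
    then show ?thesis using c unfolding C_def by (intro PiE_ext[of c A "\<lambda>_. {0..<int p}" c']) auto
  qed
  show ?thesis
    by (rule exI[of _ C], rule exI[of _ \<phi>]) (use finC cardC dim hom inj in auto)
qed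

section \<open>Approximation\<close>

context right_action
begin

text \<open>
  Schreier's lemma: by the cocycle rule the finitely many \<open>\<theta> x (s i)\<close> generate all values of \<open>\<theta>\<close>.
\<close>

lemma stabilizer_finitely_generated:
  fixes s :: "nat \<Rightarrow> 'g" and d :: nat
  assumes s: "\<And>i. i < d \<Longrightarrow> s i \<in> carrier G"
    and gen: "\<And>g. g \<in> carrier G \<Longrightarrow> \<exists>w. set w \<subseteq> {..<d} \<and> word_prod G s w = g"
    and X: "finite X" "x0 \<in> X" "\<And>x. x \<in> X \<Longrightarrow> \<exists>g\<in>carrier G. act x0 g = x"
    and N: "N = {g \<in> carrier G. act x0 g = x0}"
  shows "\<exists>T. finite T \<and> T \<subseteq> N \<and> N \<subseteq> generate (G\<lparr>carrier := N\<rparr>) T"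
proof -
  from stabilizer_cocycle[OF X(2,3), folded N] obtain \<theta> where
    *: "(\<forall>x\<in>X. \<forall>g\<in>carrier G. \<theta> x g \<in> N) \<and>
      (\<forall>x\<in>X. \<forall>g\<in>carrier G. \<forall>h\<in>carrier G. \<theta> x (g \<otimes> h) = \<theta> x g \<otimes> \<theta> (act x g) h) \<and>
      (\<forall>x\<in>X. \<theta> x \<one> = \<one>) \<and>
      (\<forall>g\<in>carrier G. act x0 g = x0 \<longrightarrow> (\<exists>g'\<in>carrier G. act x0 g' = x0 \<and> \<theta> x0 g' = g))"
    by (rule exE)
  have theta: "\<theta> x g \<in> N" if "x \<in> X" "g \<in> carrier G" for x g using * that by simp
  have theta_mult: "\<theta> x (g \<otimes> h) = \<theta> x g \<otimes> \<theta> (act x g) h"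
    if "x \<in> X" "g \<in> carrier G" "h \<in> carrier G" for x g h using * that by simp
  have theta_one: "\<theta> x \<one> = \<one>" if "x \<in> X" for x using * that by simp
  have theta_onto: "\<exists>g'\<in>carrier G. act x0 g' = x0 \<and> \<theta> x0 g' = g"
    if "g \<in> carrier G" "act x0 g = x0" for g using * that by simp
  let ?T = "(\<lambda>(x, i). \<theta> x (s i)) ` (X \<times> {..<d})"
  have "\<theta> x (word_prod G s w) \<in> generate (G\<lparr>carrier := N\<rparr>) ?T" if "set w \<subseteq> {..<d}" "x \<in> X" for w x
    using that
  proof (induction w arbitrary: x)
    case Nil
    then show ?case using generate.one[of "G\<lparr>carrier := N\<rparr>" ?T] by (simp add: theta_one)
  next
    case (Cons i w)
    then have i: "i < d" and w: "set w \<subseteq> {..<d}" and x: "x \<in> X" by auto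
    have "\<theta> x (s i) \<in> ?T" using i x by force
    then have 1: "\<theta> x (s i) \<in> generate (G\<lparr>carrier := N\<rparr>) ?T" by (rule generate.incl)
    have 2: "\<theta> (act x (s i)) (word_prod G s w) \<in> generate (G\<lparr>carrier := N\<rparr>) ?T"
      by (rule Cons.IH[OF w act_closed[OF x s[OF i]]])
    show ?case
      using generate.eng[OF 1 2] theta_mult[OF x s[OF i] word_prod_closed[where d = d, OF s w]] by simp
  qed
  then have "N \<subseteq> generate (G\<lparr>carrier := N\<rparr>) ?T"
    using theta_onto gen X(2) unfolding N by blast
  moreover have "?T \<subseteq> N" using theta s by auto
  moreover have "finite ?T" using X(1) by simp
  ultimately show ?thesis by blast
qed

text \<open>
  Comparing \<open>p\<^sup>b \<le> |S| \<le> l\<^bsup>|E|\<^esup> p\<^bsup>|J|\<^esup>\<close>, where \<open>S\<close> is the set of harmonic cochains modulo \<open>p\<close>, with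
  \<open>|J| \<le> |X| \<tau>\<close>, which holds because the heat step fixes the real harmonic cochains and has the same
  diagonal entries as on the group.
\<close>

lemma betti_number_bound:
  fixes s :: "nat \<Rightarrow> 'g" and d m k p l :: nat
  assumes s: "\<And>i. i < d \<Longrightarrow> s i \<in> carrier G"
    and gen: "\<And>g. g \<in> carrier G \<Longrightarrow> \<exists>w. set w \<subseteq> {..<d} \<and> word_prod G s w = g"
    and X: "finite X" "x0 \<in> X" "\<And>x. x \<in> X \<Longrightarrow> \<exists>g\<in>carrier G. act x0 g = x"
    and N: "N = {g \<in> carrier G. act x0 g = x0}" "subgroup N G"
    and p: "prime p"
    and l: "l > 0" "\<And>L. L \<in> harmonic_rows G s d m \<Longrightarrow> (\<Sum>(i, c, g)\<leftarrow>L. \<bar>c\<bar>) \<le> int l"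
    and free: "\<And>x h. x \<in> X \<Longrightarrow> h \<in> propagation G (harmonic_rows G s d m) (2 * k) \<Longrightarrow> act x h = x \<Longrightarrow> h = \<one>"
  defines "\<tau> \<equiv> (\<Sum>i<d. (norm ((heat_step G (carrier G) (\<lambda>x g. x \<otimes> g) (harmonic_rows G s d m) ^^ k)
      (unit_vec (\<one>, i))))\<^sup>2)"
  shows "real (betti_number 1 (G\<lparr>carrier := N\<rparr>) (residue_ring (int p))) * ln (real p)
    \<le> real (card X) * (real d * ln (real l) + \<tau> * ln (real p))"
proof -
  let ?rs = "harmonic_rows G s d m"
  let ?E = "X \<times> {..<d}"
  let ?T = "heat_step G X act ?rs"
  let ?b = "betti_number 1 (G\<lparr>carrier := N\<rparr>) (residue_ring (int p))"
  note fin = finite_harmonic_rows[of G s d m]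
  have val: "valid_row G d L" if "L \<in> ?rs" for L
    by (rule valid_harmonic_rows[OF s that])
  have finE: "finite ?E" using X(1) by simp
  define K :: "('x \<times> nat \<Rightarrow> real) set" where
    "K = {z. (\<forall>e. e \<notin> ?E \<longrightarrow> z e = 0) \<and> (\<forall>L\<in>?rs. \<forall>x\<in>X. row_apply act L z x = 0)}"
  have lin: "row_apply act L (\<lambda>e. z e + a * w e) x = row_apply act L z x + a * row_apply act L w x"
    for L x a and z w :: "'x \<times> nat \<Rightarrow> real"
    unfolding row_apply_def by (induction L) (auto simp: algebra_simps)
  have "\<exists>J v. J \<subseteq> ?E \<and> (\<forall>j\<in>J. v j \<in> K) \<and>
    (\<forall>i\<in>J. \<forall>j\<in>J. (\<Sum>e\<in>?E. v i e * v j e) = (if i = j then 1 else 0)) \<and>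
    (\<forall>z\<in>K. (\<forall>j\<in>J. z j = 0) \<longrightarrow> z = (\<lambda>e. 0))"
    by (rule orthonormal_coordinates[OF finE]) (auto simp: K_def lin)
  then obtain J v where *: "J \<subseteq> ?E \<and> (\<forall>j\<in>J. v j \<in> K) \<and>
    (\<forall>i\<in>J. \<forall>j\<in>J. (\<Sum>e\<in>?E. v i e * v j e) = (if i = j then 1 else 0)) \<and>
    (\<forall>z\<in>K. (\<forall>j\<in>J. z j = 0) \<longrightarrow> z = (\<lambda>e. 0))"
    by (elim exE)
  have J: "J \<subseteq> ?E" using * by (elim conjE)
  have vK: "v j \<in> K" if "j \<in> J" for j using * that by (elim conjE) (rule bspec)
  have orth: "(\<Sum>e\<in>?E. v i e * v j e) = (if i = j then 1 else 0)" if "i \<in> J" "j \<in> J" for i j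
    using * that by (elim conjE) (drule bspec, assumption, erule bspec)
  have injK: "z = (\<lambda>e. 0)" if "z \<in> K" "\<And>j. j \<in> J \<Longrightarrow> z j = 0" for z
    using * that(1) that(2) by metis
  have fixed: "?T (Ell2 (\<lambda>e. of_real (v j e))) = Ell2 (\<lambda>e. of_real (v j e))" if j: "j \<in> J" for j
  proof -
    have c: "coord (Ell2 (\<lambda>e. complex_of_real (v j e))) = (\<lambda>e. of_real (v j e))"
    proof (rule coord_Ell2, rule finite_nonzero_values_imp_summable_on)
      show "finite {x \<in> UNIV. (cmod (complex_of_real (v j x)))\<^sup>2 \<noteq> 0}"
        by (rule finite_subset[OF _ finE]) (use vK[OF j] in \<open>auto simp: K_def\<close>)
    qed
    show ?thesis
    proof (rule iffD2[OF heat_step_fixed_iff[OF fin val]])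
      show "\<forall>L\<in>?rs. row_op X act L (Ell2 (\<lambda>e. of_real (v j e))) = 0"
      proof
      fix L assume L: "L \<in> ?rs"
      show "row_op X act L (Ell2 (\<lambda>e. of_real (v j e))) = 0"
      proof (rule ell2_eqI)
        fix x
        have "row_apply act L (v j) x = 0" if "x \<in> X" using vK[OF j] L that by (simp add: K_def)
        then show "coord (row_op X act L (Ell2 (\<lambda>e. of_real (v j e)))) x = coord 0 x"
          unfolding coord_row_op[OF val[OF L]] c row_apply_of_real by simp
      qed
      qed
    qed
  qed
  have "real (card J) \<le> (\<Sum>e\<in>?E. (norm ((?T ^^ k) (unit_vec e)))\<^sup>2)"
  proof (rule card_fixed_orthonormal_le[OF finE J _ orth])
    show "v j e = 0" if "j \<in> J" "e \<notin> ?E" for j e using vK[OF that(1)] that(2) unfolding K_def by blast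
    show "(?T ^^ k) x \<bullet> y = x \<bullet> (?T ^^ k) y" for x y
      by (rule funpow_symmetric[OF heat_step_symmetric[OF fin val]])
    show "(?T ^^ k) (Ell2 (\<lambda>e. of_real (v j e))) = Ell2 (\<lambda>e. of_real (v j e))" if "j \<in> J" for j
      using fixed[OF that] by (induction k) simp_all
  qed
  also have "\<dots> = (\<Sum>x\<in>X. \<Sum>i<d. (norm ((?T ^^ k) (unit_vec (x, i))))\<^sup>2)"
    by (subst sum.cartesian_product) (simp add: case_prod_unfold)
  also have "\<dots> = (\<Sum>x\<in>X. \<tau>)"
    unfolding \<tau>_def
    by (intro sum.cong refl) (rule heat_power_diagonal[OF fin val _ free], assumption+)
  finally have cardJ: "real (card J) \<le> real (card X) * \<tau>" by simp
  let ?B = "?rs \<times> X"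
  let ?lam = "\<lambda>r z. row_apply act (fst r) z (snd r) :: int"
  define S where "S = {z. (\<forall>e\<in>?E. z e \<in> {0..<int p}) \<and> (\<forall>e. e \<notin> ?E \<longrightarrow> z e = 0) \<and> (\<forall>r\<in>?B. int p dvd ?lam r z)}"
  have p0: "p > 0" using p by (rule prime_gt_0_nat)
  have diff: "?lam r (\<lambda>e. z e - w e) = ?lam r z - ?lam r w" for r z w by (rule row_apply_diff)
  have bound: "\<bar>?lam r z\<bar> \<le> int l * R" if r: "r \<in> ?B" and z: "\<And>e. \<bar>z e\<bar> \<le> R" for r z R
  proof -
    have "\<bar>?lam r z\<bar> \<le> (\<Sum>(i, c, g)\<leftarrow>fst r. \<bar>c\<bar>) * R" by (rule row_apply_bound[OF z])
    also have "\<dots> \<le> int l * R"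
    proof (rule mult_right_mono)
      show "(\<Sum>(i, c, g)\<leftarrow>fst r. \<bar>c\<bar>) \<le> int l" using r by (intro l(2)) auto
      show "0 \<le> R" using z[of undefined] by linarith
    qed
    finally show ?thesis .
  qed
  have injz: "z = (\<lambda>e. 0)" if z: "\<And>e. e \<notin> ?E \<Longrightarrow> z e = 0" "\<And>r. r \<in> ?B \<Longrightarrow> ?lam r z = 0" "\<And>j. j \<in> J \<Longrightarrow> z j = 0" for z
  proof -
    have "(\<lambda>e. real_of_int (z e)) = (\<lambda>e. 0)"
    proof (rule injK)
      show "(\<lambda>e. real_of_int (z e)) \<in> K"
        using z(1) z(2) by (force simp: K_def row_apply_of_int)
    qed (simp add: z(3))
    then show ?thesis by (simp add: fun_eq_iff)
  qed
  have finS: "finite S"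
    unfolding S_def by (rule card_solutions_mod_le(1)[OF finE J p0 l(1), where lam = ?lam, OF diff bound injz])
  have "card S \<le> l ^ card ?E * p ^ card J"
    unfolding S_def by (rule card_solutions_mod_le(2)[OF finE J p0 l(1), where lam = ?lam, OF diff bound injz])
  moreover have "p ^ ?b \<le> card S"
  proof -
    interpret H: group "G\<lparr>carrier := N\<rparr>" by (rule subgroup.subgroup_is_group[OF N(2) group_axioms])
    obtain T where T: "finite T" "T \<subseteq> N" "N \<subseteq> generate (G\<lparr>carrier := N\<rparr>) T"
      using stabilizer_finitely_generated[where s = s and d = d, OF s gen X N(1)] by blast
    have "\<exists>(C :: (('g list \<Rightarrow> int) set \<Rightarrow> int) set) (\<phi> :: (('g list \<Rightarrow> int) set \<Rightarrow> int) \<Rightarrow> 'g \<Rightarrow> int).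
      finite C \<and> card C = p ^ ?b \<and>
      (\<forall>c\<in>C. \<forall>g\<in>carrier (G\<lparr>carrier := N\<rparr>). \<forall>h\<in>carrier (G\<lparr>carrier := N\<rparr>).
        [\<phi> c (g \<otimes>\<^bsub>G\<lparr>carrier := N\<rparr>\<^esub> h) = \<phi> c g + \<phi> c h] (mod int p)) \<and>
      (\<forall>c\<in>C. \<forall>c'\<in>C. (\<forall>g\<in>carrier (G\<lparr>carrier := N\<rparr>). [\<phi> c g = \<phi> c' g] (mod int p)) \<longrightarrow> c = c')"
      by (rule H.homs_of_betti_number[OF p T(1)]) (use T in simp_all)
    then obtain C :: "(('g list \<Rightarrow> int) set \<Rightarrow> int) set" and \<phi> where C: "finite C" "card C = p ^ ?b"
      and hom: "\<forall>c\<in>C. \<forall>g\<in>N. \<forall>h\<in>N. [\<phi> c (g \<otimes> h) = \<phi> c g + \<phi> c h] (mod int p)"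
      and inj: "\<forall>c\<in>C. \<forall>c'\<in>C. (\<forall>g\<in>N. [\<phi> c g = \<phi> c' g] (mod int p)) \<longrightarrow> c = c'"
      by auto
    have "card C \<le> card S"
    proof (rule card_homs_le_card_cochains[OF S_def s gen X N(1) p0 C(1) finS])
      show "[\<phi> c (g \<otimes> h) = \<phi> c g + \<phi> c h] (mod int p)" if "c \<in> C" "g \<in> N" "h \<in> N" for c g h
        using hom that by simp
      show "c = c'" if "c \<in> C" "c' \<in> C" "\<And>g. g \<in> N \<Longrightarrow> [\<phi> c g = \<phi> c' g] (mod int p)" for c c'
        using inj that by simp
    qed
    then show ?thesis by (simp only: C(2))
  qed
  ultimately have "p ^ ?b \<le> l ^ card ?E * p ^ card J" by linarith
  then have "real (p ^ ?b) \<le> real (l ^ card ?E * p ^ card J)" by (simp only: of_nat_le_iff)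
  then have "ln (real (p ^ ?b)) \<le> ln (real (l ^ card ?E * p ^ card J))"
    using p0 l(1) by (subst ln_le_cancel_iff) auto
  also have "ln (real (l ^ card ?E * p ^ card J)) = real (card ?E) * ln (real l) + real (card J) * ln (real p)"
    using p0 l(1) by (simp add: ln_mult ln_realpow)
  also have "ln (real (p ^ ?b)) = real ?b * ln (real p)"
    using p0 by (simp add: ln_realpow)
  finally have "real ?b * ln (real p) \<le> real (card ?E) * ln (real l) + real (card J) * ln (real p)" .
  also have "\<dots> \<le> real (card ?E) * ln (real l) + real (card X) * \<tau> * ln (real p)"
    using cardJ p0 by (intro add_left_mono mult_right_mono) auto
  also have "\<dots> = real (card X) * (real d * ln (real l) + \<tau> * ln (real p))"
    by (simp add: card_cartesian_product algebra_simps)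
  finally show ?thesis .
qed

end

text \<open>
  Adding the inverses of the generators makes positive words suffice.
\<close>

lemma (in group) generating_words:
  assumes S: "finite S" "S \<subseteq> carrier G" "generate G S = carrier G"
  obtains s d where "\<And>i. i < d \<Longrightarrow> s i \<in> carrier G" "inj_on s {..<d}"
    "\<And>g. g \<in> carrier G \<Longrightarrow> \<exists>w. set w \<subseteq> {..<d} \<and> word_prod G s w = g"
proof -
  define S' where "S' = S \<union> (\<lambda>g. inv g) ` S"
  have S': "finite S'" "S' \<subseteq> carrier G" using S by (auto simp: S'_def)
  obtain s where s: "bij_betw s {0..<card S'} S'" using ex_bij_betw_nat_finite[OF S'(1)] by blast
  define d where "d = card S'"
  have b: "bij_betw s {..<d} S'" using s by (simp add: d_def atLeast0LessThan)
  have sc: "s i \<in> carrier G" if "i < d" for i using b S'(2) that by (auto simp: bij_betw_def)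
  have one: "\<exists>w. set w \<subseteq> {..<d} \<and> word_prod G s w = g" if g: "g \<in> S'" for g
  proof -
    obtain i where "i < d" "s i = g" using b g by (auto simp: bij_betw_def)
    then show ?thesis using sc[of i] by (intro exI[of _ "[i]"]) auto
  qed
  have "\<exists>w. set w \<subseteq> {..<d} \<and> word_prod G s w = g" if "g \<in> generate G S" for g
    using that
  proof (induction rule: generate.induct)
    case one then show ?case by (intro exI[of _ "[]"]) simp
  next
    case (incl h) then show ?case by (intro one) (simp add: S'_def)
  next
    case (inv h) then show ?case by (intro one) (simp add: S'_def)
  next
    case (eng h1 h2)
    then obtain v w where vw: "set v \<subseteq> {..<d}" "word_prod G s v = h1" "set w \<subseteq> {..<d}" "word_prod G s w = h2" by blast
    then show ?case
      using word_prod_append[where s = s and d = d, OF sc vw(1,3)] by (intro exI[of _ "v @ w"]) auto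
  qed
  then show thesis using sc b S(3) by (intro that[of d s]) (auto simp: bij_betw_def)
qed

lemma (in group) coset_action:
  assumes N: "N \<lhd> G"
  shows "right_action G (rcosets N) (\<lambda>C g. C #> g)"
proof -
  interpret N: normal N G by (rule N)
  show ?thesis
  proof unfold_locales
    fix C g h assume C: "C \<in> rcosets N" and g: "g \<in> carrier G"
    then obtain a where a: "a \<in> carrier G" "C = N #> a" by (auto simp: RCOSETS_def)
    show "C #> g \<in> rcosets N"
      using a g by (simp add: coset_mult_assoc[OF N.subset] rcosetsI[OF N.subset])
    show "C #> g #> h = C #> (g \<otimes> h)" if "h \<in> carrier G"
      using a g that by (simp add: coset_mult_assoc[OF N.subset] m_assoc)
  next
    fix C assume C: "C \<in> rcosets N"
    then obtain a where a: "a \<in> carrier G" "C = N #> a" by (auto simp: RCOSETS_def)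
    show "C #> \<one> = C" using a by (simp add: coset_mult_assoc[OF N.subset])
  qed
qed

text \<open>
  The stabilizer of a coset \<open>N a\<close> is the conjugate of \<open>N\<close> by \<open>a\<close>, which is \<open>N\<close> for \<open>N\<close> normal.
\<close>

lemma (in group) coset_fixed:
  assumes N: "N \<lhd> G" and C: "C \<in> rcosets N" and h: "h \<in> carrier G" and eq: "C #> h = C"
  shows "h \<in> N"
proof -
  interpret N: normal N G by (rule N)
  obtain a where a: "a \<in> carrier G" "C = N #> a" using C by (auto simp: RCOSETS_def)
  have "N #> (a \<otimes> h) = N #> a" using eq a h by (simp add: coset_mult_assoc[OF N.subset])
  then have "a \<otimes> h \<in> N #> a" using rcos_self[of "a \<otimes> h" N] a h N.subgroup_axioms by simp
  then obtain n where n: "n \<in> N" "a \<otimes> h = n \<otimes> a" by (auto simp: r_coset_def)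
  have nc: "n \<in> carrier G" using n(1) N.subset by blast
  have "h = inv a \<otimes> (a \<otimes> h)" using a h by (simp add: m_assoc[symmetric])
  also have "\<dots> = inv a \<otimes> n \<otimes> a" unfolding n(2) using a nc by (simp add: m_assoc)
  also have "\<dots> \<in> N" using N.inv_op_closed1[OF a(1) n(1)] .
  finally show ?thesis .
qed

text \<open>
  Each element of \<open>F\<close> other than the neutral element is missing from some member of the chain, and
  then from all later ones.
\<close>

lemma residual_chain_avoids:
  assumes "residual_chain G N" "finite F"
  shows "\<exists>i0. \<forall>i\<ge>i0. N i \<inter> F \<subseteq> {\<one>\<^bsub>G\<^esub>}"
  using assms(2)
proof (induction F)
  case empty then show ?case by simp
next
  case (insert f F)
  then obtain i0 where i0: "\<forall>i\<ge>i0. N i \<inter> F \<subseteq> {\<one>\<^bsub>G\<^esub>}" by blast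
  have dec: "N i \<subseteq> N j" if "j \<le> i" for i j
    using that
  proof (induction rule: dec_induct)
    case (step n)
    have "N (Suc n) \<subseteq> N n" using assms(1) unfolding residual_chain_def by (elim conjE allE[of _ n])
    with step.IH show ?case by (rule order_trans[rotated])
  qed simp
  show ?case
  proof (cases "f = \<one>\<^bsub>G\<^esub>")
    case True then show ?thesis using i0 by (intro exI[of _ i0]) auto
  next
    case False
    then have "f \<notin> (\<Inter>i. N i)" using assms(1) by (simp add: residual_chain_def)
    then obtain j where j: "f \<notin> N j" by blast
    have "N i \<inter> insert f F \<subseteq> {\<one>\<^bsub>G\<^esub>}" if i: "i \<ge> max i0 j" for i
    proof -
      have "f \<notin> N i" using dec[of j i] i j by auto
      moreover have "N i \<inter> F \<subseteq> {\<one>\<^bsub>G\<^esub>}" using i0 i by simp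
      ultimately show ?thesis by simp
    qed
    then show ?thesis by blast
  qed
qed

text \<open>
  The numbers \<open>d\<close>, \<open>l\<close> and \<open>\<tau>\<close> depend only on \<open>G\<close> and the accuracy \<open>e\<close>, so dividing the bound of
  \<open>betti_number_bound\<close> by \<open>[G : N i] ln (p i)\<close> leaves an error that tends to zero with \<open>1 / ln (p i)\<close>.
\<close>

lemma (in group) limsup_betti_numbers_le:
  fixes N :: "nat \<Rightarrow> 'a set" and p :: "nat \<Rightarrow> nat"
  assumes "finitely_generated_group G" "residual_chain G N"
    and "\<And>i. i \<ge> 1 \<Longrightarrow> prime (p i)" "filterlim p at_top sequentially"
  shows "limsup (\<lambda>i. ereal (real (betti_number 1 (G\<lparr>carrier := N i\<rparr>) (residue_ring (int (p i))))
      / real (card (rcosets (N i))))) \<le> l2_betti_number 1 G"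
proof (rule ereal_le_epsilon2)
  fix e :: real assume e: "e > 0"
  obtain S where S: "finite S" "S \<subseteq> carrier G" "generate G S = carrier G"
    using assms(1) by (auto simp: finitely_generated_group_def)
  obtain s d where s: "\<And>i. i < d \<Longrightarrow> s i \<in> carrier G" "inj_on s {..<d}"
    and gen: "\<And>g. g \<in> carrier G \<Longrightarrow> \<exists>w. set w \<subseteq> {..<d} \<and> word_prod G s w = g"
    using generating_words[OF S] by metis
  obtain m k where mk: "ereal (\<Sum>i<d. (norm ((heat_step G (carrier G) (\<lambda>x g. x \<otimes> g) (harmonic_rows G s d m) ^^ k)
      (unit_vec (\<one>, i))))\<^sup>2) \<le> l2_betti_number 1 G + ereal e"
    using harmonic_projection[where s = s and d = d, OF s gen e] by blast
  define \<tau> where "\<tau> = (\<Sum>i<d. (norm ((heat_step G (carrier G) (\<lambda>x g. x \<otimes> g) (harmonic_rows G s d m) ^^ k)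
      (unit_vec (\<one>, i))))\<^sup>2)"
  let ?rs = "harmonic_rows G s d m"
  let ?b = "\<lambda>i. betti_number 1 (G\<lparr>carrier := N i\<rparr>) (residue_ring (int (p i)))"
  let ?n = "\<lambda>i. card (rcosets (N i))"
  define l where "l = nat (1 + (\<Sum>L\<in>?rs. \<Sum>(i, c, g)\<leftarrow>L. \<bar>c\<bar>))"
  have nn: "0 \<le> (\<Sum>(i, c, g)\<leftarrow>L. \<bar>c\<bar>)" for L :: "'a row" by (intro sum_list_nonneg) auto
  have nn': "0 \<le> (\<Sum>L\<in>?rs. \<Sum>(i, c, g)\<leftarrow>L. \<bar>c\<bar>)" by (intro sum_nonneg nn)
  have l0: "l > 0" using nn' by (simp add: l_def)
  have l: "(\<Sum>(i, c, g)\<leftarrow>L. \<bar>c\<bar>) \<le> int l" if "L \<in> ?rs" for L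
  proof -
    have "(\<Sum>(i, c, g)\<leftarrow>L. \<bar>c\<bar>) \<le> (\<Sum>L\<in>?rs. \<Sum>(i, c, g)\<leftarrow>L. \<bar>c\<bar>)"
      by (rule member_le_sum[OF that _ finite_harmonic_rows]) (rule nn)
    then show ?thesis using nn' by (simp add: l_def)
  qed
  let ?F = "propagation G ?rs (2 * k)"
  obtain i0 where i0: "\<forall>i\<ge>i0. N i \<inter> ?F \<subseteq> {\<one>}"
    using residual_chain_avoids[OF assms(2) finite_propagation[OF finite_harmonic_rows]] by blast
  have bound: "real (?b i) / real (?n i) \<le> \<tau> + real d * ln (real l) / ln (real (p i))"
    if i: "i \<ge> max i0 1" for i
  proof -
    have nrm: "N i \<lhd> G" and finX: "finite (rcosets (N i))"
      using assms(2) by (auto simp: residual_chain_def)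
    interpret N: normal "N i" G by (rule nrm)
    interpret act: right_action G "rcosets (N i)" "\<lambda>C g. C #> g" by (rule coset_action[OF nrm])
    interpret self: right_action G "carrier G" "\<lambda>x g. x \<otimes> g" by (rule right_action_self)
    have pr: "prime (p i)" using assms(3) i by simp
    have base: "N i \<in> rcosets (N i)"
      using rcosetsI[OF N.subset one_closed] coset_mult_one[OF N.subset] by simp
    have trans: "\<exists>g\<in>carrier G. N i #> g = C" if "C \<in> rcosets (N i)" for C
      using that by (auto simp: RCOSETS_def)
    have stab: "N i = {g \<in> carrier G. N i #> g = N i}"
      using N.subset coset_join2[OF _ N.subgroup_axioms] coset_fixed[OF nrm base] by blast
    have Fc: "?F \<subseteq> carrier G"
      by (rule self.propagation_closed[where d = d]) (rule self.valid_harmonic_rows[OF s(1)])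
    have free: "h = \<one>" if "C \<in> rcosets (N i)" "h \<in> ?F" "C #> h = C" for C h
      using coset_fixed[OF nrm that(1) _ that(3)] that(2) Fc i0 i by auto
    have main: "real (?b i) * ln (real (p i)) \<le> real (?n i) * (real d * ln (real l) + \<tau> * ln (real (p i)))"
      unfolding \<tau>_def
      by (rule act.betti_number_bound[OF s(1) gen finX base trans stab N.subgroup_axioms pr l0 l free])
    have "card (rcosets (N i)) > 0" using finX base by (auto simp: card_gt_0_iff)
    moreover have "ln (real (p i)) > 0" using prime_gt_1_nat[OF pr] by simp
    ultimately show ?thesis using main by (simp add: field_simps)
  qed
  have lnp: "filterlim (\<lambda>i. ln (real (p i))) at_top sequentially"
    by (rule filterlim_compose[OF ln_at_top filterlim_compose[OF filterlim_real_sequentially assms(4)]])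
  have "(\<lambda>i. \<tau> + real d * ln (real l) / ln (real (p i))) \<longlonglongrightarrow> \<tau> + 0"
    by (intro tendsto_add tendsto_const real_tendsto_divide_at_top[OF tendsto_const lnp])
  then have lim: "(\<lambda>i. ereal (\<tau> + real d * ln (real l) / ln (real (p i)))) \<longlonglongrightarrow> ereal \<tau>" by simp
  have "limsup (\<lambda>i. ereal (real (?b i) / real (?n i))) \<le> limsup (\<lambda>i. ereal (\<tau> + real d * ln (real l) / ln (real (p i))))"
    by (rule Limsup_mono, rule eventually_sequentiallyI[of "max i0 1"]) (use bound in simp)
  also have "\<dots> = ereal \<tau>" by (rule lim_imp_Limsup[OF _ lim]) simp
  also have "\<dots> \<le> l2_betti_number 1 G + ereal e" using mk by (simp only: \<tau>_def)
  finally show "limsup (\<lambda>i. ereal (real (?b i) / real (?n i))) \<le> l2_betti_number 1 G + ereal e" .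
qed

theorem proposition3p2:
  fixes G :: "('g, 'm) monoid_scheme" and N :: "nat \<Rightarrow> 'g set" and p :: "nat \<Rightarrow> nat"
  assumes "finitely_generated_group G"
    and "residual_chain G N"
    and "\<And>i. i \<ge> 1 \<Longrightarrow> prime (p i)"
    and "filterlim p at_top sequentially"
  shows "l2_betti_number 1 G \<ge>
    limsup (\<lambda>i. ereal (real (betti_number 1 (G\<lparr>carrier := N i\<rparr>) (residue_ring (int (p i))))
                     / real (card (rcosets\<^bsub>G\<^esub> (N i)))))"
proof -
  interpret group G using assms(1) by (simp add: finitely_generated_group_def)
  show ?thesis by (rule limsup_betti_numbers_le[OF assms])
qed

end
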